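(* Let $d\ge1$, $T=(T_1,\dots,T_d)$ with $T_i>0$, $[0,T]=\prod_{i=1}^d[0,T_i]$, and let $\{\theta_n\}_{n\in\mathbb{N}}$ be the Kac-Stroock kernels $$\theta_n(t)=n^{\frac d2}\left(\prod_{i=1}^dt_i\right)^{\frac{d-1}{2}}(-1)^{N_n(t)},\qquad t\in[0,T],$$ where $N_n$ is a $d$-parameter Poisson process with intensity $n$. Then for any $q>1$ and any even integer $m\in\mathbb{N}$ there is a positive constant $C$, independent of $n$ and $g$, such that for every $n\in\mathbb{N}$ and every simple function $g$ on $[0,T]$, $$\mathbb{E}\left[\left(\int_{[0,T]}g(u)\theta_n(u)\,du\right)^m\right]\le C\left(\int_{[0,T]}|g(u)|^{2q}\,du\right)^{\frac{m}{2q}}.$$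
   Context: Simple functions are those of the form $g=\sum_{j=1}^k a_j\mathbb{I}_{A_j}$ with $a_j\in\mathbb{R}$ and $A_1,\dots,A_k\subset[0,T]$ disjoint rectangles $A_j=(s_1^j,t_1^j]\times\cdots\times(s_d^j,t_d^j]$, $s_i^j<t_i^j$. For $s,t\in\mathbb{R}^d$, $s<t$ means $s_i<t_i$ for all $i$, and $\Delta_sX(t)$ denotes the increment of $X$ over the rectangle $(s,t]=\prod_{i=1}^d(s_i,t_i]$ (alternating sum over the vertices; $X(t)-X(s)$ if $d=1$). Given a filtration $\{\mathscr{F}_t:t\in[0,T]\}$ ($\mathscr{F}_s\subset\mathscr{F}_t$ if $s\le t$ coordinatewise), set $\mathscr{F}_t^T=\bigvee_{i=1}^d\mathscr{F}_{T_1,\dots,T_{i-1},t_i,T_{i+1},\dots,T_d}$. A $d$-parameter càdlàg process $N_\mu=\{N_\mu(t):t\in[0,T]\}$ is a Poisson process with intensity $\mu>0$ if it is null on the axes and, for all $0\le s<t$, $\Delta_sN_\mu(t)$ is independent of $\mathscr{F}_s^T$ and has a Poisson law of parameter $\mu\prod_{i=1}^d(t_i-s_i)$. The filtration is the one generated by the process itself, completed with the null sets. *)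

theory Defs
  imports "HOL-Probability.Probability"
begin

text \<open>
  The parameter space is \<^typ>\<open>real ^ 'd\<close>, so that the number of parameters is \<open>CARD('d)\<close>.
  The library order on vectors is the coordinatewise one, hence \<open>{0..T}\<close> is the product
  of the intervals \<open>[0, T\<^sub>i]\<close>. The library's \<open><\<close> is however not the coordinatewise strict
  order, which is therefore always written out.
\<close>

definition rect :: "real ^ 'd \<Rightarrow> real ^ 'd \<Rightarrow> (real ^ 'd) set" where
  "rect s t = {u. \<forall>i. s $ i < u $ i \<and> u $ i \<le> t $ i}"

definition simple_fun_on :: "real ^ 'd \<Rightarrow> (real ^ 'd \<Rightarrow> real) \<Rightarrow> bool" where
  "simple_fun_on T g \<longleftrightarrow>
     (\<exists>(k::nat) (a :: nat \<Rightarrow> real) (s :: nat \<Rightarrow> real ^ 'd) (t :: nat \<Rightarrow> real ^ 'd).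
        (\<forall>j<k. (\<forall>i. s j $ i < t j $ i) \<and> rect (s j) (t j) \<subseteq> {0..T}) \<and>
        disjoint_family_on (\<lambda>j. rect (s j) (t j)) {..<k} \<and>
        g = (\<lambda>u. \<Sum>j<k. a j * indicator (rect (s j) (t j)) u))"

text \<open>The set \<open>S\<close> collects the coordinates in which a vertex of the rectangle agrees with \<open>s\<close>.\<close>

definition increment :: "(real ^ 'd \<Rightarrow> real) \<Rightarrow> real ^ 'd \<Rightarrow> real ^ 'd \<Rightarrow> real" where
  "increment x s t =
     (\<Sum>S\<in>(UNIV :: 'd set set). (-1) ^ card S * x (\<chi> i. if i \<in> S then s $ i else t $ i))"

text \<open>
  The multiparameter cadlag property: at every point the limits from all \<open>2\<^sup>d\<close> quadrants
  exist, and the limit from the closed upper quadrant is the value at the point. The set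
  \<open>S\<close> collects the coordinates which are approached strictly from below. If no point of
  \<open>[0, T]\<close> lies in a quadrant, then the limit condition is void.
\<close>

definition cadlag_on :: "real ^ 'd \<Rightarrow> (real ^ 'd \<Rightarrow> real) \<Rightarrow> bool" where
  "cadlag_on T x \<longleftrightarrow>
     (\<forall>t\<in>{0..T}.
        (x \<longlongrightarrow> x t) (at t within {u\<in>{0..T}. t \<le> u}) \<and>
        (\<forall>S :: 'd set. \<exists>l.
           (x \<longlongrightarrow> l) (at t within
              {u\<in>{0..T}. \<forall>i. if i \<in> S then u $ i < t $ i else t $ i \<le> u $ i})))"

definition filtration_on :: "'w measure \<Rightarrow> real ^ 'd \<Rightarrow> (real ^ 'd \<Rightarrow> 'w measure) \<Rightarrow> bool" where
  "filtration_on M T F \<longleftrightarrow>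
     (\<forall>t\<in>{0..T}. subalgebra M (F t)) \<and>
     (\<forall>s\<in>{0..T}. \<forall>t\<in>{0..T}. s \<le> t \<longrightarrow> sets (F s) \<subseteq> sets (F t))"

definition strong_past ::
    "'w measure \<Rightarrow> real ^ 'd \<Rightarrow> (real ^ 'd \<Rightarrow> 'w measure) \<Rightarrow> real ^ 'd \<Rightarrow> 'w measure" where
  "strong_past M T F t =
     sigma (space M) (\<Union>i. sets (F (\<chi> j. if j = i then t $ j else T $ j)))"

definition natural_filtration ::
    "'w measure \<Rightarrow> (real ^ 'd \<Rightarrow> 'w \<Rightarrow> real) \<Rightarrow> real ^ 'd \<Rightarrow> 'w measure" where
  "natural_filtration M X t =
     sigma (space M)
       ({X r -` A \<inter> space M | r A. r \<in> {0..t} \<and> A \<in> sets borel} \<union> null_sets M)"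

definition poisson_process ::
    "'w measure \<Rightarrow> real ^ 'd \<Rightarrow> (real ^ 'd \<Rightarrow> 'w measure) \<Rightarrow> real \<Rightarrow> (real ^ 'd \<Rightarrow> 'w \<Rightarrow> real) \<Rightarrow> bool"
where
  "poisson_process M T F \<mu> X \<longleftrightarrow>
     prob_space M \<and> filtration_on M T F \<and> 0 < \<mu> \<and>
     (\<forall>t\<in>{0..T}. X t \<in> borel_measurable M) \<and>
     (\<forall>\<omega>\<in>space M. cadlag_on T (\<lambda>t. X t \<omega>)) \<and>
     (\<forall>\<omega>\<in>space M. \<forall>t\<in>{0..T}. (\<exists>i. t $ i = 0) \<longrightarrow> X t \<omega> = 0) \<and>
     (\<forall>s\<in>{0..T}. \<forall>t\<in>{0..T}. (\<forall>i. s $ i < t $ i) \<longrightarrow>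
        (let D = (\<lambda>\<omega>. increment (\<lambda>r. X r \<omega>) s t) in
           prob_space.indep_set M
             (sets (vimage_algebra (space M) D borel)) (sets (strong_past M T F s)) \<and>
           distr M borel D =
             distr (measure_pmf (poisson_pmf (\<mu> * (\<Prod>i\<in>UNIV. t $ i - s $ i)))) borel real))"

text \<open>
  \<open>x\<^bsup>(d-1)/2\<^esup>\<close> is written as a natural power of \<open>sqrt x\<close>, since for \<open>d = 1\<close> and
  \<open>x = 0\<close> its value is 1, whereas \<open>0 powr 0 = 0\<close>.
\<close>

definition kac_stroock :: "nat \<Rightarrow> (real ^ 'd \<Rightarrow> 'w \<Rightarrow> nat) \<Rightarrow> real ^ 'd \<Rightarrow> 'w \<Rightarrow> real" where
  "kac_stroock n N t \<omega> =
     real n powr (real CARD('d) / 2) * sqrt (\<Prod>i\<in>UNIV. t $ i) ^ (CARD('d) - 1) * (-1) ^ N t \<omega>"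

lemma filtration_on_natural_filtration:
  assumes "\<And>t. t \<in> {0..T} \<Longrightarrow> X t \<in> borel_measurable M"
  shows "filtration_on M T (natural_filtration M X)"
proof -
  let ?G = "\<lambda>t. {X r -` A \<inter> space M | r A. r \<in> {0..t} \<and> A \<in> sets borel} \<union> null_sets M"
  have sp: "?G t \<subseteq> Pow (space M)" for t
    using sets.sets_into_space by (fastforce dest: null_setsD2)
  have "?G t \<subseteq> sets M" if "t \<in> {0..T}" for t
  proof -
    have "X r -` A \<inter> space M \<in> sets M" if "r \<in> {0..t}" "A \<in> sets borel" for r A
      using assms[of r] that \<open>t \<in> {0..T}\<close>
      by (meson atLeastAtMost_iff measurable_sets order_trans)
    then show ?thesis by auto
  qed
  then have "subalgebra M (natural_filtration M X t)" if "t \<in> {0..T}" for t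
    using that sp[of t]
    by (simp add: subalgebra_def natural_filtration_def space_measure_of sets_measure_of
        sets.sigma_sets_subset)
  moreover have "sets (natural_filtration M X s) \<subseteq> sets (natural_filtration M X t)"
    if "s \<le> t" for s t
  proof -
    have "?G s \<subseteq> ?G t"
      using that by (fastforce intro: order_trans)
    then show ?thesis
      using sp[of s] sp[of t]
      by (simp add: natural_filtration_def sets_measure_of sigma_sets_mono')
  qed
  ultimately show ?thesis
    by (simp add: filtration_on_def)
qed

end

theory Submission
  imports Defs "HOL-Combinatorics.Permutations"
begin

text \<open>
  Write \<open>m = 2h\<close>. Expanding the \<open>m\<close>-th moment leads to the expectations of products
  \<open>\<Prod>\<^sub>j (-1)\<^bsup>N(u\<^sub>j)\<^esup>\<close>. On the grid spanned by the coordinates of the \<open>u\<^sub>j\<close> the increments over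
  the cells are independent, so that such an expectation is \<open>exp (- 2 n |A|)\<close>, where \<open>A\<close> is the
  set of points that lie in an odd number of the boxes \<open>[0, u\<^sub>j]\<close>. If all \<open>u\<^sub>j\<close> are bounded below by
  \<open>L\<close>, then \<open>A\<close> contains, for every direction \<open>i\<close>, slabs of cross section \<open>\<Prod>\<^sub>k\<^sub>\<noteq>\<^sub>i L\<^sub>k\<close> between the
  order statistics \<open>2r - 1\<close> and \<open>2r\<close> of the \<open>i\<close>-th coordinates. Hence the expectation is at most a
  product over \<open>i\<close> of sums, over the pairings of the indices, of exponential kernels. Such a kernel
  satisfies a multilinear Cauchy-Schwarz inequality, one coordinate after the other, even though the
  pairings in different directions are unrelated.

  On a dyadic box, where \<open>L \<le> u \<le> 2 L\<close>, the weights of the Kac-Stroock kernel match the factors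
  \<open>\<Prod>\<^sub>k\<^sub>\<noteq>\<^sub>i L\<^sub>k\<close> exactly, and the moment is at most \<open>C (\<integral>g\<^sup>2)\<^bsup>h\<^esup>\<close> with a constant that depends neither
  on the box nor on \<open>n\<close>. Hoelder's inequality with \<open>q > 1\<close> gains a power of the volume of the box,
  which makes the sum over all dyadic boxes of \<open>[0, T]\<close> converge.
\<close>

section \<open>Multilinear Cauchy-Schwarz bounds\<close>

text \<open>The permutation that sorts the i-th coordinates depends on the whole configuration of
  points, so the pointwise bound takes the sum over all permutations in each direction, at the cost
  of a factor (m!)^d. The boxes answer another obstacle: the slabs have the smallest coordinates as
  cross section, whereas the weight of the kernel involves the actual coordinates. Near the axes the
  two are comparable only if all points stay within a factor 2 of a common corner L. With M_i the
  product of the L_k over k \<noteq> i, the exponential kernel in direction i has mass 1 / (n M_i).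
  Over all directions this gives n^(-d) P^(-(d-1)), where P is the product of all L_k; the square of
  the weight is n^d times the (d-1)-st power of the product of the u_k, so n and P cancel up to a
  factor 2^(d(d-1)). Contributions of different boxes are correlated, hence they are added in the
  norm of L^m, as in Minkowski's inequality, and a geometric decay of the box norms makes that sum
  finite.\<close>

definition ennsqrt :: "ennreal \<Rightarrow> ennreal" where
  "ennsqrt x = (if x = \<top> then \<top> else ennreal (sqrt (enn2real x)))"

lemma measurable_ennsqrt [measurable]: "ennsqrt \<in> borel_measurable borel"
  unfolding ennsqrt_def by measurable

lemma ennsqrt_power2: "(ennsqrt x)\<^sup>2 = x"
  by (cases x) (auto simp: ennsqrt_def power2_eq_square ennreal_mult[symmetric] ennreal_top_mult)

lemma ennreal_power2_le_imp_le:
  fixes x y :: ennreal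
  assumes "x\<^sup>2 \<le> y\<^sup>2"
  shows "x \<le> y"
proof (rule ccontr)
  assume "\<not> x \<le> y"
  then have "y < x" by simp
  then have "y * y < x * x"
    by (cases x; cases y)
      (auto simp: ennreal_mult[symmetric] ennreal_less_iff ennreal_mult_less_top ennreal_top_mult intro!: mult_strict_mono')
  with assms show False by (simp add: power2_eq_square)
qed

lemma prod_mono_ennreal:
  fixes f g :: "'a \<Rightarrow> ennreal"
  shows "(\<And>i. i \<in> A \<Longrightarrow> f i \<le> g i) \<Longrightarrow> prod f A \<le> prod g A"
  by (induction A rule: infinite_finite_induct) (auto intro!: mult_mono)

text \<open>Boundedness on L2 of the multilinear form with kernel \<open>H\<close>. The functions
  \<open>h j\<close> are allowed to differ, although a single function is inserted at the end: in
  the passage to product spaces they are replaced by their partial L2 norms. With values in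
  \<open>ennreal\<close>, and \<open>ennsqrt\<close> sending \<infinity> to \<infinity>,
  measurability is the only side condition.\<close>

definition cs_bound :: "'i set \<Rightarrow> 'a measure \<Rightarrow> (('i \<Rightarrow> 'a) \<Rightarrow> ennreal) \<Rightarrow> ennreal \<Rightarrow> bool" where
  "cs_bound I A H C \<longleftrightarrow>
     H \<in> borel_measurable (PiM I (\<lambda>_. A)) \<and>
     (\<forall>h. (\<forall>j\<in>I. h j \<in> borel_measurable A) \<longrightarrow>
        (\<integral>\<^sup>+x. (\<Prod>j\<in>I. h j (x j)) * H x \<partial>PiM I (\<lambda>_. A))
          \<le> C * (\<Prod>j\<in>I. ennsqrt (\<integral>\<^sup>+x. (h j x)\<^sup>2 \<partial>A)))"

lemma cs_boundD:
  assumes "cs_bound I A H C" "\<And>j. j \<in> I \<Longrightarrow> h j \<in> borel_measurable A"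
  shows "(\<integral>\<^sup>+x. (\<Prod>j\<in>I. h j (x j)) * H x \<partial>PiM I (\<lambda>_. A))
          \<le> C * (\<Prod>j\<in>I. ennsqrt (\<integral>\<^sup>+x. (h j x)\<^sup>2 \<partial>A))"
  using assms unfolding cs_bound_def by blast

lemma cs_bound_measurable: "cs_bound I A H C \<Longrightarrow> H \<in> borel_measurable (PiM I (\<lambda>_. A))"
  unfolding cs_bound_def by blast

lemma cs_boundI:
  assumes "H \<in> borel_measurable (PiM I (\<lambda>_. A))"
    and "\<And>h. (\<And>j. j \<in> I \<Longrightarrow> h j \<in> borel_measurable A) \<Longrightarrow>
      (\<integral>\<^sup>+x. (\<Prod>j\<in>I. h j (x j)) * H x \<partial>PiM I (\<lambda>_. A))
          \<le> C * (\<Prod>j\<in>I. ennsqrt (\<integral>\<^sup>+x. (h j x)\<^sup>2 \<partial>A))"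
  shows "cs_bound I A H C"
  using assms unfolding cs_bound_def by blast

lemma cs_bound_cong:
  assumes "cs_bound I A H C" "\<And>x. x \<in> space (PiM I (\<lambda>_. A)) \<Longrightarrow> H x = H' x"
  shows "cs_bound I A H' C"
proof (rule cs_boundI)
  show "H' \<in> borel_measurable (PiM I (\<lambda>_. A))"
    using cs_bound_measurable[OF assms(1)] assms(2) by (subst measurable_cong[of _ _ H]) auto
next
  fix h :: "'a \<Rightarrow> 'b \<Rightarrow> ennreal" assume h: "\<And>j. j \<in> I \<Longrightarrow> h j \<in> borel_measurable A"
  have "(\<integral>\<^sup>+x. (\<Prod>j\<in>I. h j (x j)) * H' x \<partial>PiM I (\<lambda>_. A)) = (\<integral>\<^sup>+x. (\<Prod>j\<in>I. h j (x j)) * H x \<partial>PiM I (\<lambda>_. A))"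
    by (rule nn_integral_cong) (simp add: assms(2))
  then show "(\<integral>\<^sup>+x. (\<Prod>j\<in>I. h j (x j)) * H' x \<partial>PiM I (\<lambda>_. A)) \<le> C * (\<Prod>j\<in>I. ennsqrt (\<integral>\<^sup>+x. (h j x)\<^sup>2 \<partial>A))"
    using cs_boundD[OF assms(1) h] by simp
qed

lemma cs_bound_sum:
  assumes "finite S" "\<And>s. s \<in> S \<Longrightarrow> cs_bound I A (H s) C" "finite I"
  shows "cs_bound I A (\<lambda>x. \<Sum>s\<in>S. H s x) (of_nat (card S) * C)"
proof (rule cs_boundI)
  have m[measurable]: "s \<in> S \<Longrightarrow> H s \<in> borel_measurable (PiM I (\<lambda>_. A))" for s
    using assms(2) cs_bound_measurable by blast
  show "(\<lambda>x. \<Sum>s\<in>S. H s x) \<in> borel_measurable (PiM I (\<lambda>_. A))"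
    by measurable
  fix h :: "'b \<Rightarrow> 'c \<Rightarrow> ennreal" assume h[measurable]: "\<And>j. j \<in> I \<Longrightarrow> h j \<in> borel_measurable A"
  have "(\<integral>\<^sup>+x. (\<Prod>j\<in>I. h j (x j)) * (\<Sum>s\<in>S. H s x) \<partial>PiM I (\<lambda>_. A))
      = (\<Sum>s\<in>S. \<integral>\<^sup>+x. (\<Prod>j\<in>I. h j (x j)) * H s x \<partial>PiM I (\<lambda>_. A))"
    unfolding sum_distrib_left
  proof (rule nn_integral_sum)
    fix s assume "s \<in> S"
    note m[OF this, measurable]
    show "(\<lambda>x. (\<Prod>j\<in>I. h j (x j)) * H s x) \<in> borel_measurable (PiM I (\<lambda>_. A))"
      by measurable
  qed
  also have "\<dots> \<le> (\<Sum>s\<in>S. C * (\<Prod>j\<in>I. ennsqrt (\<integral>\<^sup>+x. (h j x)\<^sup>2 \<partial>A)))"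
    by (intro sum_mono cs_boundD assms(2) h)
  also have "\<dots> = of_nat (card S) * C * (\<Prod>j\<in>I. ennsqrt (\<integral>\<^sup>+x. (h j x)\<^sup>2 \<partial>A))"
    by (simp add: mult.assoc)
  finally show "(\<integral>\<^sup>+x. (\<Prod>j\<in>I. h j (x j)) * (\<Sum>s\<in>S. H s x) \<partial>PiM I (\<lambda>_. A))
    \<le> of_nat (card S) * C * (\<Prod>j\<in>I. ennsqrt (\<integral>\<^sup>+x. (h j x)\<^sup>2 \<partial>A))" .
qed

section \<open>Tensorisation of the bounds\<close>

lemma PiM_distr:
  assumes I: "finite I" and "sigma_finite_measure A" and f[measurable]: "f \<in> measurable A B"
    and "sigma_finite_measure (distr A B f)"
  shows "PiM I (\<lambda>_. distr A B f) = distr (PiM I (\<lambda>_. A)) (PiM I (\<lambda>_. B)) (\<lambda>x. \<lambda>j\<in>I. f (x j))"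
proof -
  interpret A: product_sigma_finite "\<lambda>_. A" using assms(2) by (simp add: product_sigma_finite_def)
  interpret D: product_sigma_finite "\<lambda>_. distr A B f" using assms(4) by (simp add: product_sigma_finite_def)
  show ?thesis
  \<comment> \<open>Sigma-finiteness of the image, which is not inherited from \<open>A\<close>,
    makes a measure with these values on boxes unique.\<close>
  proof (rule D.PiM_eqI[symmetric, OF I])
    show "sets (distr (PiM I (\<lambda>_. A)) (PiM I (\<lambda>_. B)) (\<lambda>x. \<lambda>j\<in>I. f (x j))) = sets (PiM I (\<lambda>_. distr A B f))"
      by (simp cong: sets_PiM_cong)
    fix E :: "'a \<Rightarrow> 'c set" assume E: "\<And>j. j \<in> I \<Longrightarrow> E j \<in> sets (distr A B f)"
    then have E': "\<And>j. j \<in> I \<Longrightarrow> E j \<in> sets B" by simp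
    have eq: "(\<lambda>x. \<lambda>j\<in>I. f (x j)) -` PiE I E \<inter> space (PiM I (\<lambda>_. A)) = PiE I (\<lambda>j. f -` E j \<inter> space A)"
      by (auto simp: space_PiM PiE_iff)
    have "emeasure (distr (PiM I (\<lambda>_. A)) (PiM I (\<lambda>_. B)) (\<lambda>x. \<lambda>j\<in>I. f (x j))) (PiE I E)
      = emeasure (PiM I (\<lambda>_. A)) (PiE I (\<lambda>j. f -` E j \<inter> space A))"
      using E' I by (subst emeasure_distr) (auto simp: eq intro!: sets_PiM_I_finite)
    also have "\<dots> = (\<Prod>j\<in>I. emeasure A (f -` E j \<inter> space A))"
      using E' I f by (intro A.emeasure_PiM) (auto intro: measurable_sets)
    also have "\<dots> = (\<Prod>j\<in>I. emeasure (distr A B f) (E j))"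
      using E' by (intro prod.cong refl) (simp add: emeasure_distr)
    finally show "emeasure (distr (PiM I (\<lambda>_. A)) (PiM I (\<lambda>_. B)) (\<lambda>x. \<lambda>j\<in>I. f (x j))) (PiE I E)
      = (\<Prod>j\<in>I. emeasure (distr A B f) (E j))" .
  qed
qed

text \<open>Integrating all second components at once requires the product of pairs to be regrouped
  as a pair of products. Uniqueness reduces this to boxes whose sides \<open>E j\<close> are
  arbitrary measurable sets of pairs, so their sections are integrated by Tonelli.\<close>

lemma PiM_pair_measure:
  assumes I: "finite I" and sA: "sigma_finite_measure A" and sB: "sigma_finite_measure B"
  shows "PiM I (\<lambda>_. A \<Otimes>\<^sub>M B) =
    distr (PiM I (\<lambda>_. A) \<Otimes>\<^sub>M PiM I (\<lambda>_. B)) (PiM I (\<lambda>_. A \<Otimes>\<^sub>M B)) (\<lambda>(x, y). \<lambda>j\<in>I. (x j, y j))"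
proof -
  interpret A: product_sigma_finite "\<lambda>_. A" using sA by (simp add: product_sigma_finite_def)
  interpret B: product_sigma_finite "\<lambda>_. B" using sB by (simp add: product_sigma_finite_def)
  interpret B1: sigma_finite_measure B by fact
  interpret A1: sigma_finite_measure A by fact
  interpret AB: pair_sigma_finite A B ..
  interpret P: product_sigma_finite "\<lambda>_. A \<Otimes>\<^sub>M B"
    using AB.P.sigma_finite_measure_axioms by (simp add: product_sigma_finite_def)
  interpret BI: sigma_finite_measure "PiM I (\<lambda>_. B)" by (rule B.sigma_finite[OF I])
  have m[measurable]: "(\<lambda>(x, y). \<lambda>j\<in>I. (x j, y j)) \<in>
    measurable (PiM I (\<lambda>_. A) \<Otimes>\<^sub>M PiM I (\<lambda>_. B)) (PiM I (\<lambda>_. A \<Otimes>\<^sub>M B))"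
    by measurable
  show ?thesis
  proof (rule P.PiM_eqI[symmetric, OF I])
    fix E :: "'a \<Rightarrow> ('b \<times> 'c) set" assume E[measurable]: "\<And>j. j \<in> I \<Longrightarrow> E j \<in> sets (A \<Otimes>\<^sub>M B)"
    have EI[measurable]: "PiE I E \<in> sets (PiM I (\<lambda>_. A \<Otimes>\<^sub>M B))"
      using I E by (intro sets_PiM_I_finite) auto
    have [measurable]: "(\<lambda>x. indicator (E j) x :: ennreal) \<in> borel_measurable (A \<Otimes>\<^sub>M B)" if "j \<in> I" for j
      using E[OF that] by simp
    have "emeasure (distr (PiM I (\<lambda>_. A) \<Otimes>\<^sub>M PiM I (\<lambda>_. B)) (PiM I (\<lambda>_. A \<Otimes>\<^sub>M B)) (\<lambda>(x, y). \<lambda>j\<in>I. (x j, y j))) (PiE I E)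
      = (\<integral>\<^sup>+z. indicator (PiE I E) z \<partial>distr (PiM I (\<lambda>_. A) \<Otimes>\<^sub>M PiM I (\<lambda>_. B)) (PiM I (\<lambda>_. A \<Otimes>\<^sub>M B)) (\<lambda>(x, y). \<lambda>j\<in>I. (x j, y j)))"
      by simp
    also have "\<dots> = (\<integral>\<^sup>+(x, y). indicator (PiE I E) (\<lambda>j\<in>I. (x j, y j)) \<partial>(PiM I (\<lambda>_. A) \<Otimes>\<^sub>M PiM I (\<lambda>_. B)))"
      by (subst nn_integral_distr) (auto simp: split_beta')
    also have "\<dots> = (\<integral>\<^sup>+(x, y). (\<Prod>j\<in>I. indicator (E j) (x j, y j)) \<partial>(PiM I (\<lambda>_. A) \<Otimes>\<^sub>M PiM I (\<lambda>_. B)))"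
    proof (rule nn_integral_cong, clarify)
      fix x y
      show "indicator (PiE I E) (\<lambda>j\<in>I. (x j, y j)) = (\<Prod>j\<in>I. indicator (E j) (x j, y j) :: ennreal)"
        using I by (auto simp: indicator_def PiE_iff prod_zero_iff)
    qed
    also have "\<dots> = (\<integral>\<^sup>+x. \<integral>\<^sup>+y. (\<Prod>j\<in>I. indicator (E j) (x j, y j)) \<partial>PiM I (\<lambda>_. B) \<partial>PiM I (\<lambda>_. A))"
      by (subst BI.nn_integral_fst[symmetric]) auto
    also have "\<dots> = (\<integral>\<^sup>+x. (\<Prod>j\<in>I. \<integral>\<^sup>+y. indicator (E j) (x j, y) \<partial>B) \<partial>PiM I (\<lambda>_. A))"
    proof (rule nn_integral_cong)
      fix x assume x: "x \<in> space (PiM I (\<lambda>_. A))"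
      show "(\<integral>\<^sup>+y. (\<Prod>j\<in>I. indicator (E j) (x j, y j)) \<partial>PiM I (\<lambda>_. B)) = (\<Prod>j\<in>I. \<integral>\<^sup>+y. indicator (E j) (x j, y) \<partial>B)"
      proof (rule B.product_nn_integral_prod[OF I])
        fix j assume j: "j \<in> I"
        then have "x j \<in> space A" using x by (auto simp: space_PiM)
        then show "(\<lambda>y. indicator (E j) (x j, y)) \<in> borel_measurable B"
          using E[OF j] by measurable
      qed
    qed
    also have "\<dots> = (\<Prod>j\<in>I. \<integral>\<^sup>+x. \<integral>\<^sup>+y. indicator (E j) (x, y) \<partial>B \<partial>A)"
      using E by (intro A.product_nn_integral_prod[OF I]) measurable
    also have "\<dots> = (\<Prod>j\<in>I. emeasure (A \<Otimes>\<^sub>M B) (E j))"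
      by (intro prod.cong refl) (simp add: sigma_finite_measure.emeasure_pair_measure[OF sB] E)
    finally show "emeasure (distr (PiM I (\<lambda>_. A) \<Otimes>\<^sub>M PiM I (\<lambda>_. B)) (PiM I (\<lambda>_. A \<Otimes>\<^sub>M B)) (\<lambda>(x, y). \<lambda>j\<in>I. (x j, y j))) (PiE I E)
      = (\<Prod>j\<in>I. emeasure (A \<Otimes>\<^sub>M B) (E j))" .
  qed simp
qed

lemma cs_bound_distr:
  assumes cs: "cs_bound I A (\<lambda>x. H (\<lambda>j\<in>I. f (x j))) C" and I: "finite I"
    and A: "sigma_finite_measure A" and f[measurable]: "f \<in> measurable A B"
    and D: "sigma_finite_measure (distr A B f)"
    and H[measurable]: "H \<in> borel_measurable (PiM I (\<lambda>_. B))"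
  shows "cs_bound I (distr A B f) H C"
proof (rule cs_boundI)
  show "H \<in> borel_measurable (PiM I (\<lambda>_. distr A B f))"
    using H by (subst measurable_cong_sets[OF sets_PiM_cong refl, of I I _ "\<lambda>_. B"]) auto
  fix h :: "'a \<Rightarrow> 'c \<Rightarrow> ennreal" assume h: "\<And>j. j \<in> I \<Longrightarrow> h j \<in> borel_measurable (distr A B f)"
  then have h[measurable]: "\<And>j. j \<in> I \<Longrightarrow> h j \<in> borel_measurable B" by simp
  have "(\<integral>\<^sup>+x. (\<Prod>j\<in>I. h j (x j)) * H x \<partial>PiM I (\<lambda>_. distr A B f))
    = (\<integral>\<^sup>+x. (\<Prod>j\<in>I. h j (f (x j))) * H (\<lambda>j\<in>I. f (x j)) \<partial>PiM I (\<lambda>_. A))"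
    unfolding PiM_distr[OF I A f D] by (subst nn_integral_distr) (auto intro!: nn_integral_cong)
  also have "\<dots> \<le> C * (\<Prod>j\<in>I. ennsqrt (\<integral>\<^sup>+x. (h j (f x))\<^sup>2 \<partial>A))"
    by (rule cs_boundD[OF cs, of "\<lambda>j x. h j (f x)"]) measurable
  also have "\<dots> = C * (\<Prod>j\<in>I. ennsqrt (\<integral>\<^sup>+x. (h j x)\<^sup>2 \<partial>distr A B f))"
    by (intro arg_cong2[where f="(*)"] refl prod.cong) (simp add: nn_integral_distr)
  finally show "(\<integral>\<^sup>+x. (\<Prod>j\<in>I. h j (x j)) * H x \<partial>PiM I (\<lambda>_. distr A B f))
    \<le> C * (\<Prod>j\<in>I. ennsqrt (\<integral>\<^sup>+x. (h j x)\<^sup>2 \<partial>distr A B f))" .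
qed

text \<open>With the first components fixed, the bound for \<open>K\<close> applies to the sections
  of the \<open>h j\<close>. Its right-hand side is again a product of functions
  \<open>\<phi> j\<close> of single components, so the bound for \<open>H\<close> applies next, and
  by Tonelli the L2 norm of \<open>\<phi> j\<close> is that of \<open>h j\<close>. Nothing relates
  \<open>H\<close> to \<open>K\<close>; this is what permits unrelated pairings in different
  directions.\<close>

lemma cs_bound_pair:
  assumes H: "cs_bound I A H C" and K: "cs_bound I B K D" and I: "finite I"
    and sA: "sigma_finite_measure A" and sB: "sigma_finite_measure B"
  shows "cs_bound I (A \<Otimes>\<^sub>M B) (\<lambda>z. H (\<lambda>j\<in>I. fst (z j)) * K (\<lambda>j\<in>I. snd (z j))) (C * D)"
proof (rule cs_boundI)
  interpret B1: sigma_finite_measure B by fact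
  interpret B: product_sigma_finite "\<lambda>_. B" using sB by (simp add: product_sigma_finite_def)
  interpret BI: sigma_finite_measure "PiM I (\<lambda>_. B)" by (rule B.sigma_finite[OF I])
  note [measurable] = cs_bound_measurable[OF H] cs_bound_measurable[OF K]
  show "(\<lambda>z. H (\<lambda>j\<in>I. fst (z j)) * K (\<lambda>j\<in>I. snd (z j))) \<in> borel_measurable (PiM I (\<lambda>_. A \<Otimes>\<^sub>M B))"
    by measurable
  fix h :: "'a \<Rightarrow> 'b \<times> 'c \<Rightarrow> ennreal" assume h[measurable]: "\<And>j. j \<in> I \<Longrightarrow> h j \<in> borel_measurable (A \<Otimes>\<^sub>M B)"
  define \<phi> where "\<phi> j x = ennsqrt (\<integral>\<^sup>+y. (h j (x, y))\<^sup>2 \<partial>B)" for j x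
  have \<phi>[measurable]: "\<phi> j \<in> borel_measurable A" if "j \<in> I" for j
    using h[OF that] unfolding \<phi>_def by measurable
  have m: "(\<lambda>z. (\<Prod>j\<in>I. h j (z j)) * (H (\<lambda>j\<in>I. fst (z j)) * K (\<lambda>j\<in>I. snd (z j)))) \<in> borel_measurable (PiM I (\<lambda>_. A \<Otimes>\<^sub>M B))"
    by measurable
  have "(\<integral>\<^sup>+z. (\<Prod>j\<in>I. h j (z j)) * (H (\<lambda>j\<in>I. fst (z j)) * K (\<lambda>j\<in>I. snd (z j))) \<partial>PiM I (\<lambda>_. A \<Otimes>\<^sub>M B))
    = (\<integral>\<^sup>+(x, y). (\<Prod>j\<in>I. h j (x j, y j)) * (H x * K y) \<partial>(PiM I (\<lambda>_. A) \<Otimes>\<^sub>M PiM I (\<lambda>_. B)))"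
    apply (subst PiM_pair_measure[OF I sA sB])
    apply (subst nn_integral_distr)
    subgoal by measurable
    subgoal using m by simp
    apply (rule nn_integral_cong)
    apply (auto simp: space_pair_measure space_PiM intro!: arg_cong2[where f="(*)"] arg_cong[where f=H] arg_cong[where f=K] prod.cong extensionalityI[of _ I] simp: PiE_iff)
    done
  also have "\<dots> = (\<integral>\<^sup>+x. \<integral>\<^sup>+y. (\<Prod>j\<in>I. h j (x j, y j)) * (H x * K y) \<partial>PiM I (\<lambda>_. B) \<partial>PiM I (\<lambda>_. A))"
    by (subst BI.nn_integral_fst[symmetric]) auto
  also have "\<dots> \<le> (\<integral>\<^sup>+x. D * ((\<Prod>j\<in>I. \<phi> j (x j)) * H x) \<partial>PiM I (\<lambda>_. A))"
  proof (rule nn_integral_mono)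
    fix x assume x: "x \<in> space (PiM I (\<lambda>_. A))"
    have [measurable]: "(\<lambda>y. h j (x j, y)) \<in> borel_measurable B" if j: "j \<in> I" for j
    proof -
      have "x j \<in> space A" using x j by (auto simp: space_PiM)
      then show ?thesis using h[OF j] by measurable
    qed
    have "(\<integral>\<^sup>+y. (\<Prod>j\<in>I. h j (x j, y j)) * (H x * K y) \<partial>PiM I (\<lambda>_. B))
      = (\<integral>\<^sup>+y. H x * ((\<Prod>j\<in>I. h j (x j, y j)) * K y) \<partial>PiM I (\<lambda>_. B))"
      by (simp add: mult_ac)
    also have "\<dots> = H x * (\<integral>\<^sup>+y. (\<Prod>j\<in>I. h j (x j, y j)) * K y \<partial>PiM I (\<lambda>_. B))"
      by (intro nn_integral_cmult) measurable
    also have "\<dots> \<le> H x * (D * (\<Prod>j\<in>I. \<phi> j (x j)))"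
      unfolding \<phi>_def by (intro mult_left_mono cs_boundD[OF K, of "\<lambda>j y. h j (x j, y)"]) auto
    finally show "(\<integral>\<^sup>+y. (\<Prod>j\<in>I. h j (x j, y j)) * (H x * K y) \<partial>PiM I (\<lambda>_. B)) \<le> D * ((\<Prod>j\<in>I. \<phi> j (x j)) * H x)"
      by (simp add: mult_ac)
  qed
  also have "\<dots> = D * (\<integral>\<^sup>+x. ((\<Prod>j\<in>I. \<phi> j (x j)) * H x) \<partial>PiM I (\<lambda>_. A))"
    by (rule nn_integral_cmult) measurable
  also have "\<dots> \<le> D * (C * (\<Prod>j\<in>I. ennsqrt (\<integral>\<^sup>+x. (\<phi> j x)\<^sup>2 \<partial>A)))"
    by (intro mult_left_mono cs_boundD[OF H]) auto
  also have "\<dots> = C * D * (\<Prod>j\<in>I. ennsqrt (\<integral>\<^sup>+x. (\<phi> j x)\<^sup>2 \<partial>A))"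
    by (simp add: mult_ac)
  also have "(\<Prod>j\<in>I. ennsqrt (\<integral>\<^sup>+x. (\<phi> j x)\<^sup>2 \<partial>A)) = (\<Prod>j\<in>I. ennsqrt (\<integral>\<^sup>+z. (h j z)\<^sup>2 \<partial>(A \<Otimes>\<^sub>M B)))"
    unfolding \<phi>_def ennsqrt_power2
    by (intro prod.cong refl arg_cong[where f=ennsqrt] B1.nn_integral_fst) measurable
  finally show "(\<integral>\<^sup>+z. (\<Prod>j\<in>I. h j (z j)) * (H (\<lambda>j\<in>I. fst (z j)) * K (\<lambda>j\<in>I. snd (z j))) \<partial>PiM I (\<lambda>_. A \<Otimes>\<^sub>M B))
    \<le> C * D * (\<Prod>j\<in>I. ennsqrt (\<integral>\<^sup>+z. (h j z)\<^sup>2 \<partial>(A \<Otimes>\<^sub>M B)))" .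
qed

text \<open>On disjoint index sets the integral splits into a product of two integrals. This
  assembles the kernel of a perfect matching from those of its pairs.\<close>

lemma cs_bound_Un:
  assumes H: "cs_bound I A H C" and K: "cs_bound J A K D" and fin: "finite I" "finite J"
    and IJ: "I \<inter> J = {}" and sA: "sigma_finite_measure A"
  shows "cs_bound (I \<union> J) A (\<lambda>x. H (restrict x I) * K (restrict x J)) (C * D)"
proof (rule cs_boundI)
  interpret A: product_sigma_finite "\<lambda>_. A" using sA by (simp add: product_sigma_finite_def)
  note [measurable] = cs_bound_measurable[OF H] cs_bound_measurable[OF K]
  have [measurable]: "(\<lambda>x. restrict x I) \<in> measurable (PiM (I \<union> J) (\<lambda>_. A)) (PiM I (\<lambda>_. A))"
    "(\<lambda>x. restrict x J) \<in> measurable (PiM (I \<union> J) (\<lambda>_. A)) (PiM J (\<lambda>_. A))"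
    by (auto intro: measurable_restrict_subset)
  show "(\<lambda>x. H (restrict x I) * K (restrict x J)) \<in> borel_measurable (PiM (I \<union> J) (\<lambda>_. A))"
    by measurable
  fix h :: "'a \<Rightarrow> 'b \<Rightarrow> ennreal" assume h[measurable]: "\<And>j. j \<in> I \<union> J \<Longrightarrow> h j \<in> borel_measurable A"
  have hI[measurable]: "j \<in> I \<Longrightarrow> h j \<in> borel_measurable A" and hJ[measurable]: "j \<in> J \<Longrightarrow> h j \<in> borel_measurable A" for j
    using h by auto
  have "(\<integral>\<^sup>+x. (\<Prod>j\<in>I \<union> J. h j (x j)) * (H (restrict x I) * K (restrict x J)) \<partial>PiM (I \<union> J) (\<lambda>_. A))
    = (\<integral>\<^sup>+x. \<integral>\<^sup>+y. ((\<Prod>j\<in>I. h j (x j)) * H x) * ((\<Prod>j\<in>J. h j (y j)) * K y) \<partial>PiM J (\<lambda>_. A) \<partial>PiM I (\<lambda>_. A))"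
  proof (subst A.product_nn_integral_fold[OF IJ fin])
    show "(\<integral>\<^sup>+x. \<integral>\<^sup>+y. (\<Prod>j\<in>I \<union> J. h j (merge I J (x, y) j)) *
          (H (restrict (merge I J (x, y)) I) * K (restrict (merge I J (x, y)) J)) \<partial>PiM J (\<lambda>_. A) \<partial>PiM I (\<lambda>_. A)) =
      (\<integral>\<^sup>+x. \<integral>\<^sup>+y. ((\<Prod>j\<in>I. h j (x j)) * H x) * ((\<Prod>j\<in>J. h j (y j)) * K y) \<partial>PiM J (\<lambda>_. A) \<partial>PiM I (\<lambda>_. A))"
    proof (intro nn_integral_cong)
      fix x y assume x: "x \<in> space (PiM I (\<lambda>_. A))" and y: "y \<in> space (PiM J (\<lambda>_. A))"
      have "restrict (merge I J (x, y)) I = x" "restrict (merge I J (x, y)) J = y"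
        using x y IJ by (auto simp: space_PiM PiE_def extensional_restrict restrict_merge)
      moreover have "(\<Prod>j\<in>I \<union> J. h j (merge I J (x, y) j)) = (\<Prod>j\<in>I. h j (x j)) * (\<Prod>j\<in>J. h j (y j))"
        using IJ fin by (subst prod.union_disjoint) (auto simp: merge_def intro!: arg_cong2[where f="(*)"] prod.cong)
      ultimately show "(\<Prod>j\<in>I \<union> J. h j (merge I J (x, y) j)) *
          (H (restrict (merge I J (x, y)) I) * K (restrict (merge I J (x, y)) J)) =
        ((\<Prod>j\<in>I. h j (x j)) * H x) * ((\<Prod>j\<in>J. h j (y j)) * K y)"
        by (simp add: mult_ac)
    qed
  qed measurable
  also have "\<dots> = (\<integral>\<^sup>+x. (\<Prod>j\<in>I. h j (x j)) * H x \<partial>PiM I (\<lambda>_. A)) * (\<integral>\<^sup>+y. (\<Prod>j\<in>J. h j (y j)) * K y \<partial>PiM J (\<lambda>_. A))"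
    by (subst nn_integral_cmult, measurable, subst nn_integral_multc, measurable)
  also have "\<dots> \<le> (C * (\<Prod>j\<in>I. ennsqrt (\<integral>\<^sup>+x. (h j x)\<^sup>2 \<partial>A))) * (D * (\<Prod>j\<in>J. ennsqrt (\<integral>\<^sup>+x. (h j x)\<^sup>2 \<partial>A)))"
    by (intro mult_mono cs_boundD[OF H] cs_boundD[OF K]) auto
  also have "\<dots> = C * D * (\<Prod>j\<in>I \<union> J. ennsqrt (\<integral>\<^sup>+x. (h j x)\<^sup>2 \<partial>A))"
    using IJ fin by (subst prod.union_disjoint) (auto simp: mult_ac)
  finally show "(\<integral>\<^sup>+x. (\<Prod>j\<in>I \<union> J. h j (x j)) * (H (restrict x I) * K (restrict x J)) \<partial>PiM (I \<union> J) (\<lambda>_. A))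
    \<le> C * D * (\<Prod>j\<in>I \<union> J. ennsqrt (\<integral>\<^sup>+x. (h j x)\<^sup>2 \<partial>A))" .
qed

lemma cs_bound_empty:
  assumes sA: "sigma_finite_measure A"
  shows "cs_bound {} A (\<lambda>_. 1) 1"
proof (rule cs_boundI)
  interpret A: product_sigma_finite "\<lambda>_::'b. A" using sA by (simp add: product_sigma_finite_def)
  show "(\<integral>\<^sup>+x. (\<Prod>j\<in>{}. h j (x j)) * 1 \<partial>PiM {} (\<lambda>_. A)) \<le> 1 * (\<Prod>j\<in>{}. ennsqrt (\<integral>\<^sup>+x. (h j x)\<^sup>2 \<partial>A))" for h :: "'b \<Rightarrow> 'a \<Rightarrow> ennreal"
    using A.nn_integral_empty[of "\<lambda>_. 1"] by simp
qed simp

section \<open>Exponential kernels\<close>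

lemma nn_integral_exp_abs_diff:
  fixes l y :: real
  assumes l: "0 < l"
  shows "(\<integral>\<^sup>+x. ennreal (exp (- l * \<bar>x - y\<bar>)) \<partial>lborel) \<le> ennreal (2 / l)"
proof -
  have D: "(\<integral>\<^sup>+x. ennreal (exponential_density l x) \<partial>lborel) = 1"
  proof -
    interpret prob_space "density lborel (exponential_density l)"
      by (rule prob_space_exponential_density[OF l])
    show ?thesis
      using emeasure_space_1 by (simp add: emeasure_density)
  qed
  \<comment> \<open>The cases \<open>c = 1\<close> and \<open>c = -1\<close> give the two one-sided
    exponential densities centred at \<open>y\<close>.\<close>
  have shift: "(\<integral>\<^sup>+x. ennreal (exponential_density l (c * (x - y))) \<partial>lborel) = 1" if "\<bar>c\<bar> = 1" for c :: real
  proof -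
    have "(\<integral>\<^sup>+x. ennreal (exponential_density l (c * (x - y))) \<partial>lborel)
      = \<bar>c\<bar> * (\<integral>\<^sup>+x. ennreal (exponential_density l (c * ((y + c * x) - y))) \<partial>lborel)"
      using that by (subst nn_integral_real_affine[where t=y and c=c]) auto
    also have "\<dots> = (\<integral>\<^sup>+x. ennreal (exponential_density l x) \<partial>lborel)"
      using that by (auto simp: abs_if split: if_splits)
    finally show ?thesis using D by simp
  qed
  \<comment> \<open>Off the diagonal, \<open>l\<close> times the kernel is the sum of the two
    one-sided densities; at \<open>x = y\<close> both contribute, so that only an inequality
    holds.\<close>
  have "(\<integral>\<^sup>+x. ennreal (exp (- l * \<bar>x - y\<bar>)) \<partial>lborel) \<le>
    (\<integral>\<^sup>+x. ennreal (1 / l) * (ennreal (exponential_density l (1 * (x - y))) + ennreal (exponential_density l ((-1) * (x - y)))) \<partial>lborel)"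
  proof (rule nn_integral_mono)
    fix x :: real
    have "exp (- l * \<bar>x - y\<bar>) \<le> 1 / l * (exponential_density l (1 * (x - y)) + exponential_density l ((-1) * (x - y)))"
      using l by (auto simp: exponential_density_def field_simps abs_if)
    then show "ennreal (exp (- l * \<bar>x - y\<bar>)) \<le> ennreal (1 / l) * (ennreal (exponential_density l (1 * (x - y))) + ennreal (exponential_density l ((-1) * (x - y))))"
      using l by (subst ennreal_plus[symmetric], simp, simp, subst ennreal_mult[symmetric], simp, simp, intro ennreal_leI)
  qed
  also have "\<dots> = ennreal (1 / l) * (1 + 1)"
    by (subst nn_integral_cmult, simp, subst nn_integral_add, simp, simp, subst (1 2) shift) auto
  also have "\<dots> = ennreal (2 / l)"
    using l by (simp add: ennreal_mult[symmetric] flip: ennreal_numeral)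
  finally show ?thesis .
qed

text \<open>Schur's test: the kernel is the square of \<open>e\<close>, one factor \<open>e\<close>
  is given to each of the two functions, and the ordinary Cauchy-Schwarz inequality leaves the row
  and column integrals of the kernel, both at most 2/l.\<close>

lemma cs_bound_exp_pair:
  fixes l :: real
  assumes l: "0 < l" and pq: "p \<noteq> q"
  shows "cs_bound {p, q} lborel (\<lambda>x. ennreal (exp (- l * \<bar>x p - x q\<bar>))) (ennreal (2 / l))"
proof (rule cs_boundI)
  interpret L: product_sigma_finite "\<lambda>_::'a. lborel :: real measure"
    by (simp add: product_sigma_finite_def lborel.sigma_finite_measure_axioms)
  show "(\<lambda>x. ennreal (exp (- l * \<bar>x p - x q\<bar>))) \<in> borel_measurable (PiM {p, q} (\<lambda>_. lborel))"
    by measurable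
  fix h :: "'a \<Rightarrow> real \<Rightarrow> ennreal" assume h: "\<And>j. j \<in> {p, q} \<Longrightarrow> h j \<in> borel_measurable lborel"
  then have [measurable]: "h p \<in> borel_measurable borel" "h q \<in> borel_measurable borel" by auto
  define e where "e z = ennreal (exp (- (l / 2) * \<bar>fst z - snd z\<bar>))" for z :: "real \<times> real"
  have e2: "(e z)\<^sup>2 = ennreal (exp (- l * \<bar>fst z - snd z\<bar>))" for z
    by (simp add: e_def power2_eq_square ennreal_mult[symmetric] mult_exp_exp field_simps)
  have [measurable]: "e \<in> borel_measurable (lborel \<Otimes>\<^sub>M lborel)" "e \<in> borel_measurable (borel \<Otimes>\<^sub>M borel)"
    unfolding e_def by measurable
  let ?I = "\<integral>\<^sup>+x. (\<Prod>j\<in>{p, q}. h j (x j)) * ennreal (exp (- l * \<bar>x p - x q\<bar>)) \<partial>PiM {p, q} (\<lambda>_. lborel)"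
  have "?I = (\<integral>\<^sup>+x. h p (x p) * h q (x q) * ennreal (exp (- l * \<bar>x p - x q\<bar>)) \<partial>PiM {p, q} (\<lambda>_. lborel))"
    using pq by simp
  also have "\<dots> = (\<integral>\<^sup>+z. h p (fst z) * h q (snd z) * ennreal (exp (- l * \<bar>fst z - snd z\<bar>)) \<partial>(lborel \<Otimes>\<^sub>M lborel))"
    by (rule L.product_nn_integral_pair[OF _ pq, of "\<lambda>x y. h p x * h q y * ennreal (exp (- l * \<bar>x - y\<bar>))"]) measurable
  also have "\<dots> = (\<integral>\<^sup>+z. (h p (fst z) * e z) * (h q (snd z) * e z) \<partial>(lborel \<Otimes>\<^sub>M lborel))"
    unfolding e2[symmetric] by (rule nn_integral_cong) (simp add: power2_eq_square mult_ac)
  finally have I: "?I = (\<integral>\<^sup>+z. (h p (fst z) * e z) * (h q (snd z) * e z) \<partial>(lborel \<Otimes>\<^sub>M lborel))" .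
  have 1: "(\<integral>\<^sup>+z. (h p (fst z) * e z)\<^sup>2 \<partial>(lborel \<Otimes>\<^sub>M lborel)) \<le> ennreal (2 / l) * (\<integral>\<^sup>+x. (h p x)\<^sup>2 \<partial>lborel)"
  proof -
    have "(\<integral>\<^sup>+z. (h p (fst z) * e z)\<^sup>2 \<partial>(lborel \<Otimes>\<^sub>M lborel)) = (\<integral>\<^sup>+x. \<integral>\<^sup>+y. (h p x)\<^sup>2 * ennreal (exp (- l * \<bar>y - x\<bar>)) \<partial>lborel \<partial>lborel)"
      by (subst lborel.nn_integral_fst[symmetric]) (auto simp: power_mult_distrib e2 abs_minus_commute)
    also have "\<dots> \<le> (\<integral>\<^sup>+x. (h p x)\<^sup>2 * ennreal (2 / l) \<partial>lborel)"
      by (intro nn_integral_mono, subst nn_integral_cmult) (auto intro!: mult_left_mono nn_integral_exp_abs_diff[OF l, simplified])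
    also have "\<dots> = ennreal (2 / l) * (\<integral>\<^sup>+x. (h p x)\<^sup>2 \<partial>lborel)"
      by (subst nn_integral_multc) (auto simp: mult.commute)
    finally show ?thesis .
  qed
  have 2: "(\<integral>\<^sup>+z. (h q (snd z) * e z)\<^sup>2 \<partial>(lborel \<Otimes>\<^sub>M lborel)) \<le> ennreal (2 / l) * (\<integral>\<^sup>+x. (h q x)\<^sup>2 \<partial>lborel)"
  proof -
    have "(\<integral>\<^sup>+z. (h q (snd z) * e z)\<^sup>2 \<partial>(lborel \<Otimes>\<^sub>M lborel)) = (\<integral>\<^sup>+y. \<integral>\<^sup>+x. (h q y)\<^sup>2 * ennreal (exp (- l * \<bar>x - y\<bar>)) \<partial>lborel \<partial>lborel)"
      by (subst lborel_pair.nn_integral_snd[symmetric]) (auto simp: power_mult_distrib e2)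
    also have "\<dots> \<le> (\<integral>\<^sup>+x. (h q x)\<^sup>2 * ennreal (2 / l) \<partial>lborel)"
      by (intro nn_integral_mono, subst nn_integral_cmult) (auto intro!: mult_left_mono nn_integral_exp_abs_diff[OF l, simplified])
    also have "\<dots> = ennreal (2 / l) * (\<integral>\<^sup>+x. (h q x)\<^sup>2 \<partial>lborel)"
      by (subst nn_integral_multc) (auto simp: mult.commute)
    finally show ?thesis .
  qed
  have "?I\<^sup>2 \<le> (\<integral>\<^sup>+z. (h p (fst z) * e z)\<^sup>2 \<partial>(lborel \<Otimes>\<^sub>M lborel)) * (\<integral>\<^sup>+z. (h q (snd z) * e z)\<^sup>2 \<partial>(lborel \<Otimes>\<^sub>M lborel))"
    unfolding I by (rule Cauchy_Schwarz_nn_integral) measurable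
  also have "\<dots> \<le> (ennreal (2 / l) * (\<integral>\<^sup>+x. (h p x)\<^sup>2 \<partial>lborel)) * (ennreal (2 / l) * (\<integral>\<^sup>+x. (h q x)\<^sup>2 \<partial>lborel))"
    by (rule mult_mono[OF 1 2]) auto
  also have "\<dots> = (ennreal (2 / l) * (\<Prod>j\<in>{p, q}. ennsqrt (\<integral>\<^sup>+x. (h j x)\<^sup>2 \<partial>lborel)))\<^sup>2"
    using pq by (simp add: power_mult_distrib ennsqrt_power2 power2_eq_square[of "ennreal (2/l)"] mult_ac)
  finally show "?I \<le> ennreal (2 / l) * (\<Prod>j\<in>{p, q}. ennsqrt (\<integral>\<^sup>+x. (h j x)\<^sup>2 \<partial>lborel))"
    by (rule ennreal_power2_le_imp_le)
qed

lemma cs_bound_UN: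
  assumes "finite R" "\<And>r. r \<in> R \<Longrightarrow> cs_bound (I r) A (H r) C" "\<And>r. r \<in> R \<Longrightarrow> finite (I r)"
    and "disjoint_family_on I R" and sA: "sigma_finite_measure A"
  shows "cs_bound (\<Union>r\<in>R. I r) A (\<lambda>x. \<Prod>r\<in>R. H r (restrict x (I r))) (C ^ card R)"
  using assms(1-4)
proof (induction R)
  case empty
  then show ?case using cs_bound_empty[OF sA] by simp
next
  case (insert r R)
  have "cs_bound (I r \<union> (\<Union>r\<in>R. I r)) A
    (\<lambda>x. H r (restrict x (I r)) * (\<Prod>s\<in>R. H s (restrict (restrict x (\<Union>r\<in>R. I r)) (I s)))) (C * C ^ card R)"
    using insert
    by (intro cs_bound_Un[OF _ _ _ _ _ sA] insert.IH) (auto simp: disjoint_family_on_def)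
  moreover have "(\<Prod>s\<in>R. H s (restrict (restrict x (\<Union>r\<in>R. I r)) (I s))) = (\<Prod>s\<in>R. H s (restrict x (I s)))" for x
  proof (rule prod.cong[OF refl])
    fix s assume "s \<in> R"
    then have "(\<Union>r\<in>R. I r) \<inter> I s = I s" by auto
    then show "H s (restrict (restrict x (\<Union>r\<in>R. I r)) (I s)) = H s (restrict x (I s))"
      by (simp add: restrict_restrict)
  qed
  ultimately show ?case
    unfolding prod.insert[OF insert.hyps] card_insert_disjoint[OF insert.hyps] power_Suc UN_insert by simp
qed

text \<open>A permutation encodes the perfect matching with pairs \<open>s (2 * r)\<close>,
  \<open>s (2 * r + 1)\<close>. The kernel factorises over these disjoint pairs and each pair
  contributes 2/l. Permutations encode a matching redundantly, but they are what sorting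
  produces.\<close>

lemma cs_bound_exp_permutation:
  fixes l :: real
  assumes l: "0 < l" and s: "s permutes {..<2 * k}"
  shows "cs_bound {..<2 * k} lborel
    (\<lambda>x. ennreal (exp (- l * (\<Sum>r<k. \<bar>x (s (2 * r)) - x (s (2 * r + 1))\<bar>)))) (ennreal (2 / l) ^ k)"
proof -
  have inj: "inj s" using s by (rule permutes_inj)
  have U: "(\<Union>r<k. {s (2 * r), s (2 * r + 1)}) = {..<2 * k}" (is "?U = _")
  proof -
    have "?U = s ` (\<Union>r<k. {2 * r, 2 * r + 1})" by auto
    also have "(\<Union>r<k. {2 * r, 2 * r + 1}) = {..<2 * k}"
    proof (intro set_eqI iffI)
      fix x assume "x \<in> {..<2 * k}"
      then have "x div 2 < k" "x = 2 * (x div 2) \<or> x = 2 * (x div 2) + 1" by auto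
      then show "x \<in> (\<Union>r<k. {2 * r, 2 * r + 1})" by blast
    qed auto
    also have "s ` {..<2 * k} = {..<2 * k}" using s by (rule permutes_image)
    finally show ?thesis .
  qed
  have ne: "s (2 * r) \<noteq> s (2 * r + 1)" for r
    using inj by (metis injD n_not_Suc_n Suc_eq_plus1)
  have "cs_bound (\<Union>r<k. {s (2 * r), s (2 * r + 1)}) lborel
    (\<lambda>x. \<Prod>r<k. (\<lambda>x. ennreal (exp (- l * \<bar>x (s (2 * r)) - x (s (2 * r + 1))\<bar>))) (restrict x {s (2 * r), s (2 * r + 1)}))
    (ennreal (2 / l) ^ card {..<k})"
  proof (rule cs_bound_UN[where H="\<lambda>r x. ennreal (exp (- l * \<bar>x (s (2 * r)) - x (s (2 * r + 1))\<bar>))"])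
    show "disjoint_family_on (\<lambda>r. {s (2 * r), s (2 * r + 1)}) {..<k}"
      unfolding disjoint_family_on_def
    proof (intro ballI impI)
      fix a b :: nat assume "a \<noteq> b"
      then have "2 * a \<noteq> 2 * b" "2 * a \<noteq> 2 * b + 1" "2 * a + 1 \<noteq> 2 * b" "2 * a + 1 \<noteq> 2 * b + 1"
        by presburger+
      then show "{s (2 * a), s (2 * a + 1)} \<inter> {s (2 * b), s (2 * b + 1)} = {}"
        by (simp add: inj_eq[OF inj])
    qed
    show "cs_bound {s (2 * r), s (2 * r + 1)} lborel
      (\<lambda>x. ennreal (exp (- l * \<bar>x (s (2 * r)) - x (s (2 * r + 1))\<bar>))) (ennreal (2 / l))" for r
      by (rule cs_bound_exp_pair[OF l ne])
  qed (auto simp: lborel.sigma_finite_measure_axioms)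
  note * = this[unfolded U card_lessThan]
  show ?thesis
    by (rule cs_bound_cong[OF *]) (simp add: sum_distrib_left sum_negf[symmetric] prod_ennreal exp_sum)
qed

section \<open>From one coordinate to several\<close>

lemma cs_bound_PiM:
  assumes "finite J" "\<And>i. i \<in> J \<Longrightarrow> cs_bound I (lborel :: real measure) (H i) (C i)" and I: "finite I"
  shows "cs_bound I (PiM J (\<lambda>_. lborel :: real measure)) (\<lambda>z. \<Prod>i\<in>J. H i (\<lambda>j\<in>I. z j i)) (\<Prod>i\<in>J. C i)"
  using assms(1,2)
proof (induction J)
  case empty
  interpret L: product_sigma_finite "\<lambda>_::'a. lborel :: real measure"
    by (simp add: product_sigma_finite_def lborel.sigma_finite_measure_axioms)
  interpret E: product_sigma_finite "\<lambda>_::'b. PiM {} (\<lambda>_::'a. lborel :: real measure)"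
    by (simp add: product_sigma_finite_def L.sigma_finite)
  \<comment> \<open>The empty product is a one-point space of mass 1, on which a function coincides
    with its L2 norm.\<close>
  have sq: "ennsqrt (x\<^sup>2) = x" for x
    using ennsqrt_power2[of "x\<^sup>2"] by (intro antisym) (auto intro: ennreal_power2_le_imp_le)
  show ?case
  proof (rule cs_boundI)
    fix h :: "'b \<Rightarrow> ('a \<Rightarrow> real) \<Rightarrow> ennreal"
    assume h: "\<And>j. j \<in> I \<Longrightarrow> h j \<in> borel_measurable (PiM {} (\<lambda>_. lborel :: real measure))"
    have "(\<integral>\<^sup>+x. (\<Prod>j\<in>I. h j (x j)) * (\<Prod>i\<in>{}. H i (\<lambda>j\<in>I. x j i)) \<partial>PiM I (\<lambda>_. PiM {} (\<lambda>_. lborel)))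
      = (\<Prod>j\<in>I. \<integral>\<^sup>+x. h j x \<partial>PiM {} (\<lambda>_. lborel))"
      using E.product_nn_integral_prod[OF I h] by simp
    also have "\<dots> = (\<Prod>j\<in>I. ennsqrt (\<integral>\<^sup>+x. (h j x)\<^sup>2 \<partial>PiM {} (\<lambda>_. lborel)))"
      by (simp add: L.nn_integral_empty sq)
    finally show "(\<integral>\<^sup>+x. (\<Prod>j\<in>I. h j (x j)) * (\<Prod>i\<in>{}. H i (\<lambda>j\<in>I. x j i)) \<partial>PiM I (\<lambda>_. PiM {} (\<lambda>_. lborel)))
      \<le> (\<Prod>i\<in>{}. C i) * (\<Prod>j\<in>I. ennsqrt (\<integral>\<^sup>+x. (h j x)\<^sup>2 \<partial>PiM {} (\<lambda>_. lborel)))"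
      by simp
  qed simp
next
  case (insert i J)
  interpret L: product_sigma_finite "\<lambda>_::'a. lborel :: real measure"
    by (simp add: product_sigma_finite_def lborel.sigma_finite_measure_axioms)
  interpret LJ: sigma_finite_measure "PiM J (\<lambda>_. lborel :: real measure)"
    using insert.hyps(1) by (rule L.sigma_finite)
  interpret P: pair_sigma_finite "lborel :: real measure" "PiM J (\<lambda>_. lborel :: real measure)" ..
  let ?f = "\<lambda>(x, y). y(i := x :: real)"
  have f[measurable]: "?f \<in> measurable (lborel \<Otimes>\<^sub>M PiM J (\<lambda>_. lborel)) (PiM (insert i J) (\<lambda>_. lborel))"
    by measurable
  \<comment> \<open>Adjoining the coordinate \<open>i\<close> turns a pair into a function on
    \<open>insert i J\<close>. The pair lemma then treats \<open>H i\<close> on the new coordinate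
    and the induction hypothesis on the others.\<close>
  have D: "distr (lborel \<Otimes>\<^sub>M PiM J (\<lambda>_. lborel)) (PiM (insert i J) (\<lambda>_. lborel)) ?f = PiM (insert i J) (\<lambda>_. lborel)"
  proof (rule measure_eqI)
    fix E assume "E \<in> sets (distr (lborel \<Otimes>\<^sub>M PiM J (\<lambda>_. lborel)) (PiM (insert i J) (\<lambda>_. lborel :: real measure)) ?f)"
    then have [measurable]: "E \<in> sets (PiM (insert i J) (\<lambda>_. lborel))" by simp
    have "emeasure (distr (lborel \<Otimes>\<^sub>M PiM J (\<lambda>_. lborel)) (PiM (insert i J) (\<lambda>_. lborel)) ?f) E
      = (\<integral>\<^sup>+z. indicator E z \<partial>distr (lborel \<Otimes>\<^sub>M PiM J (\<lambda>_. lborel)) (PiM (insert i J) (\<lambda>_. lborel)) ?f)"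
      by simp
    also have "\<dots> = (\<integral>\<^sup>+z. indicator E (?f z) \<partial>(lborel \<Otimes>\<^sub>M PiM J (\<lambda>_. lborel)))"
      by (rule nn_integral_distr) auto
    also have "\<dots> = (\<integral>\<^sup>+x. \<integral>\<^sup>+y. indicator E (y(i := x)) \<partial>PiM J (\<lambda>_. lborel) \<partial>lborel)"
      by (subst LJ.nn_integral_fst[symmetric]) (auto simp: split_beta')
    also have "\<dots> = (\<integral>\<^sup>+z. indicator E z \<partial>PiM (insert i J) (\<lambda>_. lborel))"
      by (rule L.product_nn_integral_insert_rev[symmetric]) (use insert.hyps in auto)
    finally show "emeasure (distr (lborel \<Otimes>\<^sub>M PiM J (\<lambda>_. lborel)) (PiM (insert i J) (\<lambda>_. lborel)) ?f) E
      = emeasure (PiM (insert i J) (\<lambda>_. lborel)) E" by simp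
  qed simp
  have Hm: "H k \<in> borel_measurable (PiM I (\<lambda>_. lborel))" if "k \<in> insert i J" for k
    using insert.prems[OF that] by (rule cs_bound_measurable)
  have "cs_bound I (distr (lborel \<Otimes>\<^sub>M PiM J (\<lambda>_. lborel)) (PiM (insert i J) (\<lambda>_. lborel)) ?f)
    (\<lambda>z. \<Prod>k\<in>insert i J. H k (\<lambda>j\<in>I. z j k)) (\<Prod>k\<in>insert i J. C k)"
  proof (rule cs_bound_distr[OF _ I _ f])
    show "sigma_finite_measure ((lborel :: real measure) \<Otimes>\<^sub>M PiM J (\<lambda>_. lborel :: real measure))"
      by (rule P.P.sigma_finite_measure_axioms)
    show "sigma_finite_measure (distr (lborel \<Otimes>\<^sub>M PiM J (\<lambda>_. lborel)) (PiM (insert i J) (\<lambda>_. lborel)) ?f)"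
      unfolding D using insert.hyps by (intro L.sigma_finite) auto
    show "(\<lambda>z. \<Prod>k\<in>insert i J. H k (\<lambda>j\<in>I. z j k)) \<in> borel_measurable (PiM I (\<lambda>_. PiM (insert i J) (\<lambda>_. lborel)))"
    proof (rule borel_measurable_prod_ennreal)
      fix k assume k: "k \<in> insert i J"
      note Hm[OF k, measurable]
      have "(\<lambda>z. z j k) \<in> borel_measurable (PiM I (\<lambda>_. PiM (insert i J) (\<lambda>_. lborel :: real measure)))" if "j \<in> I" for j
        using measurable_compose[OF measurable_component_singleton[OF that, of "\<lambda>_. PiM (insert i J) (\<lambda>_. lborel :: real measure)"] measurable_component_singleton[OF k]] by simp
      then have [measurable]: "(\<lambda>z. \<lambda>j\<in>I. z j k) \<in> measurable (PiM I (\<lambda>_. PiM (insert i J) (\<lambda>_. lborel :: real measure))) (PiM I (\<lambda>_. lborel))"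
        by (intro measurable_restrict) simp
      show "(\<lambda>z. H k (\<lambda>j\<in>I. z j k)) \<in> borel_measurable (PiM I (\<lambda>_. PiM (insert i J) (\<lambda>_. lborel :: real measure)))"
        by measurable
    qed
    have "cs_bound I (lborel \<Otimes>\<^sub>M PiM J (\<lambda>_. lborel))
      (\<lambda>z. H i (\<lambda>j\<in>I. fst (z j)) * (\<Prod>k\<in>J. H k (\<lambda>j\<in>I. (\<lambda>j\<in>I. snd (z j)) j k))) (C i * (\<Prod>k\<in>J. C k))"
      using insert.prems
      by (intro cs_bound_pair[where K="\<lambda>z. \<Prod>k\<in>J. H k (\<lambda>j\<in>I. z j k)"] insert.IH I LJ.sigma_finite_measure_axioms lborel.sigma_finite_measure_axioms) auto
    then show "cs_bound I (lborel \<Otimes>\<^sub>M PiM J (\<lambda>_. lborel))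
      (\<lambda>x. \<Prod>k\<in>insert i J. H k (\<lambda>j\<in>I. (\<lambda>j\<in>I. ?f (x j)) j k)) (\<Prod>k\<in>insert i J. C k)"
      unfolding prod.insert[OF insert.hyps, of C]
    proof (rule cs_bound_cong)
      fix x :: "'b \<Rightarrow> real \<times> ('a \<Rightarrow> real)"
      show "H i (\<lambda>j\<in>I. fst (x j)) * (\<Prod>k\<in>J. H k (\<lambda>j\<in>I. (\<lambda>j\<in>I. snd (x j)) j k)) =
        (\<Prod>k\<in>insert i J. H k (\<lambda>j\<in>I. (\<lambda>j\<in>I. ?f (x j)) j k))"
      proof -
        have "(\<lambda>j\<in>I. (\<lambda>j\<in>I. ?f (x j)) j i) = (\<lambda>j\<in>I. fst (x j))"
          by (auto simp: fun_eq_iff split_beta')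
        moreover have "(\<lambda>j\<in>I. (\<lambda>j\<in>I. ?f (x j)) j k) = (\<lambda>j\<in>I. (\<lambda>j\<in>I. snd (x j)) j k)" if "k \<in> J" for k
          using that insert.hyps by (auto simp: fun_eq_iff split_beta')
        ultimately show ?thesis
          using insert.hyps by simp
      qed
    qed
  qed
  then show ?case unfolding D .
qed

lemma borel_measurable_vec_lambda:
  fixes f :: "'a \<Rightarrow> 'd :: finite \<Rightarrow> real"
  assumes "\<And>i. (\<lambda>x. f x i) \<in> borel_measurable M"
  shows "(\<lambda>x. \<chi> i. f x i) \<in> borel_measurable M"
  unfolding borel_measurable_euclidean_space[of "\<lambda>x. \<chi> i. f x i"]
  using assms by (auto simp: Basis_vec_def inner_axis)

lemma borel_measurable_vec_nth [measurable]: "(\<lambda>x :: real ^ 'd. x $ i) \<in> borel_measurable borel"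
  by (intro borel_measurable_continuous_onI continuous_intros)

lemma lborel_vec_eq_distr_PiM:
  "(lborel :: (real ^ 'd) measure) = distr (PiM (UNIV :: 'd set) (\<lambda>_. lborel)) borel (\<lambda>f. \<chi> i. f i)"
proof (rule lborel_eqI)
  interpret L: product_sigma_finite "\<lambda>_::'d. lborel :: real measure"
    by (simp add: product_sigma_finite_def lborel.sigma_finite_measure_axioms)
  have m[measurable]: "(\<lambda>f. \<chi> i. f i) \<in> measurable (PiM (UNIV :: 'd set) (\<lambda>_. lborel :: real measure)) borel"
    by (rule borel_measurable_vec_lambda) simp
  fix l u :: "real ^ 'd" assume lu: "\<And>b. b \<in> Basis \<Longrightarrow> l \<bullet> b \<le> u \<bullet> b"
  have lu': "l $ i \<le> u $ i" for i
    using lu[of "axis i 1"] by (simp add: inner_axis axis_in_Basis_iff)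
  have eq: "(\<lambda>f. \<chi> i. f i) -` box l u \<inter> space (PiM (UNIV :: 'd set) (\<lambda>_. lborel :: real measure)) = PiE UNIV (\<lambda>i. {l $ i <..< u $ i})"
    by (auto simp: space_PiM mem_box_cart PiE_iff)
  have "emeasure (distr (PiM (UNIV :: 'd set) (\<lambda>_. lborel)) borel (\<lambda>f. \<chi> i. f i)) (box l u)
    = (\<Prod>i\<in>UNIV. emeasure lborel {l $ i <..< u $ i})"
    by (simp add: emeasure_distr eq L.emeasure_PiM)
  also have "\<dots> = ennreal (\<Prod>i\<in>UNIV. u $ i - l $ i)"
    using lu' by (simp add: prod_ennreal)
  also have "(\<Prod>i\<in>UNIV. u $ i - l $ i) = (\<Prod>b\<in>Basis. (u - l) \<bullet> b)"
    using prod.reindex[of "\<lambda>i. axis i 1 :: real ^ 'd" UNIV "\<lambda>b. (u - l) \<bullet> b"]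
    by (simp add: Basis_vec_def inj_on_def axis_eq_axis inner_axis UNION_singleton_eq_range o_def)
  finally show "emeasure (distr (PiM (UNIV :: 'd set) (\<lambda>_. lborel)) borel (\<lambda>f. \<chi> i. f i)) (box l u)
    = ennreal (\<Prod>b\<in>Basis. (u - l) \<bullet> b)" .
qed simp

lemma cs_bound_vec:
  assumes H: "\<And>i. cs_bound I (lborel :: real measure) (H i) (C i)" and I: "finite I"
  shows "cs_bound I (lborel :: (real ^ 'd) measure) (\<lambda>z. \<Prod>i\<in>UNIV. H i (\<lambda>j\<in>I. z j $ i)) (\<Prod>i\<in>UNIV. C i)"
proof -
  interpret L: product_sigma_finite "\<lambda>_::'d. lborel :: real measure"
    by (simp add: product_sigma_finite_def lborel.sigma_finite_measure_axioms)
  note [measurable] = cs_bound_measurable[OF H]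
  show ?thesis
    unfolding lborel_vec_eq_distr_PiM
  proof (rule cs_bound_distr[OF _ I])
    show "cs_bound I (PiM (UNIV :: 'd set) (\<lambda>_. lborel)) (\<lambda>x. \<Prod>i\<in>UNIV. H i (\<lambda>j\<in>I. (\<lambda>j\<in>I. \<chi> i. x j i) j $ i)) (\<Prod>i\<in>UNIV. C i)"
      by (rule cs_bound_cong[OF cs_bound_PiM[OF _ H I]]) (auto intro!: prod.cong arg_cong[where f="H _"])
    show "(\<lambda>f. \<chi> i. f i) \<in> measurable (PiM (UNIV :: 'd set) (\<lambda>_. lborel :: real measure)) borel"
      by (rule borel_measurable_vec_lambda) simp
    show "sigma_finite_measure (distr (PiM (UNIV :: 'd set) (\<lambda>_. lborel :: real measure)) borel (\<lambda>f. \<chi> i. f i))"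
      unfolding lborel_vec_eq_distr_PiM[symmetric] by (rule lborel.sigma_finite_measure_axioms)
    show "(\<lambda>z. \<Prod>i\<in>UNIV. H i (\<lambda>j\<in>I. z j $ i)) \<in> borel_measurable (PiM I (\<lambda>_. borel :: (real ^ 'd) measure))"
      by measurable
  qed (simp add: L.sigma_finite)
qed

section \<open>Parity of a multiparameter Poisson process\<close>

text \<open>Signs are written as cos (pi x) on integers x: increments are alternating sums of real
  values, not natural numbers a priori, and cosine is measurable and turns sums of integers into
  products.\<close>

lemma cos_pi_add_Ints:
  assumes "x \<in> \<int>" "y \<in> \<int>"
  shows "cos (pi * (x + y)) = cos (pi * x) * cos (pi * y)"
proof -
  have "sin (pi * x) = 0"
    using assms(1) sin_times_pi_eq_0[of x] by (simp add: mult.commute)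
  then show ?thesis by (simp add: distrib_left cos_add)
qed

lemma cos_pi_sum_Ints:
  assumes "finite A" "\<And>a. a \<in> A \<Longrightarrow> f a \<in> \<int>"
  shows "cos (pi * (\<Sum>a\<in>A. f a)) = (\<Prod>a\<in>A. cos (pi * f a))"
  using assms
proof (induction A rule: finite_induct)
  case (insert a A)
  then show ?case by (simp add: cos_pi_add_Ints Ints_sum)
qed simp

lemma cos_pi_Ints_power:
  assumes "x \<in> \<int>"
  shows "cos (pi * x) ^ n = (if odd n then cos (pi * x) else 1)"
proof -
  from assms obtain i :: int where "x = of_int i" by (auto elim: Ints_cases)
  then show ?thesis by (auto simp: mult.commute)
qed

text \<open>This is the probability generating function of the Poisson law at -1, exp (r (z - 1))
  with z = -1.\<close>

lemma integral_poisson_cos_pi: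
  assumes r: "0 < r"
  shows "(\<integral>x. cos (pi * x) \<partial>distr (measure_pmf (poisson_pmf r)) borel real) = exp (- 2 * r)"
proof -
  have s: "(\<lambda>k. pmf (poisson_pmf r) k * (-1) ^ k) sums (exp (- r) * exp (- r))"
  proof -
    have "(\<lambda>k. (- r) ^ k /\<^sub>R fact k) sums exp (- r)" by (rule exp_converges)
    then have "(\<lambda>k. exp (- r) * ((- r) ^ k /\<^sub>R fact k)) sums (exp (- r) * exp (- r))" by (rule sums_mult)
    moreover have "exp (- r) * ((- r) ^ k /\<^sub>R fact k) = pmf (poisson_pmf r) k * (-1) ^ k" for k
      using r by (simp add: power_minus[of r] field_simps)
    ultimately show ?thesis by simp
  qed
  have a: "summable (\<lambda>k. norm (pmf (poisson_pmf r) k * (-1) ^ k))"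
  proof -
    have "summable (\<lambda>k. exp (- r) * (inverse (fact k) * r ^ k))"
      by (intro summable_mult summable_exp)
    moreover have "norm (pmf (poisson_pmf r) k * (-1) ^ k) = exp (- r) * (inverse (fact k) * r ^ k)" for k
      using r by (simp add: abs_mult power_abs field_simps)
    ultimately show ?thesis by simp
  qed
  have "(\<integral>x. cos (pi * x) \<partial>distr (measure_pmf (poisson_pmf r)) borel real) = (\<integral>k. (-1) ^ k \<partial>measure_pmf (poisson_pmf r))"
    by (subst integral_distr) auto
  also have "\<dots> = (\<integral>k. pmf (poisson_pmf r) k * (-1) ^ k \<partial>count_space UNIV)"
    by (subst measure_pmf_eq_density, subst integral_density) auto
  also have "\<dots> = (\<Sum>k. pmf (poisson_pmf r) k * (-1) ^ k)"
    using a by (intro integral_count_space_nat) (simp add: integrable_count_space_nat_iff)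
  also have "\<dots> = exp (- 2 * r)"
    using s by (simp add: sums_iff mult_exp_exp)
  finally show ?thesis .
qed

text \<open>Toggling \<open>i\<close> in \<open>S\<close> reverses the sign of a term and leaves its
  vertex in place, so the alternating sum equals its own negative.\<close>

lemma increment_degenerate:
  fixes s t :: "real ^ 'd"
  assumes "s $ i = t $ i"
  shows "increment x s t = 0"
proof -
  let ?f = "\<lambda>S. (-1) ^ card S * x (\<chi> i. if i \<in> S then s $ i else t $ i)"
  let ?h = "\<lambda>S. if i \<in> S then S - {i} else insert i S"
  have bij: "bij_betw ?h UNIV UNIV"
    by (rule bij_betw_byWitness[where f'="?h"]) auto
  have "?f (?h S) = - ?f S" for S
  proof -
    have "(-1 :: real) ^ card (?h S) = - ((-1) ^ card S)"
    proof (cases "i \<in> S")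
      case True
      have "card S = Suc (card (S - {i}))"
        using True by (intro card.remove) auto
      then have "(-1 :: real) ^ card S = - ((-1) ^ card (S - {i}))"
        by (simp only: power_Suc)
      then show ?thesis by (simp only: True if_True minus_minus)
    qed simp
    moreover have "(\<chi> j. if j \<in> ?h S then s $ j else t $ j) = (\<chi> j. if j \<in> S then s $ j else t $ j)"
      using assms by (auto simp: vec_eq_iff)
    ultimately show ?thesis by simp
  qed
  then have "(\<Sum>S\<in>UNIV. ?f S) = - (\<Sum>S\<in>UNIV. ?f S)"
    using sum.reindex_bij_betw[OF bij, of ?f] by (simp only: sum_negf)
  then show ?thesis by (simp add: increment_def)
qed

text \<open>The identity is linear in \<open>F\<close>; for a product function it is a product of telescoping sums.\<close>

lemma sum_grid_increments:
  fixes F :: "('d :: finite \<Rightarrow> nat) \<Rightarrow> real"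
  assumes F0: "\<And>c k. c k = 0 \<Longrightarrow> F c = 0"
  shows "(\<Sum>a\<in>PiE UNIV (\<lambda>k. {..<b k}). \<Sum>S\<in>UNIV. (-1) ^ card S * F (\<lambda>k. if k \<in> S then a k else Suc (a k))) = F b"
proof -
  define C where "C = PiE UNIV (\<lambda>k. {..b k})"
  have finC: "finite C" unfolding C_def by (intro finite_PiE) auto
  \<comment> \<open>Indicators of single grid points are product functions, and \<open>F\<close> is
    a linear combination of them on \<open>C\<close>.\<close>
  define \<phi> :: "('d \<Rightarrow> nat) \<Rightarrow> 'd \<Rightarrow> nat \<Rightarrow> real" where "\<phi> c k l = of_bool (l = c k)" for c k l
  have \<phi>: "(\<Prod>k\<in>UNIV. \<phi> c k (a k)) = of_bool (a = c)" for a c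
    by (auto simp: \<phi>_def fun_eq_iff prod_zero_iff)
  have F: "F a = (\<Sum>c\<in>C. F c * (\<Prod>k\<in>UNIV. \<phi> c k (a k)))" if "a \<in> C" for a
    using finC that by (simp add: \<phi> of_bool_def if_distrib[of "(*) _"] cong: if_cong)
  have tel: "F c * (\<Sum>a\<in>PiE UNIV (\<lambda>k. {..<b k}). \<Sum>S\<in>UNIV. (-1) ^ card S * (\<Prod>k\<in>UNIV. \<phi> c k (if k \<in> S then a k else Suc (a k))))
    = F c * (\<Prod>k\<in>UNIV. \<phi> c k (b k))" for c
  proof (cases "F c = 0")
    case False
    \<comment> \<open>A point that carries weight has no zero index, so the lower end of each
      telescoping sum vanishes.\<close>
    then have 0: "\<phi> c k 0 = 0" for k
      using F0[of c k] by (auto simp: \<phi>_def)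
    have "(\<Sum>S\<in>UNIV. (-1) ^ card S * (\<Prod>k\<in>UNIV. \<phi> c k (if k \<in> S then a k else Suc (a k))))
      = (\<Prod>k\<in>UNIV. \<phi> c k (Suc (a k)) - \<phi> c k (a k))" for a
    proof -
      have "(\<Prod>k\<in>UNIV. \<phi> c k (Suc (a k)) - \<phi> c k (a k)) = (\<Prod>k\<in>UNIV. - \<phi> c k (a k) + \<phi> c k (Suc (a k)))"
        by simp
      also have "\<dots> = (\<Sum>S\<in>UNIV. (\<Prod>k\<in>S. - \<phi> c k (a k)) * (\<Prod>k\<in>UNIV - S. \<phi> c k (Suc (a k))))"
        by (subst prod_add) auto
      also have "\<dots> = (\<Sum>S\<in>UNIV. (-1) ^ card S * (\<Prod>k\<in>UNIV. \<phi> c k (if k \<in> S then a k else Suc (a k))))"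
      proof (rule sum.cong[OF refl])
        fix S :: "'d set"
        have "(\<Prod>k\<in>UNIV. \<phi> c k (if k \<in> S then a k else Suc (a k)))
          = (\<Prod>k\<in>S. \<phi> c k (a k)) * (\<Prod>k\<in>UNIV - S. \<phi> c k (Suc (a k)))"
          by (subst prod.subset_diff[of S UNIV]) (auto simp: mult.commute intro!: arg_cong2[where f="(*)"] prod.cong)
        then show "(\<Prod>k\<in>S. - \<phi> c k (a k)) * (\<Prod>k\<in>UNIV - S. \<phi> c k (Suc (a k)))
          = (-1) ^ card S * (\<Prod>k\<in>UNIV. \<phi> c k (if k \<in> S then a k else Suc (a k)))"
          by (simp add: prod_uminus)
      qed
      finally show ?thesis by simp
    qed
    then have "(\<Sum>a\<in>PiE UNIV (\<lambda>k. {..<b k}). \<Sum>S\<in>UNIV. (-1) ^ card S * (\<Prod>k\<in>UNIV. \<phi> c k (if k \<in> S then a k else Suc (a k))))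
      = (\<Prod>k\<in>UNIV. \<Sum>l<b k. \<phi> c k (Suc l) - \<phi> c k l)"
      by (subst prod_sum_PiE) auto
    also have "\<dots> = (\<Prod>k\<in>UNIV. \<phi> c k (b k))"
      by (simp add: sum_lessThan_telescope 0)
    finally show ?thesis by simp
  qed simp
  have "(\<Sum>a\<in>PiE UNIV (\<lambda>k. {..<b k}). \<Sum>S\<in>UNIV. (-1) ^ card S * F (\<lambda>k. if k \<in> S then a k else Suc (a k)))
    = (\<Sum>a\<in>PiE UNIV (\<lambda>k. {..<b k}). \<Sum>S\<in>UNIV. (-1) ^ card S * (\<Sum>c\<in>C. F c * (\<Prod>k\<in>UNIV. \<phi> c k (if k \<in> S then a k else Suc (a k)))))"
  proof (intro sum.cong refl arg_cong2[where f="(*)"] F)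
    fix a S assume a: "a \<in> PiE UNIV (\<lambda>k. {..<b k})"
    then have "a k < b k" for k by (auto simp: PiE_iff)
    then show "(\<lambda>k. if k \<in> S then a k else Suc (a k)) \<in> C"
      by (auto simp: C_def PiE_iff intro: less_imp_le Suc_leI)
  qed
  also have "\<dots> = (\<Sum>c\<in>C. F c * (\<Sum>a\<in>PiE UNIV (\<lambda>k. {..<b k}). \<Sum>S\<in>UNIV. (-1) ^ card S * (\<Prod>k\<in>UNIV. \<phi> c k (if k \<in> S then a k else Suc (a k)))))"
  proof -
    have "(\<Sum>S\<in>UNIV. (-1) ^ card S * (\<Sum>c\<in>C. F c * P c S)) = (\<Sum>c\<in>C. F c * (\<Sum>S\<in>UNIV. (-1) ^ card S * P c S))"
      for P :: "('d \<Rightarrow> nat) \<Rightarrow> 'd set \<Rightarrow> real"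
      by (subst sum_distrib_left, subst sum.swap) (simp add: sum_distrib_left mult.left_commute)
    then show ?thesis
      by (simp only: sum_distrib_left) (rule sum.swap)
  qed
  also have "\<dots> = F b"
    unfolding tel by (rule F[symmetric]) (auto simp: C_def)
  finally show ?thesis .
qed

text \<open>The indices are sorted by the key \<open>f\<close> instead of sorting the values; this
  yields a permutation even when several values coincide.\<close>

lemma exists_sorting_permutation:
  fixes f :: "nat \<Rightarrow> 'a :: linorder"
  shows "\<exists>p. p permutes {..<m} \<and> (\<forall>i j. i \<le> j \<longrightarrow> j < m \<longrightarrow> f (p i) \<le> f (p j))"
proof -
  have "mset (sort_key f [0..<m]) = mset [0..<m]" by simp
  then obtain p where p: "p permutes {..<length [0..<m]}" "permute_list p [0..<m] = sort_key f [0..<m]"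
    by (rule mset_eq_permutation)
  have nth: "sort_key f [0..<m] ! i = p i" if "i < m" for i
  proof -
    have "p i < m" using permutes_in_image[OF p(1), of i] that by simp
    then show ?thesis
      using that unfolding p(2)[symmetric] by (simp add: permute_list_def)
  qed
  have "sorted (map f (sort_key f [0..<m]))" by simp
  then have "f (p i) \<le> f (p j)" if "i \<le> j" "j < m" for i j
    using that nth by (auto simp: sorted_iff_nth_mono)
  with p(1) show ?thesis by auto
qed

section \<open>Independent cells of a grid\<close>

definition grid_point :: "('d \<Rightarrow> nat \<Rightarrow> real) \<Rightarrow> ('d \<Rightarrow> nat) \<Rightarrow> real ^ 'd" where
  "grid_point g a = (\<chi> k. g k (a k))"

definition cell_volume :: "('d :: finite \<Rightarrow> nat \<Rightarrow> real) \<Rightarrow> ('d \<Rightarrow> nat) \<Rightarrow> real" where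
  "cell_volume g a = (\<Prod>k\<in>UNIV. g k (Suc (a k)) - g k (a k))"

text \<open>The index n of the family enters only as the intensity \<open>\<mu>\<close>, so a bound
  in this locale that does not mention \<open>\<mu>\<close> is uniform in n.\<close>

locale poisson_sheet =
  fixes M :: "'w measure" and T :: "real ^ 'd" and N :: "real ^ 'd \<Rightarrow> 'w \<Rightarrow> nat" and \<mu> :: real
  assumes pp: "poisson_process M T (natural_filtration M (\<lambda>t \<omega>. real (N t \<omega>))) \<mu> (\<lambda>t \<omega>. real (N t \<omega>))"
begin

abbreviation "X \<equiv> \<lambda>t \<omega>. real (N t \<omega>)"
abbreviation "SP \<equiv> strong_past M T (natural_filtration M X)"

sublocale prob_space M
  using pp by (simp add: poisson_process_def)

lemma intensity_pos: "0 < \<mu>"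
  using pp by (simp add: poisson_process_def)

lemma X_measurable: "t \<in> {0..T} \<Longrightarrow> X t \<in> borel_measurable M"
  using pp unfolding poisson_process_def by blast

lemma X_axes: "\<omega> \<in> space M \<Longrightarrow> t \<in> {0..T} \<Longrightarrow> t $ i = 0 \<Longrightarrow> X t \<omega> = 0"
  using pp unfolding poisson_process_def by blast

lemma sets_natural_filtration_subset: "sets (natural_filtration M X t) \<subseteq> Pow (space M)"
proof -
  have "space (natural_filtration M X t) = space M"
    by (simp add: natural_filtration_def space_measure_of_conv)
  then show ?thesis using sets.space_closed by metis
qed

text \<open>One coordinate suffices: the strong past is generated by the sigma-algebras at the
  points that have the coordinate of \<open>s\<close> in one direction and those of \<open>T\<close>
  in all the others.\<close>

lemma measurable_strong_past:
  assumes "r \<in> {0..T}" "s \<in> {0..T}" "r $ i \<le> s $ i"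
  shows "X r \<in> borel_measurable (SP s)"
proof (rule measurableI)
  fix A :: "real set" assume A: "A \<in> sets borel"
  define t where "t = (\<chi> j. if j = i then s $ j else T $ j)"
  have "r \<in> {0..t}"
    using assms by (auto simp: t_def less_eq_vec_def)
  then have "X r -` A \<inter> space M \<in> {X r -` A \<inter> space M | r A. r \<in> {0..t} \<and> A \<in> sets borel} \<union> null_sets M" (is "_ \<in> ?G")
    using A by blast
  moreover have "?G \<subseteq> Pow (space M)"
    using sets.sets_into_space by (fastforce dest: null_setsD2)
  ultimately have "X r -` A \<inter> space M \<in> sets (natural_filtration M X t)"
    by (simp add: natural_filtration_def sets_measure_of)
  moreover have "(\<Union>i. sets (natural_filtration M X (\<chi> j. if j = i then s $ j else T $ j))) \<subseteq> Pow (space M)"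
    using sets_natural_filtration_subset by blast
  ultimately have "X r -` A \<inter> space M \<in> sets (SP s)"
    unfolding strong_past_def t_def by (subst sets_measure_of) auto
  then show "X r -` A \<inter> space (SP s) \<in> sets (SP s)"
    by (simp add: strong_past_def space_measure_of_conv)
qed simp

text \<open>The sign of the increment is a function of the increment alone and \<open>Y\<close>
  belongs to the strong past, so the expectation factors and the Poisson law evaluates the first
  factor.\<close>

lemma expectation_mult_cos_increment:
  assumes s: "s \<in> {0..T}" and t: "t \<in> {0..T}" and st: "\<And>i. s $ i < t $ i"
    and Y: "Y \<in> borel_measurable (SP s)" and Y1: "\<And>\<omega>. \<omega> \<in> space M \<Longrightarrow> \<bar>Y \<omega>\<bar> \<le> 1"
  shows "expectation (\<lambda>\<omega>. cos (pi * increment (\<lambda>r. X r \<omega>) s t) * Y \<omega>)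
    = exp (- 2 * (\<mu> * (\<Prod>i\<in>UNIV. t $ i - s $ i))) * expectation Y"
proof -
  define D where "D = (\<lambda>\<omega>. increment (\<lambda>r. X r \<omega>) s t)"
  have ind: "indep_set (sets (vimage_algebra (space M) D borel)) (sets (SP s))"
    and dis: "distr M borel D = distr (measure_pmf (poisson_pmf (\<mu> * (\<Prod>i\<in>UNIV. t $ i - s $ i)))) borel real"
    using pp s t st unfolding poisson_process_def Let_def D_def by blast+
  have sub: "sets (SP s) \<subseteq> events" "sets (vimage_algebra (space M) D borel) \<subseteq> events"
    using indep_setD_ev1[OF ind] indep_setD_ev2[OF ind] by auto
  have sp: "space (SP s) = space M" by (simp add: strong_past_def space_measure_of_conv)
  have Dv: "D \<in> borel_measurable (vimage_algebra (space M) D borel)"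
    by (rule measurable_vimage_algebra1) auto
  then have Cv: "(\<lambda>\<omega>. cos (pi * D \<omega>)) \<in> borel_measurable (vimage_algebra (space M) D borel)"
    by measurable
  have DM[measurable]: "D \<in> borel_measurable M"
    using Dv sub(2) by (auto simp: measurable_def)
  have YM: "Y \<in> borel_measurable M"
    using Y sub(1) sp by (auto simp: measurable_def)
  have "indep_var borel (\<lambda>\<omega>. cos (pi * D \<omega>)) borel Y"
    unfolding indep_var_eq
  proof (intro conjI)
    show "(\<lambda>\<omega>. cos (pi * D \<omega>)) \<in> borel_measurable M" by measurable
    show "Y \<in> borel_measurable M" by (rule YM)
    \<comment> \<open>Independence is given for two sigma-algebras; those generated by the cosine
      and by \<open>Y\<close> are contained in them.\<close>
    have 1: "sigma_sets (space M) {(\<lambda>\<omega>. cos (pi * D \<omega>)) -` A \<inter> space M | A. A \<in> sets borel} \<subseteq> sets (vimage_algebra (space M) D borel)"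
      using measurable_sets[OF Cv]
      by (intro sets.sigma_sets_subset[of _ "vimage_algebra (space M) D borel", simplified]) (auto simp: space_vimage_algebra)
    have 2: "sigma_sets (space M) {Y -` A \<inter> space M | A. A \<in> sets borel} \<subseteq> sets (SP s)"
      using measurable_sets[OF Y] sp
      by (intro sets.sigma_sets_subset[of _ "SP s", unfolded sp]) auto
    show "indep_set (sigma_sets (space M) {(\<lambda>\<omega>. cos (pi * D \<omega>)) -` A \<inter> space M | A. A \<in> sets borel})
      (sigma_sets (space M) {Y -` A \<inter> space M | A. A \<in> sets borel})"
      using ind 1 2 unfolding indep_sets2_eq by blast
  qed
  then have "expectation (\<lambda>\<omega>. cos (pi * D \<omega>) * Y \<omega>) = expectation (\<lambda>\<omega>. cos (pi * D \<omega>)) * expectation Y"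
    by (intro indep_var_lebesgue_integral integrable_const_bound[where B=1]) (auto simp: YM Y1)
  also have "expectation (\<lambda>\<omega>. cos (pi * D \<omega>)) = (\<integral>x. cos (pi * x) \<partial>distr M borel D)"
    by (subst integral_distr) auto
  also have "\<dots> = exp (- 2 * (\<mu> * (\<Prod>i\<in>UNIV. t $ i - s $ i)))"
    unfolding dis using st intensity_pos by (intro integral_poisson_cos_pi mult_pos_pos prod_pos) auto
  finally show ?thesis by (simp add: D_def)
qed

definition cell_increment :: "('d \<Rightarrow> nat \<Rightarrow> real) \<Rightarrow> ('d \<Rightarrow> nat) \<Rightarrow> 'w \<Rightarrow> real" where
  "cell_increment g a \<omega> = increment (\<lambda>r. X r \<omega>) (grid_point g a) (grid_point g (\<lambda>k. Suc (a k)))"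

lemma cell_increment_eq:
  "cell_increment g a \<omega> = (\<Sum>S\<in>UNIV. (-1) ^ card S * X (grid_point g (\<lambda>k. if k \<in> S then a k else Suc (a k))) \<omega>)"
proof -
  have "(\<chi> i. if i \<in> S then grid_point g a $ i else grid_point g (\<lambda>k. Suc (a k)) $ i) = grid_point g (\<lambda>k. if k \<in> S then a k else Suc (a k))" for S
    by (auto simp: grid_point_def vec_eq_iff)
  then show ?thesis by (simp add: cell_increment_def increment_def)
qed

lemma cell_increment_Ints: "cell_increment g a \<omega> \<in> \<int>"
  unfolding cell_increment_eq by (intro Ints_sum Ints_mult Ints_power) auto

text \<open>
  The grid values are only weakly monotone, because coordinates of different points may coincide.
  Degenerate cells have increment and volume 0.
\<close>

context
  fixes g :: "'d \<Rightarrow> nat \<Rightarrow> real" and m :: nat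
  assumes g0: "\<And>k. g k 0 = 0" and gT: "\<And>k. g k m \<le> T $ k"
    and gmono: "\<And>k i j. i \<le> j \<Longrightarrow> j \<le> m \<Longrightarrow> g k i \<le> g k j"
begin

lemma grid_point_in:
  assumes "\<And>k. a k \<le> m"
  shows "grid_point g a \<in> {0..T}"
proof -
  have "0 \<le> g k (a k)" "g k (a k) \<le> T $ k" for k
    using gmono[of 0 "a k" k] gmono[of "a k" m k] gT[of k] g0[of k] assms[of k] by auto
  then show ?thesis by (simp add: grid_point_def less_eq_vec_def)
qed

text \<open>A vertex with a zero index lies on an axis, where the process vanishes, so telescoping
  over the cells below \<open>b\<close> leaves only the vertex \<open>b\<close>.\<close>

lemma X_grid_point_eq_sum:
  assumes "\<And>k. b k \<le> m" "\<omega> \<in> space M"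
  shows "X (grid_point g b) \<omega> = (\<Sum>a\<in>PiE UNIV (\<lambda>k. {..<b k}). cell_increment g a \<omega>)"
proof -
  \<comment> \<open>Vanishing at index 0 is needed for every \<open>c\<close>, but the process is
    controlled only inside \<open>[0, T]\<close>; cutting off beyond \<open>b\<close> reconciles the
    two.\<close>
  define F where "F c = (if \<forall>k. c k \<le> b k then X (grid_point g c) \<omega> else 0)" for c
  have F0: "F c = 0" if "c k = 0" for c k
  proof (cases "\<forall>k. c k \<le> b k")
    case True
    then have "grid_point g c \<in> {0..T}" using assms(1) by (intro grid_point_in) (meson order_trans)
    moreover have "grid_point g c $ k = 0" using that g0 by (simp add: grid_point_def)
    ultimately show ?thesis using X_axes[OF assms(2)] by (simp add: F_def)
  qed (auto simp: F_def)
  have "X (grid_point g b) \<omega> = F b" by (simp add: F_def)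
  also have "\<dots> = (\<Sum>a\<in>PiE UNIV (\<lambda>k. {..<b k}). \<Sum>S\<in>UNIV. (-1) ^ card S * F (\<lambda>k. if k \<in> S then a k else Suc (a k)))"
    by (rule sum_grid_increments[symmetric]) (rule F0)
  also have "\<dots> = (\<Sum>a\<in>PiE UNIV (\<lambda>k. {..<b k}). cell_increment g a \<omega>)"
    unfolding cell_increment_eq
  proof (intro sum.cong refl arg_cong2[where f="(*)"])
    fix a S assume "a \<in> PiE UNIV (\<lambda>k. {..<b k})"
    then have "\<And>k. a k < b k" by (auto simp: PiE_iff)
    then show "F (\<lambda>k. if k \<in> S then a k else Suc (a k)) = X (grid_point g (\<lambda>k. if k \<in> S then a k else Suc (a k))) \<omega>"
      by (auto simp: F_def less_imp_le Suc_le_eq)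
  qed
  finally show ?thesis .
qed

lemma cell_volume_nonneg: "(\<And>k. a k < m) \<Longrightarrow> 0 \<le> cell_volume g a"
  unfolding cell_volume_def by (intro prod_nonneg) (simp add: gmono Suc_le_eq)

text \<open>
  A cell that is maximal in the coordinatewise order has all other cells in its strong past,
  so that the maximal cells can be split off one after the other.
\<close>

lemma expectation_prod_cos_cells:
  assumes "finite A" "\<And>a k. a \<in> A \<Longrightarrow> a k < m"
  shows "expectation (\<lambda>\<omega>. \<Prod>a\<in>A. cos (pi * cell_increment g a \<omega>)) = (\<Prod>a\<in>A. exp (- 2 * (\<mu> * cell_volume g a)))"
  using assms
proof (induction "card A" arbitrary: A)
  case 0
  then show ?case by (simp add: prob_space)
next
  case (Suc n)
  from Suc.hyps Suc.prems have "A \<noteq> {}" by auto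
  with Suc.prems(1) obtain a where a: "a \<in> A" and amax: "\<And>b. b \<in> A \<Longrightarrow> a \<le> b \<Longrightarrow> a = b"
    using finite_has_maximal[of A] by metis
  let ?Y = "\<lambda>\<omega>. \<Prod>b\<in>A - {a}. cos (pi * cell_increment g b \<omega>)"
  have IH: "expectation ?Y = (\<Prod>b\<in>A - {a}. exp (- 2 * (\<mu> * cell_volume g b)))"
    using Suc a by (intro Suc.hyps(1)) auto
  have am: "a k < m" for k using Suc.prems(2) a by blast
  have "expectation (\<lambda>\<omega>. cos (pi * cell_increment g a \<omega>) * ?Y \<omega>) = exp (- 2 * (\<mu> * cell_volume g a)) * expectation ?Y"
  proof (cases "\<exists>k. g k (Suc (a k)) = g k (a k)")
    \<comment> \<open>The Poisson hypothesis covers only nondegenerate rectangles. Here the factor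
      is cos 0 = exp 0 = 1.\<close>
    case True
    then obtain k where k: "g k (Suc (a k)) = g k (a k)" by blast
    then have "cell_volume g a = 0" by (auto simp: cell_volume_def prod_zero_iff)
    moreover have "cell_increment g a \<omega> = 0" for \<omega>
      unfolding cell_increment_def by (rule increment_degenerate[of _ k]) (simp add: grid_point_def k)
    ultimately show ?thesis by simp
  next
    case False
    have lt: "grid_point g a $ i < grid_point g (\<lambda>k. Suc (a k)) $ i" for i
      using False gmono[of "a i" "Suc (a i)" i] am[of i] by (simp add: grid_point_def less_le) metis
    have ain: "grid_point g a \<in> {0..T}" using am by (intro grid_point_in) (simp add: less_imp_le)
    have vol: "cell_volume g a = (\<Prod>i\<in>UNIV. grid_point g (\<lambda>k. Suc (a k)) $ i - grid_point g a $ i)"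
      by (simp add: cell_volume_def grid_point_def)
    show ?thesis
      unfolding vol cell_increment_def[of g a]
    proof (rule expectation_mult_cos_increment[OF ain _ lt])
      show "grid_point g (\<lambda>k. Suc (a k)) \<in> {0..T}" using am by (intro grid_point_in) (simp add: Suc_leI)
      show "\<bar>?Y \<omega>\<bar> \<le> 1" for \<omega>
        by (auto simp: abs_prod intro!: prod_le_1)
      have "cell_increment g b \<in> borel_measurable (SP (grid_point g a))" if b: "b \<in> A - {a}" for b
      proof -
        \<comment> \<open>Maximality provides a direction \<open>k\<close> with
          \<open>b k < a k\<close>. Then even the upper vertices of the cell \<open>b\<close>, at
          index \<open>Suc (b k)\<close>, do not exceed the lower corner of the cell
          \<open>a\<close> in direction \<open>k\<close>.\<close>
        have "\<not> a \<le> b" using amax b by auto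
        then obtain k where k: "b k < a k" by (auto simp: le_fun_def not_le)
        have bm: "b k < m" for k using Suc.prems(2) b by blast
        show ?thesis
          unfolding cell_increment_eq[abs_def]
        proof (intro borel_measurable_sum borel_measurable_times borel_measurable_const measurable_strong_past[OF _ ain, of _ k])
          fix S
          show "grid_point g (\<lambda>k. if k \<in> S then b k else Suc (b k)) \<in> {0..T}"
            using bm by (intro grid_point_in) (auto simp: less_imp_le Suc_leI)
          show "grid_point g (\<lambda>k. if k \<in> S then b k else Suc (b k)) $ k \<le> grid_point g a $ k"
            using k am[of k] by (auto simp: grid_point_def intro!: gmono)
        qed
      qed
      then show "?Y \<in> borel_measurable (SP (grid_point g a))"
        by (intro borel_measurable_prod) measurable
    qed
  qed
  then show ?case
    using IH by (simp only: prod.remove[OF Suc.prems(1) a])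
qed

end

text \<open>The sign at \<open>u j\<close> is the product of the signs of all cells in the box below
  \<open>u j\<close>. In the product over \<open>j\<close> a cell occurs as often as such boxes
  contain it, so exactly the cells with odd multiplicity survive, and the expectation is determined
  by their total volume. The bound keeps only the volume of suitable cells along the coordinate
  directions.\<close>

lemma expectation_prod_signs_le:
  fixes u :: "nat \<Rightarrow> real ^ 'd" and L :: "'d \<Rightarrow> real"
  assumes h: "0 < h" and L0: "\<And>i. 0 \<le> L i"
    and Lu: "\<And>j i. j < 2 * h \<Longrightarrow> L i \<le> u j $ i" and uT: "\<And>j i. j < 2 * h \<Longrightarrow> u j $ i \<le> T $ i"
  shows "\<exists>\<sigma>. (\<forall>i. \<sigma> i permutes {..<2 * h}) \<and>
    \<bar>expectation (\<lambda>\<omega>. \<Prod>j<2 * h. (-1) ^ N (u j) \<omega>)\<bar> \<le>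
      exp (- 2 * (\<mu> * (\<Sum>i\<in>UNIV. (\<Prod>k\<in>UNIV - {i}. L k) * (\<Sum>r<h. \<bar>u (\<sigma> i (2 * r)) $ i - u (\<sigma> i (2 * r + 1)) $ i\<bar>))))"
proof -
  define m where "m = 2 * h"
  have "\<forall>i. \<exists>p. p permutes {..<m} \<and> (\<forall>a b. a \<le> b \<longrightarrow> b < m \<longrightarrow> u (p a) $ i \<le> u (p b) $ i)"
    by (intro allI exists_sorting_permutation)
  then obtain \<sigma> where \<sigma>: "\<And>i. \<sigma> i permutes {..<m}"
    and sorted: "\<And>i a b. a \<le> b \<Longrightarrow> b < m \<Longrightarrow> u (\<sigma> i a) $ i \<le> u (\<sigma> i b) $ i"
    by metis
  have \<sigma>_lt: "\<sigma> i l < m \<longleftrightarrow> l < m" for i l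
    using permutes_in_image[OF \<sigma>, of i l] by simp
  have inv_lt: "inv (\<sigma> i) l < m \<longleftrightarrow> l < m" for i l
    using permutes_in_image[OF permutes_inv[OF \<sigma>], of i l] by simp
  \<comment> \<open>Index 0 is the axis; for positive \<open>l\<close> up to \<open>m\<close>,
    \<open>g k l\<close> is the \<open>l\<close>-th smallest of the \<open>k\<close>-th coordinates,
    hence the shift by one.\<close>
  define g where "g k l = (if l = 0 then 0 else u (\<sigma> k (l - 1)) $ k)" for k l
  have g0: "g k 0 = 0" for k by (simp add: g_def)
  have gT: "g k m \<le> T $ k" for k
    using h uT[of "\<sigma> k (m - 1)" k] \<sigma>_lt[of k "m - 1"] by (simp add: g_def m_def)
  have u0: "0 \<le> u j $ k" if "j < m" for j k
    using Lu[of j k] L0[of k] that by (simp add: m_def)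
  have gmono: "g k i \<le> g k j" if "i \<le> j" "j \<le> m" for k i j
    using that sorted[of "i - 1" "j - 1" k] u0[of "\<sigma> k (j - 1)" k] \<sigma>_lt[of k "j - 1"]
    by (auto simp: g_def)
  note cells = g0 gT gmono
  \<comment> \<open>\<open>b j k\<close> is the rank of \<open>u j\<close> in direction
    \<open>k\<close>, counted from 1, with ties broken by the permutation.\<close>
  define b where "b j k = Suc (inv (\<sigma> k) j)" for j k
  have bm: "b j k \<le> m" if "j < m" for j k
    using inv_lt[of k j] that by (simp add: b_def Suc_le_eq)
  have gb: "grid_point g (b j) = u j" for j
    using permutes_inverses(1)[OF \<sigma>] by (simp add: grid_point_def g_def b_def vec_eq_iff)
  define A where "A = PiE (UNIV :: 'd set) (\<lambda>_. {..<m})"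
  define B where "B j = PiE (UNIV :: 'd set) (\<lambda>k. {..<b j k})" for j
  have finA: "finite A" unfolding A_def by (intro finite_PiE) auto
  have BA: "B j \<subseteq> A" if "j < m" for j
    using bm[OF that] unfolding A_def B_def by (intro PiE_mono) auto
  \<comment> \<open>The number of boxes below the points \<open>u j\<close> that contain the cell
    \<open>a\<close>.\<close>
  define c where "c a = card {j. j < m \<and> a \<in> B j}" for a
  define Ao where "Ao = {a \<in> A. odd (c a)}"
  have finAo: "finite Ao" using finA by (simp add: Ao_def)
  have Aom: "a k < m" if "a \<in> Ao" for a k
    using that by (auto simp: Ao_def A_def PiE_iff)
  have signs: "(\<Prod>j<m. (-1) ^ N (u j) \<omega>) = (\<Prod>a\<in>Ao. cos (pi * cell_increment g a \<omega>))" if \<omega>: "\<omega> \<in> space M" for \<omega>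
  proof -
    have "(\<Prod>j<m. (-1) ^ N (u j) \<omega>) = (\<Prod>j<m. \<Prod>a\<in>A. if a \<in> B j then cos (pi * cell_increment g a \<omega>) else 1)"
    proof (rule prod.cong[OF refl])
      fix j assume "j \<in> {..<m}"
      then have j: "j < m" by simp
      have "(-1) ^ N (u j) \<omega> = cos (pi * X (u j) \<omega>)" by simp
      also have "X (u j) \<omega> = (\<Sum>a\<in>B j. cell_increment g a \<omega>)"
        using X_grid_point_eq_sum[of g m "b j", OF cells bm[OF j] \<omega>] unfolding gb B_def by simp
      also have "cos (pi * \<dots>) = (\<Prod>a\<in>B j. cos (pi * cell_increment g a \<omega>))"
        using finite_subset[OF BA[OF j] finA] by (intro cos_pi_sum_Ints cell_increment_Ints)
      also have "\<dots> = (\<Prod>a\<in>A. if a \<in> B j then cos (pi * cell_increment g a \<omega>) else 1)"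
        using finA BA[OF j] by (simp add: prod.If_cases Int_absorb1)
      finally show "(-1) ^ N (u j) \<omega> = (\<Prod>a\<in>A. if a \<in> B j then cos (pi * cell_increment g a \<omega>) else 1)" .
    qed
    also have "\<dots> = (\<Prod>a\<in>A. \<Prod>j<m. if a \<in> B j then cos (pi * cell_increment g a \<omega>) else 1)"
      by (rule prod.swap)
    also have "\<dots> = (\<Prod>a\<in>A. cos (pi * cell_increment g a \<omega>) ^ c a)"
      by (intro prod.cong refl) (simp add: prod.If_cases c_def Collect_conj_eq lessThan_def)
    also have "\<dots> = (\<Prod>a\<in>A. if odd (c a) then cos (pi * cell_increment g a \<omega>) else 1)"
      by (intro prod.cong refl cos_pi_Ints_power cell_increment_Ints)
    also have "\<dots> = (\<Prod>a\<in>Ao. cos (pi * cell_increment g a \<omega>))"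
      unfolding Ao_def using finA by (simp add: prod.inter_filter)
    finally show ?thesis .
  qed
  have "expectation (\<lambda>\<omega>. \<Prod>j<m. (-1) ^ N (u j) \<omega>) = expectation (\<lambda>\<omega>. \<Prod>a\<in>Ao. cos (pi * cell_increment g a \<omega>))"
    by (rule Bochner_Integration.integral_cong[OF refl]) (rule signs)
  also have "\<dots> = (\<Prod>a\<in>Ao. exp (- 2 * (\<mu> * cell_volume g a)))"
    by (rule expectation_prod_cos_cells[of g m]) (use cells finAo Aom in blast)+
  also have "\<dots> = exp (- 2 * (\<mu> * (\<Sum>a\<in>Ao. cell_volume g a)))"
    using finAo by (simp add: exp_sum sum_distrib_left)
  finally have E: "expectation (\<lambda>\<omega>. \<Prod>j<m. (-1) ^ N (u j) \<omega>) = exp (- 2 * (\<mu> * (\<Sum>a\<in>Ao. cell_volume g a)))" .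
  \<comment> \<open>These cells lie in the lowest layer in every direction except \<open>i\<close>;
    in direction \<open>i\<close> they lie between the order statistics \<open>2 * r + 1\<close> and
    \<open>2 * r + 2\<close>, counted from 1.\<close>
  define e where "e = (\<lambda>(i :: 'd, r). \<lambda>k. if k = i then Suc (2 * r) else (0 :: nat))"
  have e_inj: "inj_on e (UNIV \<times> {..<h})"
  proof (rule inj_onI, clarify)
    fix i i' r r' assume "e (i, r) = e (i', r')"
    then have "e (i, r) i = e (i', r') i" by simp
    then show "i = i' \<and> r = r'" by (auto simp: e_def split: if_splits)
  qed
  have e_Ao: "e (i, r) \<in> Ao" if r: "r < h" for i r
  proof -
    \<comment> \<open>All ranks are at least 1, so only direction \<open>i\<close> matters: the
      boxes of all but the lowest \<open>2 * r + 1\<close> points contain the cell. Their number is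
      odd because \<open>m\<close> is even.\<close>
    have "{j. j < m \<and> e (i, r) \<in> B j} = \<sigma> i ` {Suc (2 * r)..<m}"
    proof (intro set_eqI iffI)
      fix j assume "j \<in> {j. j < m \<and> e (i, r) \<in> B j}"
      then have "j < m" "e (i, r) i < b j i" by (auto simp: B_def PiE_iff)
      then show "j \<in> \<sigma> i ` {Suc (2 * r)..<m}"
        using inv_lt[of i j] permutes_inverses(1)[OF \<sigma>, of i j]
        by (intro image_eqI[of _ _ "inv (\<sigma> i) j"]) (auto simp: e_def b_def)
    next
      fix j assume "j \<in> \<sigma> i ` {Suc (2 * r)..<m}"
      then show "j \<in> {j. j < m \<and> e (i, r) \<in> B j}"
        using \<sigma>_lt permutes_inverses(2)[OF \<sigma>] by (auto simp: B_def PiE_iff e_def b_def)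
    qed
    then have "c (e (i, r)) = m - Suc (2 * r)"
      using permutes_inj[OF \<sigma>, of i] by (simp add: c_def card_image inj_on_subset)
    then have "odd (c (e (i, r)))" using r by (simp add: m_def)
    moreover have "e (i, r) \<in> A" using r by (auto simp: A_def PiE_iff e_def m_def)
    ultimately show ?thesis by (simp add: Ao_def)
  qed
  \<comment> \<open>In a direction \<open>k\<close> other than \<open>i\<close> the cell reaches
    from the axis to the smallest coordinate, which is at least \<open>L k\<close>.\<close>
  have vol: "(\<Prod>k\<in>UNIV - {i}. L k) * \<bar>u (\<sigma> i (2 * r)) $ i - u (\<sigma> i (2 * r + 1)) $ i\<bar> \<le> cell_volume g (e (i, r))" if r: "r < h" for i r
  proof -
    have "cell_volume g (e (i, r)) = (g i (Suc (Suc (2 * r))) - g i (Suc (2 * r))) * (\<Prod>k\<in>UNIV - {i}. g k (Suc (e (i, r) k)) - g k (e (i, r) k))"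
      unfolding cell_volume_def by (subst prod.remove[of UNIV i, OF finite UNIV_I]) (simp add: e_def)
    also have "(\<Prod>k\<in>UNIV - {i}. g k (Suc (e (i, r) k)) - g k (e (i, r) k)) = (\<Prod>k\<in>UNIV - {i}. u (\<sigma> k 0) $ k)"
      by (rule prod.cong) (auto simp: e_def g_def)
    also have "g i (Suc (Suc (2 * r))) - g i (Suc (2 * r)) = \<bar>u (\<sigma> i (2 * r)) $ i - u (\<sigma> i (2 * r + 1)) $ i\<bar>"
      using sorted[of "2 * r" "2 * r + 1" i] r by (simp add: g_def m_def)
    also have "\<dots> * (\<Prod>k\<in>UNIV - {i}. u (\<sigma> k 0) $ k) \<ge> \<dots> * (\<Prod>k\<in>UNIV - {i}. L k)"
    proof (intro mult_left_mono prod_mono conjI L0)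
      fix k
      show "L k \<le> u (\<sigma> k 0) $ k" using h \<sigma>_lt[of k 0] by (intro Lu) (simp add: m_def)
    qed simp
    finally show ?thesis by (simp add: mult.commute)
  qed
  have "(\<Sum>i\<in>UNIV. (\<Prod>k\<in>UNIV - {i}. L k) * (\<Sum>r<h. \<bar>u (\<sigma> i (2 * r)) $ i - u (\<sigma> i (2 * r + 1)) $ i\<bar>))
    \<le> (\<Sum>i\<in>UNIV. \<Sum>r<h. cell_volume g (e (i, r)))"
    unfolding sum_distrib_left using vol by (intro sum_mono) auto
  also have "\<dots> = (\<Sum>a\<in>e ` (UNIV \<times> {..<h}). cell_volume g a)"
    by (simp add: sum.cartesian_product sum.reindex[OF e_inj] case_prod_beta')
  also have "\<dots> \<le> (\<Sum>a\<in>Ao. cell_volume g a)"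
    using e_Ao finAo Aom by (intro sum_mono2 cell_volume_nonneg[of g m, OF cells]) auto
  finally have "\<bar>expectation (\<lambda>\<omega>. \<Prod>j<m. (-1) ^ N (u j) \<omega>)\<bar> \<le>
      exp (- 2 * (\<mu> * (\<Sum>i\<in>UNIV. (\<Prod>k\<in>UNIV - {i}. L k) * (\<Sum>r<h. \<bar>u (\<sigma> i (2 * r)) $ i - u (\<sigma> i (2 * r + 1)) $ i\<bar>))))"
    unfolding E using intensity_pos by simp
  then show ?thesis using \<sigma> unfolding m_def by blast
qed

text \<open>Right continuity makes the process the limit of its values at the next grid points above.\<close>

lemma X_jointly_measurable:
  assumes T0: "\<And>i. 0 \<le> T $ i"
  shows "(\<lambda>z. X (\<chi> i. max 0 (min (T $ i) (fst z $ i))) (snd z)) \<in> borel_measurable (borel \<Otimes>\<^sub>M M)"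
proof -
  define cl :: "real ^ 'd \<Rightarrow> real ^ 'd" where "cl v = (\<chi> i. max 0 (min (T $ i) (v $ i)))" for v
  have cl_in: "cl v \<in> {0..T}" for v
    using T0 by (auto simp: cl_def less_eq_vec_def)
  define idx :: "nat \<Rightarrow> real ^ 'd \<Rightarrow> 'd \<Rightarrow> int" where "idx K v i = \<lceil>real (Suc K) * cl v $ i\<rceil>" for K v i
  \<comment> \<open>Rounding up can leave \<open>[0, T]\<close>. Clamping once more corrects this
    and keeps the point above \<open>cl v\<close>, in the quadrant of right continuity.\<close>
  define p :: "nat \<Rightarrow> ('d \<Rightarrow> int) \<Rightarrow> real ^ 'd" where "p K c = cl (\<chi> i. of_int (c i) / real (Suc K))" for K c
  have p_nth: "p K c $ i = max 0 (min (T $ i) (of_int (c i) / real (Suc K)))" for K c i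
    by (simp add: p_def cl_def)
  have cl0: "0 \<le> cl v $ i" and clT: "cl v $ i \<le> T $ i" for v i
    using cl_in[of v] by (auto simp: less_eq_vec_def)
  have p_ge_nth: "cl v $ i \<le> p K (idx K v) $ i" for K v i
  proof -
    have "cl v $ i \<le> of_int (idx K v i) / real (Suc K)"
      by (simp add: idx_def field_simps del: of_nat_Suc)
    then show ?thesis
      using clT by (simp add: p_nth le_max_iff_disj)
  qed
  then have p_ge: "cl v \<le> p K (idx K v)" for K v
    by (simp add: less_eq_vec_def)
  have p_le: "p K (idx K v) $ i \<le> cl v $ i + 1 / real (Suc K)" for K v i
  proof -
    have "of_int (idx K v i) \<le> real (Suc K) * cl v $ i + 1"
      unfolding idx_def by (rule of_int_ceiling_le_add_one)
    then have "of_int (idx K v i) / real (Suc K) \<le> cl v $ i + 1 / real (Suc K)"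
      by (simp add: field_simps del: of_nat_Suc)
    moreover have "0 \<le> cl v $ i + 1 / real (Suc K)"
      using cl0 by simp
    ultimately show ?thesis by (simp add: p_nth min_le_iff_disj)
  qed
  have p_lim: "(\<lambda>K. p K (idx K v)) \<longlonglongrightarrow> cl v" for v
  proof (rule vec_tendstoI)
    fix i
    have "(\<lambda>K. cl v $ i + 1 / real (Suc K)) \<longlonglongrightarrow> cl v $ i + 0"
      by (rule tendsto_add[OF tendsto_const LIMSEQ_Suc[OF lim_inverse_n']])
    then have "(\<lambda>K. cl v $ i + 1 / real (Suc K)) \<longlonglongrightarrow> cl v $ i"
      by simp
    from tendsto_sandwich[OF _ _ tendsto_const this] show "(\<lambda>K. p K (idx K v) $ i) \<longlonglongrightarrow> cl v $ i"
      using p_ge_nth p_le by (simp del: of_nat_Suc)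
  qed
  have "(\<lambda>z. X (cl (fst z)) (snd z)) \<in> borel_measurable (borel \<Otimes>\<^sub>M M)"
  proof (rule borel_measurable_LIMSEQ_real)
    fix z assume "z \<in> space ((borel :: (real ^ 'd) measure) \<Otimes>\<^sub>M M)"
    then have z: "snd z \<in> space M" by (auto simp: space_pair_measure)
    let ?v = "fst z"
    have "cadlag_on T (\<lambda>t. X t (snd z))"
      using pp z unfolding poisson_process_def by blast
    then have "((\<lambda>t. X t (snd z)) \<longlongrightarrow> X (cl ?v) (snd z)) (at (cl ?v) within {u\<in>{0..T}. cl ?v \<le> u})"
      using cl_in[of ?v] unfolding cadlag_on_def by blast
    then have "continuous (at (cl ?v) within {u\<in>{0..T}. cl ?v \<le> u}) (\<lambda>t. X t (snd z))"
      by (simp add: continuous_within)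
    moreover have "p K (idx K ?v) \<in> {u\<in>{0..T}. cl ?v \<le> u}" for K
      using p_ge cl_in by (auto simp: p_def)
    ultimately show "(\<lambda>K. X (p K (idx K (fst z))) (snd z)) \<longlonglongrightarrow> X (cl (fst z)) (snd z)"
      unfolding continuous_within_sequentially comp_def
      by (elim allE[of _ "\<lambda>K. p K (idx K ?v)"] impE) (use p_lim in auto)
  next
    fix K
    show "(\<lambda>z. X (p K (idx K (fst z))) (snd z)) \<in> borel_measurable (borel \<Otimes>\<^sub>M M)"
    \<comment> \<open>For fixed \<open>K\<close> the index ranges over a countable type, so
      measurability in \<omega> at each fixed grid point suffices.\<close>
    proof (rule measurable_compose_countable[of "\<lambda>c z. X (p K c) (snd z)"])
      fix c
      have "X (p K c) \<in> borel_measurable M"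
        using cl_in by (intro X_measurable) (auto simp: p_def)
      then show "(\<lambda>z. X (p K c) (snd z)) \<in> borel_measurable (borel \<Otimes>\<^sub>M M)"
        by measurable
    next
      show "(\<lambda>z. idx K (fst z)) \<in> measurable (borel \<Otimes>\<^sub>M M) (count_space UNIV)"
      proof (subst measurable_count_space_eq_countable, safe)
        fix c
        have "(\<lambda>z. idx K (fst z)) -` {c} \<inter> space ((borel :: (real ^ 'd) measure) \<Otimes>\<^sub>M M)
          = {z \<in> space (borel \<Otimes>\<^sub>M M). \<forall>i. idx K (fst z) i = c i}"
          by (auto simp: fun_eq_iff)
        also have "\<dots> \<in> sets (borel \<Otimes>\<^sub>M M)"
          unfolding idx_def cl_def by simp
        finally show "(\<lambda>z. idx K (fst z)) -` {c} \<inter> space (borel \<Otimes>\<^sub>M M) \<in> sets (borel \<Otimes>\<^sub>M M)" .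
      qed auto
    qed
  qed
  then show ?thesis by (simp add: cl_def)
qed

section \<open>Moments on a dyadic box\<close>

text \<open>Outside \<open>[0, T]\<close> nothing is known about \<open>N\<close>; clamping makes the field measurable on the whole space.\<close>

definition clamped_sign :: "real ^ 'd \<Rightarrow> 'w \<Rightarrow> real" where
  "clamped_sign u \<omega> = (-1) ^ N (\<chi> i. max 0 (min (T $ i) (u $ i))) \<omega>"

lemma clamped_sign_eq: "u \<in> {0..T} \<Longrightarrow> clamped_sign u \<omega> = (-1) ^ N u \<omega>"
proof -
  assume "u \<in> {0..T}"
  then have "(\<chi> i. max 0 (min (T $ i) (u $ i))) = u"
    by (auto simp: vec_eq_iff less_eq_vec_def min_absorb2 max_absorb2)
  then show ?thesis by (simp add: clamped_sign_def)
qed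

lemma abs_clamped_sign [simp]: "\<bar>clamped_sign u \<omega>\<bar> = 1"
  by (simp add: clamped_sign_def power_abs)

lemma measurable_clamped_sign:
  assumes T0: "\<And>i. 0 < T $ i"
  shows "(\<lambda>z. clamped_sign (fst z) (snd z)) \<in> borel_measurable (borel \<Otimes>\<^sub>M M)"
proof -
  note X_jointly_measurable[OF less_imp_le[OF T0], measurable]
  have "(\<lambda>z. cos (pi * X (\<chi> i. max 0 (min (T $ i) (fst z $ i))) (snd z))) \<in> borel_measurable (borel \<Otimes>\<^sub>M M)"
    by measurable
  then show ?thesis by (simp add: clamped_sign_def)
qed

text \<open>The power of the integral is an integral over \<open>2 * h\<close> copies of the space,
  and Fubini moves the expectation inside onto the product of signs. The result is the multilinear
  form to which the Cauchy-Schwarz bound applies with all functions equal to |f|. In each direction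
  (2h)! permutations contribute \<open>h\<close> pairs of mass 1 / (\<mu> M_i) each.\<close>

lemma moment_box_le:
  fixes f :: "real ^ 'd \<Rightarrow> real" and L :: "'d \<Rightarrow> real"
  assumes T0: "\<And>i. 0 < T $ i" and h: "0 < h" and L0: "\<And>i. 0 < L i"
    and f[measurable]: "f \<in> borel_measurable borel" and fi: "integrable lborel f"
    and f2: "integrable lborel (\<lambda>u. (f u)\<^sup>2)"
    and supp: "\<And>u i. f u \<noteq> 0 \<Longrightarrow> L i \<le> u $ i \<and> u $ i \<le> T $ i"
  shows "expectation (\<lambda>\<omega>. (\<integral>u. f u * clamped_sign u \<omega> \<partial>lborel) ^ (2 * h))
    \<le> (\<Prod>i\<in>UNIV. fact (2 * h) * (1 / (\<mu> * (\<Prod>k\<in>UNIV - {i}. L k))) ^ h) * (\<integral>u. (f u)\<^sup>2 \<partial>lborel) ^ h"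
proof -
  define I where "I = {..<2 * h}"
  have finI[simp]: "finite I" by (simp add: I_def)
  interpret L: product_sigma_finite "\<lambda>_::nat. lborel :: (real ^ 'd) measure"
    by (simp add: product_sigma_finite_def lborel.sigma_finite_measure_axioms)
  let ?P = "PiM I (\<lambda>_. lborel :: (real ^ 'd) measure)"
  interpret LI: sigma_finite_measure ?P by (rule L.sigma_finite) simp
  interpret PM: pair_sigma_finite ?P M ..
  note measurable_clamped_sign[OF T0, measurable]
  have sm: "(\<lambda>u. clamped_sign u \<omega>) \<in> borel_measurable borel" if "\<omega> \<in> space M" for \<omega>
    using measurable_compose_Pair1[OF that, of "\<lambda>z. clamped_sign (snd z) (fst z)" borel borel]
      measurable_pair_swap[OF measurable_clamped_sign[OF T0]] by (simp add: case_prod_beta')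
  have int1: "integrable lborel (\<lambda>u. f u * clamped_sign u \<omega>)" if "\<omega> \<in> space M" for \<omega>
    using sm[OF that] by (intro Bochner_Integration.integrable_bound[OF fi]) (auto simp: abs_mult)
  have intf: "integrable ?P (\<lambda>x. \<Prod>j\<in>I. \<bar>f (x j)\<bar>)"
    by (intro L.product_integrable_prod) (auto intro: integrable_abs[OF fi])
  have Fm[measurable]: "(\<lambda>z. \<Prod>j\<in>I. f (fst z j) * clamped_sign (fst z j) (snd z)) \<in> borel_measurable (?P \<Otimes>\<^sub>M M)"
  proof (intro borel_measurable_prod borel_measurable_times)
    fix j assume j: "j \<in> I"
    have c: "(\<lambda>z. fst z j) \<in> borel_measurable (?P \<Otimes>\<^sub>M M)"
      using measurable_compose[OF measurable_fst measurable_component_singleton[OF j, of "\<lambda>_. lborel :: (real ^ 'd) measure"]] by simp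
    then show "(\<lambda>z. f (fst z j)) \<in> borel_measurable (?P \<Otimes>\<^sub>M M)" by measurable
    have "(\<lambda>z. (fst z j, snd z)) \<in> measurable (?P \<Otimes>\<^sub>M M) (borel \<Otimes>\<^sub>M M)"
      using c by measurable
    from measurable_compose[OF this measurable_clamped_sign[OF T0]]
    show "(\<lambda>z. clamped_sign (fst z j) (snd z)) \<in> borel_measurable (?P \<Otimes>\<^sub>M M)" by simp
  qed
  \<comment> \<open>Signs have modulus 1, so the absolute value does not depend on \<omega> and
    joint integrability reduces to that of \<open>f\<close>.\<close>
  have absF: "\<bar>\<Prod>j\<in>I. f (x j) * clamped_sign (x j) \<omega>\<bar> = (\<Prod>j\<in>I. \<bar>f (x j)\<bar>)" for x \<omega>
    by (simp add: abs_prod abs_mult)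
  have intF: "integrable (?P \<Otimes>\<^sub>M M) (\<lambda>(x, \<omega>). \<Prod>j\<in>I. f (x j) * clamped_sign (x j) \<omega>)"
  proof (rule PM.Fubini_integrable)
    show "(\<lambda>(x, \<omega>). \<Prod>j\<in>I. f (x j) * clamped_sign (x j) \<omega>) \<in> borel_measurable (?P \<Otimes>\<^sub>M M)"
      using Fm by (simp add: case_prod_beta')
    show "integrable ?P (\<lambda>x. \<integral>\<omega>. norm (case (x, \<omega>) of (x, \<omega>) \<Rightarrow> \<Prod>j\<in>I. f (x j) * clamped_sign (x j) \<omega>) \<partial>M)"
      using intf by (simp add: absF prob_space)
    show "AE x in ?P. integrable M (\<lambda>\<omega>. case (x, \<omega>) of (x, \<omega>) \<Rightarrow> \<Prod>j\<in>I. f (x j) * clamped_sign (x j) \<omega>)"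
    proof (rule AE_I2)
      fix x assume "x \<in> space ?P"
      then have "(\<lambda>\<omega>. \<Prod>j\<in>I. f (x j) * clamped_sign (x j) \<omega>) \<in> borel_measurable M"
        using measurable_compose_Pair1[OF _ Fm] by simp
      then show "integrable M (\<lambda>\<omega>. case (x, \<omega>) of (x, \<omega>) \<Rightarrow> \<Prod>j\<in>I. f (x j) * clamped_sign (x j) \<omega>)"
        by (intro integrable_const_bound[of _ "\<Prod>j\<in>I. \<bar>f (x j)\<bar>"]) (auto simp: absF)
    qed
  qed
  define E where "E x = expectation (\<lambda>\<omega>. \<Prod>j\<in>I. clamped_sign (x j) \<omega>)" for x
  have "expectation (\<lambda>\<omega>. (\<integral>u. f u * clamped_sign u \<omega> \<partial>lborel) ^ (2 * h))
    = expectation (\<lambda>\<omega>. \<integral>x. (\<Prod>j\<in>I. f (x j) * clamped_sign (x j) \<omega>) \<partial>?P)"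
  proof (rule Bochner_Integration.integral_cong[OF refl])
    fix \<omega> assume "\<omega> \<in> space M"
    then show "(\<integral>u. f u * clamped_sign u \<omega> \<partial>lborel) ^ (2 * h) = (\<integral>x. (\<Prod>j\<in>I. f (x j) * clamped_sign (x j) \<omega>) \<partial>?P)"
      using int1 by (subst L.product_integral_prod) (auto simp: I_def)
  qed
  also have "\<dots> = (\<integral>x. expectation (\<lambda>\<omega>. \<Prod>j\<in>I. f (x j) * clamped_sign (x j) \<omega>) \<partial>?P)"
    by (rule PM.Fubini_integral[OF intF])
  finally have eq: "expectation (\<lambda>\<omega>. (\<integral>u. f u * clamped_sign u \<omega> \<partial>lborel) ^ (2 * h))
    = (\<integral>x. expectation (\<lambda>\<omega>. \<Prod>j\<in>I. f (x j) * clamped_sign (x j) \<omega>) \<partial>?P)" .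
  define M' where "M' i = (\<Prod>k\<in>UNIV - {i}. L k)" for i
  have M'0: "0 < M' i" for i unfolding M'_def using L0 by (intro prod_pos) auto
  \<comment> \<open>The 2 comes from the exponent of the Poisson sign; it cancels against the 2 in
    the mass \<open>2 / l i\<close> of the exponential kernel.\<close>
  define l where "l i = 2 * (\<mu> * M' i)" for i
  have l0: "0 < l i" for i using M'0 intensity_pos by (simp add: l_def)
  have nn: "0 \<le> fact (2 * h) * (1 / (\<mu> * M' i)) ^ h" for i
    using M'0[of i] intensity_pos by simp
  \<comment> \<open>The sorting permutation varies with the configuration; the sum over all
    permutations dominates whichever one occurs.\<close>
  define H :: "'d \<Rightarrow> (nat \<Rightarrow> real) \<Rightarrow> ennreal" where
    "H i x = (\<Sum>s | s permutes I. ennreal (exp (- l i * (\<Sum>r<h. \<bar>x (s (2 * r)) - x (s (2 * r + 1))\<bar>))))" for i x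
  have cs: "cs_bound I (lborel :: (real ^ 'd) measure) (\<lambda>z. \<Prod>i\<in>UNIV. H i (\<lambda>j\<in>I. z j $ i))
    (\<Prod>i\<in>UNIV. of_nat (card {s. s permutes I}) * ennreal (2 / l i) ^ h)"
    unfolding H_def I_def
    by (intro cs_bound_vec cs_bound_sum cs_bound_exp_permutation l0) (auto intro: finite_permutations)
  \<comment> \<open>If some \<open>f (x j)\<close> vanishes, the left side is 0. Otherwise all
    points lie in the support of \<open>f\<close>, which provides the lower bound \<open>L\<close>
    for the coordinates.\<close>
  have pt: "ennreal \<bar>expectation (\<lambda>\<omega>. \<Prod>j\<in>I. f (x j) * clamped_sign (x j) \<omega>)\<bar>
    \<le> (\<Prod>j\<in>I. ennreal \<bar>f (x j)\<bar>) * (\<Prod>i\<in>UNIV. H i (\<lambda>j\<in>I. x j $ i))" for x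
  proof (cases "\<exists>j\<in>I. f (x j) = 0")
    case True
    then have z: "(\<Prod>j\<in>I. f (x j) * clamped_sign (x j) \<omega>) = 0" for \<omega>
      by (auto simp: prod_zero_iff)
    show ?thesis unfolding z by simp
  next
    case False
    then have s: "L i \<le> x j $ i" "x j $ i \<le> T $ i" if "j < 2 * h" for i j
      using supp[of "x j" i] that by (auto simp: I_def)
    have xin: "x j \<in> {0..T}" if "j < 2 * h" for j
    proof -
      have "0 \<le> x j $ i" for i using s(1)[OF that, of i] L0[of i] by linarith
      then show ?thesis using s(2)[OF that] by (simp add: less_eq_vec_def)
    qed
    obtain \<sigma> where \<sigma>: "\<And>i. \<sigma> i permutes I" and le: "\<bar>expectation (\<lambda>\<omega>. \<Prod>j<2 * h. (-1) ^ N (x j) \<omega>)\<bar> \<le>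
      exp (- 2 * (\<mu> * (\<Sum>i\<in>UNIV. (\<Prod>k\<in>UNIV - {i}. L k) * (\<Sum>r<h. \<bar>x (\<sigma> i (2 * r)) $ i - x (\<sigma> i (2 * r + 1)) $ i\<bar>))))"
      using expectation_prod_signs_le[of h L x, OF h less_imp_le[OF L0] s] unfolding I_def by blast
    define S where "S i = (\<Sum>r<h. \<bar>x (\<sigma> i (2 * r)) $ i - x (\<sigma> i (2 * r + 1)) $ i\<bar>)" for i
    have "(\<Prod>j<2 * h. (-1) ^ N (x j) \<omega>) = (\<Prod>j\<in>I. clamped_sign (x j) \<omega>)" for \<omega>
      unfolding I_def by (intro prod.cong refl clamped_sign_eq[symmetric] xin) auto
    then have "\<bar>E x\<bar> \<le> exp (- 2 * (\<mu> * (\<Sum>i\<in>UNIV. M' i * S i)))"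
      using le unfolding E_def S_def M'_def by simp
    also have "\<dots> = (\<Prod>i\<in>UNIV. exp (- l i * S i))"
      by (simp add: exp_sum[symmetric] l_def sum_distrib_left sum_negf[symmetric] mult_ac)
    finally have "ennreal \<bar>E x\<bar> \<le> (\<Prod>i\<in>UNIV. ennreal (exp (- l i * S i)))"
      by (simp add: prod_ennreal)
    also have "\<dots> \<le> (\<Prod>i\<in>UNIV. H i (\<lambda>j\<in>I. x j $ i))"
    proof (rule prod_mono_ennreal)
      fix i
      have "\<sigma> i (2 * r) \<in> I" "\<sigma> i (2 * r + 1) \<in> I" if "r < h" for r
        using permutes_in_image[OF \<sigma>, of i] that by (auto simp: I_def)
      then have "S i = (\<Sum>r<h. \<bar>(\<lambda>j\<in>I. x j $ i) (\<sigma> i (2 * r)) - (\<lambda>j\<in>I. x j $ i) (\<sigma> i (2 * r + 1))\<bar>)"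
        unfolding S_def by (intro sum.cong) auto
      then show "ennreal (exp (- l i * S i)) \<le> H i (\<lambda>j\<in>I. x j $ i)"
        unfolding H_def using \<sigma>[of i]
        by (intro member_le_sum[of "\<sigma> i", THEN order_trans[rotated]]) (auto intro: finite_permutations)
    qed
    finally have Ex: "ennreal \<bar>E x\<bar> \<le> (\<Prod>i\<in>UNIV. H i (\<lambda>j\<in>I. x j $ i))" .
    have "\<bar>expectation (\<lambda>\<omega>. \<Prod>j\<in>I. f (x j) * clamped_sign (x j) \<omega>)\<bar> = (\<Prod>j\<in>I. \<bar>f (x j)\<bar>) * \<bar>E x\<bar>"
      by (simp add: prod.distrib E_def abs_mult abs_prod)
    then have "ennreal \<bar>expectation (\<lambda>\<omega>. \<Prod>j\<in>I. f (x j) * clamped_sign (x j) \<omega>)\<bar> = (\<Prod>j\<in>I. ennreal \<bar>f (x j)\<bar>) * ennreal \<bar>E x\<bar>"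
      by (simp add: ennreal_mult prod_nonneg prod_ennreal)
    then show ?thesis using Ex by (auto intro: mult_left_mono)
  qed
  have intE: "integrable ?P (\<lambda>x. expectation (\<lambda>\<omega>. \<Prod>j\<in>I. f (x j) * clamped_sign (x j) \<omega>))"
    using PM.integrable_fst[OF intF] .
  have F2: "(\<integral>\<^sup>+u. (ennreal \<bar>f u\<bar>)\<^sup>2 \<partial>lborel) = ennreal (\<integral>u. (f u)\<^sup>2 \<partial>lborel)"
    using f2 by (subst nn_integral_eq_integral[symmetric]) (auto simp: ennreal_power)
  have "ennreal \<bar>\<integral>x. expectation (\<lambda>\<omega>. \<Prod>j\<in>I. f (x j) * clamped_sign (x j) \<omega>) \<partial>?P\<bar>
    \<le> (\<integral>\<^sup>+x. ennreal \<bar>expectation (\<lambda>\<omega>. \<Prod>j\<in>I. f (x j) * clamped_sign (x j) \<omega>)\<bar> \<partial>?P)"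
    using integral_norm_bound_ennreal[OF intE] by simp
  also have "\<dots> \<le> (\<integral>\<^sup>+x. (\<Prod>j\<in>I. ennreal \<bar>f (x j)\<bar>) * (\<Prod>i\<in>UNIV. H i (\<lambda>j\<in>I. x j $ i)) \<partial>?P)"
    by (intro nn_integral_mono pt)
  also have "\<dots> \<le> (\<Prod>i\<in>UNIV. of_nat (card {s. s permutes I}) * ennreal (2 / l i) ^ h) *
    (\<Prod>j\<in>I. ennsqrt (\<integral>\<^sup>+u. (ennreal \<bar>f u\<bar>)\<^sup>2 \<partial>lborel))"
    by (rule cs_boundD[OF cs, of "\<lambda>j u. ennreal \<bar>f u\<bar>"]) simp
  also have "(\<Prod>j\<in>I. ennsqrt (\<integral>\<^sup>+u. (ennreal \<bar>f u\<bar>)\<^sup>2 \<partial>lborel)) = ennreal (\<integral>u. (f u)\<^sup>2 \<partial>lborel) ^ h"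
    by (simp add: F2 I_def power_mult ennsqrt_power2)
  also have "card {s. s permutes I} = fact (2 * h)"
    by (rule card_permutations) (auto simp: I_def)
  also have "(\<Prod>i\<in>UNIV. of_nat (fact (2 * h)) * ennreal (2 / l i) ^ h) = ennreal (\<Prod>i\<in>UNIV. fact (2 * h) * (1 / (\<mu> * M' i)) ^ h)"
  proof -
    have "of_nat (fact (2 * h)) * ennreal (2 / l i) ^ h = ennreal (fact (2 * h) * (1 / (\<mu> * M' i)) ^ h)" for i
      using l0[of i] by (simp add: ennreal_mult ennreal_power l_def ennreal_of_nat_eq_real_of_nat)
    then show ?thesis by (simp only: prod_ennreal[OF nn])
  qed
  also have "\<dots> * ennreal (\<integral>u. (f u)\<^sup>2 \<partial>lborel) ^ h = ennreal ((\<Prod>i\<in>UNIV. fact (2 * h) * (1 / (\<mu> * M' i)) ^ h) * (\<integral>u. (f u)\<^sup>2 \<partial>lborel) ^ h)"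
    by (subst ennreal_mult) (auto simp: ennreal_power intro!: prod_nonneg nn)
  finally have "\<bar>\<integral>x. expectation (\<lambda>\<omega>. \<Prod>j\<in>I. f (x j) * clamped_sign (x j) \<omega>) \<partial>?P\<bar>
      \<le> (\<Prod>i\<in>UNIV. fact (2 * h) * (1 / (\<mu> * M' i)) ^ h) * (\<integral>u. (f u)\<^sup>2 \<partial>lborel) ^ h"
    by (subst (asm) ennreal_le_iff) (intro mult_nonneg_nonneg prod_nonneg nn zero_le_power Bochner_Integration.integral_nonneg zero_le_power2)
  then show ?thesis unfolding eq M'_def by linarith
qed

end

section \<open>Elementary inequalities for the summation\<close>

lemma Youngs_inequality_scaled:
  fixes x c q :: real
  assumes q: "1 < q" and x: "0 \<le> x" and c: "0 < c"
  shows "x \<le> x powr q * (c powr (1 - q) / q) + (1 - 1 / q) * c"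
proof -
  \<comment> \<open>The factor \<open>x\<close> is split as \<open>a * b\<close> so that
    \<open>b\<close> raised to the conjugate exponent is \<open>c\<close>. Equality then holds at
    \<open>x = c\<close>, and \<open>c\<close> remains free for optimisation.\<close>
  define a where "a = x * c powr (- (q - 1) / q)"
  define b where "b = c powr ((q - 1) / q)"
  have ab: "a * b = x"
    using c q by (simp add: a_def b_def powr_add[symmetric] field_simps)
  have "a * b \<le> a powr q / q + b powr (q / (q - 1)) / (q / (q - 1))"
    using x c q by (intro Youngs_inequality) (auto simp: a_def b_def field_simps)
  moreover have "a powr q = x powr q * c powr (1 - q)"
    using x c q by (simp add: a_def powr_mult powr_powr)
  moreover have "b powr (q / (q - 1)) = c"
    using c q by (simp add: b_def powr_powr)
  ultimately show ?thesis using ab q by (simp add: field_simps)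
qed

text \<open>Hoelder's inequality for the square of \<open>g\<close> and the indicator of
  \<open>Q\<close>, with exponents q and q / (q - 1). It is obtained by integrating the scaled Young
  inequality and optimising the scale \<open>c\<close>.\<close>

lemma integral_square_le_powr:
  fixes g :: "'a \<Rightarrow> real"
  assumes q: "1 < q" and Q: "Q \<in> sets M" and V: "measure M Q \<le> V" "0 < V" and fin: "emeasure M Q < \<infinity>"
    and i2: "integrable M (\<lambda>u. indicator Q u * (g u)\<^sup>2)"
    and iq: "integrable M (\<lambda>u. \<bar>g u\<bar> powr (2 * q))"
  shows "(\<integral>u. indicator Q u * (g u)\<^sup>2 \<partial>M) \<le> (\<integral>u. \<bar>g u\<bar> powr (2 * q) \<partial>M) powr (1 / q) * V powr (1 - 1 / q)"
proof -
  define A where "A = (\<integral>u. \<bar>g u\<bar> powr (2 * q) \<partial>M)"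
  have A0: "0 \<le> A" unfolding A_def by (intro Bochner_Integration.integral_nonneg) auto
  have young: "(\<integral>u. indicator Q u * (g u)\<^sup>2 \<partial>M) \<le> A * (c powr (1 - q) / q) + (1 - 1 / q) * c * V" if c: "0 < c" for c
  proof -
    have iQ: "integrable M (indicator Q :: 'a \<Rightarrow> real)"
      using Q fin by (simp add: integrable_indicator_iff)
    have "(\<integral>u. indicator Q u * (g u)\<^sup>2 \<partial>M)
      \<le> (\<integral>u. \<bar>g u\<bar> powr (2 * q) * (c powr (1 - q) / q) + (1 - 1 / q) * c * indicator Q u \<partial>M)"
    proof (rule integral_mono[OF i2])
      show "integrable M (\<lambda>u. \<bar>g u\<bar> powr (2 * q) * (c powr (1 - q) / q) + (1 - 1 / q) * c * indicator Q u)"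
        using iq iQ by (intro Bochner_Integration.integrable_add integrable_mult_left integrable_mult_right) auto
      fix u
      have "((g u)\<^sup>2) powr q = \<bar>g u\<bar> powr (2 * q)"
      proof (cases "g u = 0")
        case False
        then have "(g u)\<^sup>2 = \<bar>g u\<bar> powr 2" by (simp add: powr_realpow[of "\<bar>g u\<bar>" 2, simplified])
        then show ?thesis by (simp only: powr_powr)
      qed simp
      then show "indicator Q u * (g u)\<^sup>2 \<le> \<bar>g u\<bar> powr (2 * q) * (c powr (1 - q) / q) + (1 - 1 / q) * c * indicator Q u"
        using Youngs_inequality_scaled[OF q _ c, of "(g u)\<^sup>2"] q by (auto simp: indicator_def)
    qed
    also have "\<dots> = A * (c powr (1 - q) / q) + (1 - 1 / q) * c * measure M Q"
      using iq iQ Q fin sets.sets_into_space[OF Q]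
      by (subst Bochner_Integration.integral_add) (auto simp: A_def Int_absorb1 intro!: integrable_mult_left integrable_mult_right)
    also have "\<dots> \<le> A * (c powr (1 - q) / q) + (1 - 1 / q) * c * V"
      using V c q by (intro add_left_mono mult_left_mono) auto
    finally show ?thesis .
  qed
  show ?thesis
  proof (cases "A = 0")
    case True
    \<comment> \<open>The optimal scale would be 0, which is not admissible, so \<open>c\<close> is
      chosen arbitrarily small instead.\<close>
    have "(\<integral>u. indicator Q u * (g u)\<^sup>2 \<partial>M) \<le> 0 + e" if "0 < e" for e
    proof -
      define c where "c = e / ((1 - 1 / q) * V)"
      have "0 < (1 - 1 / q) * V" using q V by simp
      then have "0 < c" "(1 - 1 / q) * c * V = e" using that q V by (auto simp: c_def field_simps)
      then show ?thesis using young[of c] True by simp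
    qed
    then have "(\<integral>u. indicator Q u * (g u)\<^sup>2 \<partial>M) \<le> 0" by (rule field_le_epsilon)
    then show ?thesis by (simp add: True[unfolded A_def])
  next
    case False
    with A0 have A: "0 < A" by simp
    \<comment> \<open>This scale makes A c^(1-q) and c V equal, and the coefficients 1/q and 1 - 1/q
      then add up to 1.\<close>
    define c where "c = (A / V) powr (1 / q)"
    have c: "0 < c" using A V by (simp add: c_def)
    have "A * c powr (1 - q) = A powr (1 / q) * V powr (1 - 1 / q)"
    proof -
      have "c powr (1 - q) = (A / V) powr (1 / q - 1)" using q by (simp add: c_def powr_powr diff_divide_distrib)
      also have "\<dots> = A powr (1 / q - 1) * V powr (1 - 1 / q)"
        using A V by (simp add: powr_divide powr_minus_divide[symmetric] divide_powr_uminus)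
      finally show ?thesis using A by (simp add: powr_diff)
    qed
    moreover have "c * V = A powr (1 / q) * V powr (1 - 1 / q)"
      using A V by (simp add: c_def powr_divide powr_diff)
    ultimately have "A * (c powr (1 - q) / q) + (1 - 1 / q) * c * V = A powr (1 / q) * V powr (1 - 1 / q)"
      by (simp add: field_simps)
    then show ?thesis using young[OF c] by (simp add: A_def)
  qed
qed

text \<open>Jensen's inequality for the n-th power, convex on the whole line for even
  \<open>n\<close>, at the points \<open>a i / w i\<close> with normalised weights. It replaces
  Minkowski's inequality: if each \<open>a i\<close> has n-th moment at most D times the n-th power
  of \<open>w i\<close>, then the sum has n-th moment at most D times the n-th power of the total
  weight.\<close>

lemma sum_power_even_le:
  fixes a w :: "'a \<Rightarrow> real"
  assumes S: "finite S" "S \<noteq> {}" and w: "\<And>i. i \<in> S \<Longrightarrow> 0 < w i" and n: "even n"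
  shows "(\<Sum>i\<in>S. a i) ^ n \<le> (\<Sum>i\<in>S. w i) ^ n * (\<Sum>i\<in>S. w i / (\<Sum>i\<in>S. w i) * (a i / w i) ^ n)"
proof -
  define W where "W = (\<Sum>i\<in>S. w i)"
  have W: "0 < W" unfolding W_def using S w by (intro sum_pos) auto
  have "(\<Sum>i\<in>S. (w i / W) *\<^sub>R (a i / w i)) ^ n \<le> (\<Sum>i\<in>S. w i / W * (a i / w i) ^ n)"
    using S w W n
    by (intro convex_on_sum[OF S convex_power_even]) (auto simp: sum_divide_distrib[symmetric] W_def less_imp_le)
  also have "(\<Sum>i\<in>S. (w i / W) *\<^sub>R (a i / w i)) = (\<Sum>i\<in>S. a i) / W"
    unfolding sum_divide_distrib by (intro sum.cong refl) (use w in force)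
  finally show ?thesis using W by (simp add: W_def[symmetric] power_divide field_simps)
qed

text \<open>Each \<open>L k\<close> is missing from exactly one of the d factors. Multiplication by
  the full product restores the missing ones.\<close>

lemma prod_prod_remove:
  fixes L :: "'d :: finite \<Rightarrow> real"
  assumes L0: "\<And>i. 0 < L i"
  shows "(\<Prod>i\<in>UNIV. \<Prod>k\<in>UNIV - {i}. L k) = (\<Prod>k\<in>UNIV. L k) ^ (CARD('d) - 1)"
proof -
  define P where "P = (\<Prod>k\<in>UNIV. L k)"
  have P: "0 < P" unfolding P_def using L0 by (intro prod_pos) auto
  have "(\<Prod>i\<in>UNIV. \<Prod>k\<in>UNIV - {i}. L k) * P = (\<Prod>i\<in>UNIV. L i * (\<Prod>k\<in>UNIV - {i}. L k))"
    by (simp add: P_def prod.distrib mult.commute)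
  also have "\<dots> = (\<Prod>i\<in>(UNIV :: 'd set). P)"
    by (intro prod.cong refl) (simp add: P_def prod.remove[symmetric])
  also have "\<dots> = P ^ (CARD('d) - 1) * P"
    by (simp add: power_Suc2[symmetric] del: power_Suc)
  finally have "(\<Prod>i\<in>UNIV. \<Prod>k\<in>UNIV - {i}. L k) = P ^ (CARD('d) - 1)"
    using P by simp
  then show ?thesis by (simp only: P_def)
qed

lemma sets_vec_box [measurable]:
  "{u :: real ^ 'd. \<forall>i. a i < u $ i \<and> u $ i \<le> b i} \<in> sets borel"
proof -
  have "{u \<in> space borel. \<forall>i. a i < u $ i \<and> u $ i \<le> b i} \<in> sets (borel :: (real ^ 'd) measure)"
    by measurable
  then show ?thesis by simp
qed

section \<open>Cancellation of the weight on a dyadic box\<close>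

context poisson_sheet
begin

text \<open>The Kac-Stroock kernel with the clamped sign: it agrees with \<open>kac_stroock\<close>
  on \<open>[0, T]\<close> when \<open>\<mu>\<close> is n, and is jointly measurable on the whole
  space.\<close>

definition sign_kernel :: "real ^ 'd \<Rightarrow> 'w \<Rightarrow> real" where
  "sign_kernel u \<omega> = \<mu> powr (real CARD('d) / 2) * sqrt (\<Prod>i\<in>UNIV. u $ i) ^ (CARD('d) - 1) * clamped_sign u \<omega>"

text \<open>The deterministic weight is absorbed into the function to which
  \<open>moment_box_le\<close> is applied, and its square is replaced by its upper bound on
  \<open>Q\<close>. The further conclusions are what Hoelder's inequality on \<open>Q\<close>
  requires.\<close>

lemma moment_sign_kernel_box_le:
  fixes g :: "real ^ 'd \<Rightarrow> real" and L :: "'d \<Rightarrow> real"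
  assumes T0: "\<And>i. 0 < T $ i" and h: "0 < h" and L0: "\<And>i. 0 < L i" and LT: "\<And>i. 2 * L i \<le> T $ i"
    and g[measurable]: "g \<in> borel_measurable borel" and B: "\<And>u. \<bar>g u\<bar> \<le> B"
  defines "Q \<equiv> {u. \<forall>i. L i < u $ i \<and> u $ i \<le> 2 * L i}"
  shows "expectation (\<lambda>\<omega>. (\<integral>u. indicator Q u * g u * sign_kernel u \<omega> \<partial>lborel) ^ (2 * h))
    \<le> fact (2 * h) ^ CARD('d) * ((2 ^ CARD('d)) ^ (CARD('d) - 1)) ^ h * (\<integral>u. indicator Q u * (g u)\<^sup>2 \<partial>lborel) ^ h"
    and "integrable lborel (\<lambda>u. indicator Q u * (g u)\<^sup>2)"
    and "emeasure lborel Q < \<infinity>" and "measure lborel Q \<le> (\<Prod>i\<in>UNIV. L i)"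
proof -
  let ?d = "CARD('d)"
  define P where "P = (\<Prod>i\<in>UNIV. L i)"
  have P0: "0 < P" unfolding P_def using L0 by (intro prod_pos) auto
  have [measurable]: "Q \<in> sets borel" unfolding Q_def by measurable
  have Qc: "Q \<subseteq> cbox (\<chi> i. L i) (\<chi> i. 2 * L i)"
    by (auto simp: Q_def mem_box_cart less_imp_le)
  show fin: "emeasure lborel Q < \<infinity>"
    using emeasure_mono[OF Qc, of lborel] emeasure_lborel_cbox_finite[of "\<chi> i. L i" "\<chi> i. 2 * L i"]
    by (auto simp: less_top[symmetric] top_unique)
  have "measure lborel Q \<le> measure lborel (cbox (\<chi> i. L i) (\<chi> i. 2 * L i))"
    using Qc by (intro measure_mono_fmeasurable) auto
  also have "\<dots> = (\<Prod>i\<in>UNIV. L i)"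
  proof (subst content_cbox_cart)
    have "(\<chi> i. L i) \<in> cbox (\<chi> i. L i) (\<chi> i. 2 * L i)"
      using L0 by (simp add: mem_box_cart less_imp_le)
    then show "cbox (\<chi> i. L i) (\<chi> i. 2 * L i) \<noteq> {}" by blast
  qed simp
  finally show "measure lborel Q \<le> (\<Prod>i\<in>UNIV. L i)" .
  have iQ: "integrable lborel (\<lambda>u. c * indicator Q u :: real)" for c
    using fin by (intro integrable_mult_right) (simp add: integrable_indicator_iff)
  have bd: "integrable lborel (\<lambda>u. indicator Q u * k u)" if "k \<in> borel_measurable borel" "\<And>u. u \<in> Q \<Longrightarrow> \<bar>k u\<bar> \<le> c" for k :: "real ^ 'd \<Rightarrow> real" and c
    using that by (intro Bochner_Integration.integrable_bound[OF iQ[of c]]) (auto simp: indicator_def intro!: AE_I2 intro: order_trans[OF _ abs_ge_self])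
  show i2: "integrable lborel (\<lambda>u. indicator Q u * (g u)\<^sup>2)"
    using B by (intro bd[of _ "B\<^sup>2"]) (auto intro!: abs_le_square_iff[THEN iffD1] order_trans[OF B])
  have Qprod: "0 \<le> (\<Prod>i\<in>UNIV. u $ i)" "(\<Prod>i\<in>UNIV. u $ i) \<le> 2 ^ ?d * P" if "u \<in> Q" for u
  proof -
    have "0 \<le> u $ i" "u $ i \<le> 2 * L i" for i
      using that L0[of i] by (auto simp: Q_def intro: order_trans[OF less_imp_le less_imp_le])
    then have "0 \<le> (\<Prod>i\<in>UNIV. u $ i)" "(\<Prod>i\<in>UNIV. u $ i) \<le> (\<Prod>i\<in>UNIV. 2 * L i)"
      by (auto intro!: prod_nonneg prod_mono)
    then show "0 \<le> (\<Prod>i\<in>UNIV. u $ i)" "(\<Prod>i\<in>UNIV. u $ i) \<le> 2 ^ ?d * P"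
      by (auto simp: prod.distrib P_def)
  qed
  define w where "w u = \<mu> powr (real ?d / 2) * sqrt (\<Prod>i\<in>UNIV. u $ i) ^ (?d - 1)" for u :: "real ^ 'd"
  have wm[measurable]: "w \<in> borel_measurable borel" unfolding w_def by measurable
  have w2: "(w u)\<^sup>2 = \<mu> ^ ?d * (\<Prod>i\<in>UNIV. u $ i) ^ (?d - 1)" if "u \<in> Q" for u
  proof -
    have "(\<mu> powr (real ?d / 2))\<^sup>2 = \<mu> ^ ?d"
      using intensity_pos by (simp add: power2_eq_square powr_add[symmetric] powr_realpow)
    moreover have "(sqrt (\<Prod>i\<in>UNIV. u $ i) ^ (?d - 1))\<^sup>2 = ((sqrt (\<Prod>i\<in>UNIV. u $ i))\<^sup>2) ^ (?d - 1)"
      by (metis power_mult mult.commute)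
    ultimately show ?thesis using Qprod(1)[OF that] by (simp add: w_def power_mult_distrib)
  qed
  \<comment> \<open>Upper bound of the squared weight on \<open>Q\<close>, where the product of the
    coordinates is at most 2^d \<open>P\<close>.\<close>
  define K where "K = \<mu> ^ ?d * (2 ^ ?d * P) ^ (?d - 1)"
  have K0: "0 < K" using intensity_pos P0 by (simp add: K_def)
  have w2K: "(w u)\<^sup>2 \<le> K" if "u \<in> Q" for u
    unfolding w2[OF that] K_def using intensity_pos Qprod[OF that] by (intro mult_left_mono power_mono) auto
  define f where "f u = indicator Q u * (g u * w u)" for u
  have fsq: "(f u)\<^sup>2 = indicator Q u * ((g u)\<^sup>2 * (w u)\<^sup>2)" for u
    by (auto simp: f_def indicator_def power_mult_distrib)
  have wK: "\<bar>w u\<bar> \<le> sqrt K" if "u \<in> Q" for u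
    using w2K[OF that] by (simp add: real_le_rsqrt)
  have B0: "0 \<le> B" using B[of 0] by linarith
  have fi: "integrable lborel f"
    unfolding f_def using wK B B0 by (intro bd[of _ "B * sqrt K"]) (auto simp: abs_mult intro!: mult_mono)
  have f2: "integrable lborel (\<lambda>u. (f u)\<^sup>2)"
    unfolding fsq using w2K B B0
    by (intro bd[of _ "B\<^sup>2 * K"]) (auto simp: abs_mult intro!: mult_mono abs_le_square_iff[THEN iffD1] order_trans[OF B])
  have "expectation (\<lambda>\<omega>. (\<integral>u. indicator Q u * g u * sign_kernel u \<omega> \<partial>lborel) ^ (2 * h))
    = expectation (\<lambda>\<omega>. (\<integral>u. f u * clamped_sign u \<omega> \<partial>lborel) ^ (2 * h))"
    by (simp add: sign_kernel_def f_def w_def mult_ac)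
  also have "\<dots> \<le> (\<Prod>i\<in>UNIV. fact (2 * h) * (1 / (\<mu> * (\<Prod>k\<in>UNIV - {i}. L k))) ^ h) * (\<integral>u. (f u)\<^sup>2 \<partial>lborel) ^ h"
  proof (rule moment_box_le[OF T0 h L0 _ fi f2])
    show "f \<in> borel_measurable borel" unfolding f_def by measurable
    fix u i assume "f u \<noteq> 0"
    then have "u \<in> Q" by (auto simp: f_def indicator_def)
    then show "L i \<le> u $ i \<and> u $ i \<le> T $ i"
      using LT[of i] by (auto simp: Q_def intro: less_imp_le order_trans)
  qed
  also have "(\<Prod>i\<in>UNIV. fact (2 * h) * (1 / (\<mu> * (\<Prod>k\<in>UNIV - {i}. L k))) ^ h)
    = fact (2 * h) ^ ?d * (1 / (\<mu> ^ ?d * P ^ (?d - 1))) ^ h"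
    by (simp add: prod.distrib prod_dividef prod_power_distrib[symmetric] prod_prod_remove[OF L0] P_def power_one_over)
  also have "\<dots> * (\<integral>u. (f u)\<^sup>2 \<partial>lborel) ^ h
    \<le> \<dots> * (K * (\<integral>u. indicator Q u * (g u)\<^sup>2 \<partial>lborel)) ^ h"
  proof (intro mult_left_mono power_mono)
    have "(\<integral>u. (f u)\<^sup>2 \<partial>lborel) \<le> (\<integral>u. K * (indicator Q u * (g u)\<^sup>2) \<partial>lborel)"
    proof (rule integral_mono[OF f2 integrable_mult_right[OF i2]])
      fix u
      show "(f u)\<^sup>2 \<le> K * (indicator Q u * (g u)\<^sup>2)"
        using w2K[of u] mult_right_mono[of "(w u)\<^sup>2" K "(g u)\<^sup>2"] by (auto simp: fsq indicator_def mult.commute)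
    qed
    then show "(\<integral>u. (f u)\<^sup>2 \<partial>lborel) \<le> K * (\<integral>u. indicator Q u * (g u)\<^sup>2 \<partial>lborel)" by simp
  qed (use intensity_pos P0 in auto)
  also have "\<dots> = fact (2 * h) ^ ?d * ((1 / (\<mu> ^ ?d * P ^ (?d - 1))) * K) ^ h * (\<integral>u. indicator Q u * (g u)\<^sup>2 \<partial>lborel) ^ h"
    by (simp only: power_mult_distrib mult.assoc)
  \<comment> \<open>Here the intensity and the position of the box disappear from the
    constant.\<close>
  also have "(1 / (\<mu> ^ ?d * P ^ (?d - 1))) * K = (2 ^ ?d) ^ (?d - 1)"
    using intensity_pos P0 by (simp add: K_def power_mult_distrib)
  finally show "expectation (\<lambda>\<omega>. (\<integral>u. indicator Q u * g u * sign_kernel u \<omega> \<partial>lborel) ^ (2 * h))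
    \<le> fact (2 * h) ^ ?d * ((2 ^ ?d) ^ (?d - 1)) ^ h * (\<integral>u. indicator Q u * (g u)\<^sup>2 \<partial>lborel) ^ h" .
qed

section \<open>Summation over the dyadic boxes\<close>

lemma measurable_sign_kernel:
  assumes T0: "\<And>i. 0 < T $ i"
  shows "(\<lambda>z. sign_kernel (fst z) (snd z)) \<in> borel_measurable (borel \<Otimes>\<^sub>M M)"
  unfolding sign_kernel_def
proof (rule borel_measurable_times)
  show "(\<lambda>z. clamped_sign (fst z) (snd z)) \<in> borel_measurable (borel \<Otimes>\<^sub>M M)"
    by (rule measurable_clamped_sign[OF T0])
qed measurable

text \<open>Finitely many boxes are treated with a bound independent of their number, and dominated
  convergence adds the rest. The first factor of the constant bounds the m-th power of the total
  weight of the boxes; the remaining factors bound the m-th moment on one box after division by its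
  weight.\<close>

lemma moment_sign_kernel_le:
  fixes g :: "real ^ 'd \<Rightarrow> real" and q :: real
  assumes T0: "\<And>i. 0 < T $ i" and h: "0 < h" and q: "1 < q"
    and g[measurable]: "g \<in> borel_measurable borel" and B: "\<And>u. \<bar>g u\<bar> \<le> B"
    and supp: "\<And>u i. g u \<noteq> 0 \<Longrightarrow> 0 < u $ i \<and> u $ i \<le> T $ i"
  shows "expectation (\<lambda>\<omega>. (\<integral>u. g u * sign_kernel u \<omega> \<partial>lborel) ^ (2 * h))
    \<le> (1 / (1 - sqrt ((1 / 2) powr (1 - 1 / q)))) ^ (CARD('d) * (2 * h)) *
       (fact (2 * h) ^ CARD('d) * ((2 ^ CARD('d)) ^ (CARD('d) - 1)) ^ h * ((\<Prod>i\<in>UNIV. T $ i) powr (1 - 1 / q)) ^ h) *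
       ((\<integral>u. \<bar>g u\<bar> powr (2 * q) \<partial>lborel) powr (1 / q)) ^ h"
proof -
  let ?d = "CARD('d)" and ?k = sign_kernel
  define C0 :: real where "C0 = fact (2 * h) ^ ?d * ((2 ^ ?d) ^ (?d - 1)) ^ h"
  have C0: "0 \<le> C0" by (simp add: C0_def)
  define A where "A = (\<integral>u. \<bar>g u\<bar> powr (2 * q) \<partial>lborel)"
  define V where "V = (\<Prod>i\<in>UNIV. T $ i)"
  have V0: "0 < V" unfolding V_def using T0 by (intro prod_pos) auto
  \<comment> \<open>Hoelder's inequality gives the factor (1/2)^(1 - 1/q) per halving of a side, in
    a bound for a squared norm; hence the square root. The condition \<open>1 < q\<close> makes it
    less than 1.\<close>
  define \<rho> where "\<rho> = sqrt ((1 / 2) powr (1 - 1 / q))"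
  have \<rho>2: "\<rho>\<^sup>2 = (1 / 2) powr (1 - 1 / q)" by (simp add: \<rho>_def)
  have \<rho>: "0 < \<rho>" "\<rho> < 1"
  proof -
    show "0 < \<rho>" by (simp add: \<rho>_def)
    have "(1 / 2 :: real) powr (1 - 1 / q) < (1 / 2) powr 0"
      using q by (intro powr_less_mono') auto
    then show "\<rho> < 1" by (simp add: \<rho>_def real_sqrt_lt_1_iff)
  qed
  define D where "D = C0 * (V powr (1 - 1 / q)) ^ h * (A powr (1 / q)) ^ h"
  have D0: "0 \<le> D" unfolding D_def using C0 by simp
  have B0: "0 \<le> B" using B[of 0] by linarith
  have bnd: "\<bar>g u * ?k u \<omega>\<bar> \<le> B * (\<mu> powr (real ?d / 2) * sqrt V ^ (?d - 1)) * indicator {0..T} u" for u \<omega>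
  proof (cases "g u = 0")
    case False
    then have u: "0 \<le> u $ i" "u $ i \<le> T $ i" for i using supp[of u i] by auto
    then have "u \<in> {0..T}" by (auto simp: less_eq_vec_def)
    moreover have "sqrt (\<Prod>i\<in>UNIV. u $ i) \<le> sqrt V"
      unfolding V_def using u by (intro real_sqrt_le_mono prod_mono) auto
    moreover have "0 \<le> (\<Prod>i\<in>UNIV. u $ i)" using u by (intro prod_nonneg) auto
    ultimately show ?thesis
      using B[of u] B0 by (auto simp: sign_kernel_def abs_mult power_abs intro!: mult_mono power_mono)
  qed (use B0 V0 in \<open>auto intro!: mult_nonneg_nonneg simp: less_imp_le\<close>)
  define c where "c = B * (\<mu> powr (real ?d / 2) * sqrt V ^ (?d - 1))"
  have iT: "integrable lborel (\<lambda>u. k * indicator {0..T} u)" for k :: real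
  proof -
    have "emeasure lborel {0..T} < \<infinity>"
      unfolding interval_cbox_cart by (rule emeasure_lborel_cbox_finite)
    then show ?thesis by (intro integrable_mult_right) (simp add: integrable_indicator_iff)
  qed
  note cint = iT[of c]
  \<comment> \<open>\<open>R\<close> bounds all the integrals below independently of \<omega> and of
    the cutoff \<open>\<phi>\<close>. It yields integrability over \<open>M\<close> and the
    dominating constant for the final limit.\<close>
  define R where "R = (\<integral>u. c * indicator {0..T} u \<partial>lborel)"
  note km = measurable_sign_kernel[OF T0]
  have km1: "(\<lambda>u. ?k u \<omega>) \<in> borel_measurable borel" if "\<omega> \<in> space M" for \<omega>
    using measurable_compose[OF _ km, of "\<lambda>u. (u, \<omega>)" borel] that by simp
  \<comment> \<open>\<open>\<phi>\<close> stands for a cutoff: the indicator of one box, or the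
    indicator \<open>\<psi> K\<close> of finitely many.\<close>
  have int: "integrable lborel (\<lambda>u. \<phi> u * (g u * ?k u \<omega>))"
    and le_R: "\<bar>\<integral>u. \<phi> u * (g u * ?k u \<omega>) \<partial>lborel\<bar> \<le> R"
    and le_c: "\<bar>\<phi> u * (g u * ?k u \<omega>)\<bar> \<le> c * indicator {0..T} u"
    if \<phi>: "\<phi> \<in> borel_measurable borel" "\<And>u. \<bar>\<phi> u\<bar> \<le> 1" and \<omega>: "\<omega> \<in> space M" for \<phi> \<omega> u
  proof -
    have le: "\<bar>\<phi> u * (g u * ?k u \<omega>)\<bar> \<le> c * indicator {0..T} u" for u
    proof -
      have "\<bar>\<phi> u\<bar> * \<bar>g u * ?k u \<omega>\<bar> \<le> 1 * \<bar>g u * ?k u \<omega>\<bar>"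
        by (intro mult_right_mono \<phi>(2)) simp
      then show ?thesis using bnd[of u \<omega>] by (simp add: abs_mult c_def)
    qed
    then show "\<bar>\<phi> u * (g u * ?k u \<omega>)\<bar> \<le> c * indicator {0..T} u" .
    show i: "integrable lborel (\<lambda>u. \<phi> u * (g u * ?k u \<omega>))"
      using \<phi>(1) km1[OF \<omega>] le by (intro Bochner_Integration.integrable_bound[OF cint]) (auto intro!: AE_I2 intro: order_trans[OF _ abs_ge_self])
    show "\<bar>\<integral>u. \<phi> u * (g u * ?k u \<omega>) \<partial>lborel\<bar> \<le> R"
      unfolding R_def using Bochner_Integration.integral_norm_bound_integral[OF i cint] le by simp
  qed
  have meas: "(\<lambda>\<omega>. \<integral>u. \<phi> u * (g u * ?k u \<omega>) \<partial>lborel) \<in> borel_measurable M"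
    if \<phi>[measurable]: "\<phi> \<in> borel_measurable borel" for \<phi>
  proof (rule lborel.borel_measurable_lebesgue_integral)
    have [measurable]: "(\<lambda>z. ?k (snd z) (fst z)) \<in> borel_measurable (M \<Otimes>\<^sub>M lborel)"
      using measurable_compose[OF _ km, of "\<lambda>z. (snd z, fst z)" "M \<Otimes>\<^sub>M lborel"] by simp
    show "(\<lambda>(\<omega>, u). \<phi> u * (g u * ?k u \<omega>)) \<in> borel_measurable (M \<Otimes>\<^sub>M lborel)"
      unfolding case_prod_beta' by measurable
  qed
  have intM: "integrable M (\<lambda>\<omega>. (\<integral>u. \<phi> u * (g u * ?k u \<omega>) \<partial>lborel) ^ n)"
    if \<phi>: "\<phi> \<in> borel_measurable borel" "\<And>u. \<bar>\<phi> u\<bar> \<le> 1" for \<phi> n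
    using meas[OF \<phi>(1)] le_R[OF \<phi>]
    by (intro integrable_const_bound[of _ "R ^ n"]) (auto simp: power_abs intro!: AE_I2 power_mono)
  have iq: "integrable lborel (\<lambda>u. \<bar>g u\<bar> powr (2 * q))"
  proof (rule Bochner_Integration.integrable_bound)
    show "integrable lborel (\<lambda>u. B powr (2 * q) * indicator {0..T} u)" by (rule iT)
    show "AE u in lborel. norm (\<bar>g u\<bar> powr (2 * q)) \<le> norm (B powr (2 * q) * indicator {0..T} u)"
    proof (rule AE_I2)
      fix u
      show "norm (\<bar>g u\<bar> powr (2 * q)) \<le> norm (B powr (2 * q) * indicator {0..T} u)"
      proof (cases "g u = 0")
        case False
        then have "u \<in> {0..T}" using supp[of u] by (auto simp: less_eq_vec_def less_imp_le)
        then show ?thesis using B[of u] q by (auto intro!: powr_mono2)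
      qed simp
    qed
  qed measurable

  \<comment> \<open>Side \<open>i\<close> of the box \<open>a\<close> runs from 2^(-a_i - 1) to
    2^(-a_i) times T_i, excluding the lower end, so the boxes are disjoint.\<close>
  define L where "L a i = T $ i / 2 ^ Suc (a i)" for a i
  define Q :: "('d \<Rightarrow> nat) \<Rightarrow> (real ^ 'd) set" where "Q a = {u. \<forall>i. L a i < u $ i \<and> u $ i \<le> 2 * L a i}" for a
  have Qm[measurable]: "Q a \<in> sets borel" for a unfolding Q_def by measurable
  have L0: "0 < L a i" for a i using T0 by (simp add: L_def)
  have LT: "2 * L a i \<le> T $ i" for a i
    using T0[of i] by (simp add: L_def divide_le_eq mult_le_cancel_left1)
  define w where "w a = (\<Prod>i\<in>UNIV. \<rho> ^ a i)" for a :: "'d \<Rightarrow> nat"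
  have w0: "0 < w a" for a unfolding w_def using \<rho> by (intro prod_pos) auto
  have box: "expectation (\<lambda>\<omega>. (\<integral>u. indicator (Q a) u * (g u * ?k u \<omega>) \<partial>lborel) ^ (2 * h)) \<le> D * w a ^ (2 * h)" for a
  proof -
    note b = moment_sign_kernel_box_le[OF T0 h L0[of a] LT[of a] g B, folded Q_def]
    let ?J = "\<integral>u. indicator (Q a) u * (g u)\<^sup>2 \<partial>lborel"
    have Lpos: "0 < (\<Prod>i\<in>UNIV. L a i)" using L0 by (intro prod_pos) auto
    have "?J \<le> A powr (1 / q) * (\<Prod>i\<in>UNIV. L a i) powr (1 - 1 / q)"
      unfolding A_def by (rule integral_square_le_powr[OF q _ b(4) Lpos b(3) b(2) iq]) simp
    also have "\<dots> \<le> A powr (1 / q) * (V powr (1 - 1 / q) * (w a)\<^sup>2)"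
    proof (rule mult_left_mono)
      have pw: "((1 / 2 :: real) ^ n) powr s = ((1 / 2) powr s) ^ n" for n s
      proof (induction n)
        case (Suc n)
        then show ?case by (subst power_Suc, subst powr_mult) auto
      qed simp
      have "(\<Prod>i\<in>UNIV. L a i) \<le> (\<Prod>i\<in>UNIV. T $ i * (1 / 2) ^ a i)"
        using T0 by (intro prod_mono) (auto simp: L_def power_one_over field_simps less_imp_le)
      also have "\<dots> = V * (1 / 2) ^ (\<Sum>i\<in>UNIV. a i)"
        by (simp add: prod.distrib V_def power_sum)
      finally have "(\<Prod>i\<in>UNIV. L a i) powr (1 - 1 / q) \<le> (V * (1 / 2) ^ (\<Sum>i\<in>UNIV. a i)) powr (1 - 1 / q)"
        using q Lpos by (intro powr_mono2) auto
      also have "\<dots> = V powr (1 - 1 / q) * (\<rho>\<^sup>2) ^ (\<Sum>i\<in>UNIV. a i)"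
        using V0 by (simp add: powr_mult pw \<rho>2)
      also have "(\<rho>\<^sup>2) ^ (\<Sum>i\<in>UNIV. a i) = (w a)\<^sup>2"
        by (simp only: w_def power_sum[symmetric] power_mult[symmetric] mult.commute)
      finally show "(\<Prod>i\<in>UNIV. L a i) powr (1 - 1 / q) \<le> V powr (1 - 1 / q) * (w a)\<^sup>2" .
    qed simp
    finally have J: "?J \<le> A powr (1 / q) * (V powr (1 - 1 / q) * (w a)\<^sup>2)" .
    have "expectation (\<lambda>\<omega>. (\<integral>u. indicator (Q a) u * (g u * ?k u \<omega>) \<partial>lborel) ^ (2 * h)) \<le> C0 * ?J ^ h"
      using b(1) by (simp add: C0_def mult.assoc)
    also have "\<dots> \<le> C0 * (A powr (1 / q) * (V powr (1 - 1 / q) * (w a)\<^sup>2)) ^ h"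
      by (intro mult_left_mono power_mono J C0 Bochner_Integration.integral_nonneg) simp
    also have "\<dots> = D * w a ^ (2 * h)"
      unfolding D_def power_mult power_mult_distrib by (simp only: mult_ac)
    finally show ?thesis .
  qed

  define S where "S K = PiE (UNIV :: 'd set) (\<lambda>_. {..<K})" for K :: nat
  have finS: "finite (S K)" for K unfolding S_def by (intro finite_PiE) auto
  define W where "W K = (\<Sum>a\<in>S K. w a)" for K
  have W: "W K \<le> (1 / (1 - \<rho>)) ^ ?d" for K
  proof -
    have "W K = (\<Prod>i\<in>(UNIV :: 'd set). \<Sum>l<K. \<rho> ^ l)"
      unfolding W_def w_def S_def by (subst prod_sum_PiE) auto
    also have "\<dots> \<le> (\<Prod>i\<in>(UNIV :: 'd set). 1 / (1 - \<rho>))"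
    proof (intro prod_mono conjI sum_nonneg)
      show "(\<Sum>l<K. \<rho> ^ l) \<le> 1 / (1 - \<rho>)"
        using \<rho> by (simp add: sum_gp_strict divide_right_mono)
    qed (use \<rho> in auto)
    finally show ?thesis by simp
  qed
  define \<psi> where "\<psi> K u = (\<Sum>a\<in>S K. indicator (Q a) u :: real)" for K and u :: "real ^ 'd"
  have \<psi>m[measurable]: "\<psi> K \<in> borel_measurable borel" for K
    unfolding \<psi>_def by (intro borel_measurable_sum borel_measurable_indicator) simp
  \<comment> \<open>In each direction the dyadic intervals telescope, so the boxes with indices
    below \<open>K\<close> fill exactly the region where every u_i lies above 2^(-K) T_i and not
    above T_i.\<close>
  have \<psi>: "\<psi> K u = (\<Prod>i\<in>UNIV. of_bool (u $ i \<le> T $ i) - of_bool (u $ i \<le> T $ i / 2 ^ K))" for K u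
  proof -
    have "indicator (Q a) u = (\<Prod>i\<in>UNIV. of_bool (u $ i \<le> T $ i / 2 ^ a i) - of_bool (u $ i \<le> T $ i / 2 ^ Suc (a i)) :: real)" for a
    proof -
      have "of_bool (u $ i \<le> T $ i / 2 ^ a i) - of_bool (u $ i \<le> T $ i / 2 ^ Suc (a i)) =
        (of_bool (L a i < u $ i \<and> u $ i \<le> 2 * L a i) :: real)" for i
        using L0[of a i] by (auto simp: L_def)
      then show ?thesis
        by (simp add: indicator_def Q_def prod_zero_iff)
    qed
    then have "\<psi> K u = (\<Prod>i\<in>UNIV. \<Sum>l<K. of_bool (u $ i \<le> T $ i / 2 ^ l) - of_bool (u $ i \<le> T $ i / 2 ^ Suc l))"
      unfolding \<psi>_def S_def by (subst prod_sum_PiE) auto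
    also have "\<dots> = (\<Prod>i\<in>UNIV. of_bool (u $ i \<le> T $ i) - of_bool (u $ i \<le> T $ i / 2 ^ K))"
      by (subst sum_lessThan_telescope') simp
    finally show ?thesis .
  qed
  have \<psi>1: "\<bar>\<psi> K u\<bar> \<le> 1" for K u
    unfolding \<psi> by (auto simp: abs_prod intro!: prod_le_1)
  have step: "expectation (\<lambda>\<omega>. (\<integral>u. \<psi> K u * (g u * ?k u \<omega>) \<partial>lborel) ^ (2 * h)) \<le> ((1 / (1 - \<rho>)) ^ ?d) ^ (2 * h) * D"
    if K: "0 < K" for K
  proof -
    \<comment> \<open>A nonempty index set makes the total weight positive, as the normalisation in
      Jensen's inequality requires.\<close>
    have SK: "S K \<noteq> {}" using K by (auto simp: S_def PiE_eq_empty_iff)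
    have WK: "0 < W K" unfolding W_def using SK finS w0 by (intro sum_pos) auto
    define I where "I a \<omega> = (\<integral>u. indicator (Q a) u * (g u * ?k u \<omega>) \<partial>lborel)" for a \<omega>
    have ind: "(indicator (Q a) :: _ \<Rightarrow> real) \<in> borel_measurable borel" "\<bar>indicator (Q a) u :: real\<bar> \<le> 1" for a u
      by (auto simp: indicator_def)
    have II: "integrable M (\<lambda>\<omega>. (I a \<omega>) ^ n)" for a n
      unfolding I_def by (rule intM[OF ind])
    have "expectation (\<lambda>\<omega>. (\<integral>u. \<psi> K u * (g u * ?k u \<omega>) \<partial>lborel) ^ (2 * h))
      \<le> expectation (\<lambda>\<omega>. W K ^ (2 * h) * (\<Sum>a\<in>S K. w a / W K * (I a \<omega> / w a) ^ (2 * h)))"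
    proof (rule integral_mono)
      show "integrable M (\<lambda>\<omega>. (\<integral>u. \<psi> K u * (g u * ?k u \<omega>) \<partial>lborel) ^ (2 * h))"
        by (rule intM[OF \<psi>m \<psi>1])
      show "integrable M (\<lambda>\<omega>. W K ^ (2 * h) * (\<Sum>a\<in>S K. w a / W K * (I a \<omega> / w a) ^ (2 * h)))"
        unfolding power_divide
        by (intro integrable_mult_right Bochner_Integration.integrable_sum integrable_divide II)
      fix \<omega> assume \<omega>: "\<omega> \<in> space M"
      have "(\<integral>u. \<psi> K u * (g u * ?k u \<omega>) \<partial>lborel) = (\<Sum>a\<in>S K. I a \<omega>)"
        unfolding \<psi>_def I_def sum_distrib_right
        by (rule Bochner_Integration.integral_sum) (rule int[OF ind \<omega>])
      then show "(\<integral>u. \<psi> K u * (g u * ?k u \<omega>) \<partial>lborel) ^ (2 * h)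
        \<le> W K ^ (2 * h) * (\<Sum>a\<in>S K. w a / W K * (I a \<omega> / w a) ^ (2 * h))"
        unfolding W_def using sum_power_even_le[OF finS SK w0, of "2 * h" "\<lambda>a. I a \<omega>"] by simp
    qed
    also have "\<dots> = W K ^ (2 * h) * (\<Sum>a\<in>S K. w a / W K * (expectation (\<lambda>\<omega>. I a \<omega> ^ (2 * h)) / w a ^ (2 * h)))"
      unfolding power_divide using II
      by (subst integral_mult_right_zero, subst Bochner_Integration.integral_sum) auto
    also have "\<dots> \<le> W K ^ (2 * h) * (\<Sum>a\<in>S K. w a / W K * D)"
    proof (intro mult_left_mono sum_mono)
      fix a
      show "expectation (\<lambda>\<omega>. I a \<omega> ^ (2 * h)) / w a ^ (2 * h) \<le> D"
        unfolding I_def using box[of a] w0[of a] by (simp add: divide_le_eq)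
    qed (use WK w0 in \<open>auto intro: less_imp_le\<close>)
    also have "(\<Sum>a\<in>S K. w a / W K * D) = D"
      using WK by (simp add: sum_distrib_right[symmetric] sum_divide_distrib[symmetric] W_def[symmetric])
    also have "W K ^ (2 * h) * D \<le> ((1 / (1 - \<rho>)) ^ ?d) ^ (2 * h) * D"
      using W[of K] WK D0 by (intro mult_right_mono power_mono) auto
    finally show ?thesis .
  qed
  have lim_in: "(\<lambda>K. \<integral>u. \<psi> K u * (g u * ?k u \<omega>) \<partial>lborel) \<longlonglongrightarrow> (\<integral>u. g u * ?k u \<omega> \<partial>lborel)" if \<omega>: "\<omega> \<in> space M" for \<omega>
  proof (rule integral_dominated_convergence)
    show "integrable lborel (\<lambda>u. c * indicator {0..T} u)" by (rule cint)
    show "(\<lambda>u. g u * ?k u \<omega>) \<in> borel_measurable lborel" using km1[OF \<omega>] by simp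
    show "(\<lambda>u. \<psi> K u * (g u * ?k u \<omega>)) \<in> borel_measurable lborel" for K using km1[OF \<omega>] by simp
    show "AE u in lborel. norm (\<psi> K u * (g u * ?k u \<omega>)) \<le> c * indicator {0..T} u" for K
      using le_c[OF \<psi>m \<psi>1 \<omega>] by simp
    show "AE u in lborel. (\<lambda>K. \<psi> K u * (g u * ?k u \<omega>)) \<longlonglongrightarrow> g u * ?k u \<omega>"
    proof (rule AE_I2)
      fix u
      show "(\<lambda>K. \<psi> K u * (g u * ?k u \<omega>)) \<longlonglongrightarrow> g u * ?k u \<omega>"
      proof (cases "g u = 0")
        case False
        have "eventually (\<lambda>K. T $ i / 2 ^ K < u $ i) sequentially" for i
        proof -
          have "(\<lambda>K. T $ i / 2 ^ K) \<longlonglongrightarrow> 0"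
            by (rule LIMSEQ_divide_realpow_zero) simp
          then show ?thesis using supp[OF False, of i] by (intro order_tendstoD(2)) auto
        qed
        \<comment> \<open>On the support of \<open>g\<close> all coordinates are positive, so every
          point lies in one of the boxes and the cutoff is eventually 1.\<close>
        then have "eventually (\<lambda>K. \<forall>i. T $ i / 2 ^ K < u $ i) sequentially"
          by (intro eventually_all_finite)
        then have "eventually (\<lambda>K. \<psi> K u * (g u * ?k u \<omega>) = g u * ?k u \<omega>) sequentially"
        proof eventually_elim
          case (elim K)
          then have "\<psi> K u = 1"
            unfolding \<psi> using supp[OF False] by (intro prod.neutral) (auto simp: not_le)
          then show ?case by simp
        qed
        then show ?thesis by (rule tendsto_eventually)
      qed simp
    qed
  qed
  have "(\<lambda>K. expectation (\<lambda>\<omega>. (\<integral>u. \<psi> K u * (g u * ?k u \<omega>) \<partial>lborel) ^ (2 * h)))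
    \<longlonglongrightarrow> expectation (\<lambda>\<omega>. (\<integral>u. g u * ?k u \<omega> \<partial>lborel) ^ (2 * h))"
  proof (rule integral_dominated_convergence)
    show "integrable M (\<lambda>_. R ^ (2 * h))" by simp
    show "(\<lambda>\<omega>. (\<integral>u. g u * ?k u \<omega> \<partial>lborel) ^ (2 * h)) \<in> borel_measurable M"
      using meas[of "\<lambda>_. 1"] by simp
    show "(\<lambda>\<omega>. (\<integral>u. \<psi> K u * (g u * ?k u \<omega>) \<partial>lborel) ^ (2 * h)) \<in> borel_measurable M" for K
      using meas[OF \<psi>m] by simp
    show "AE \<omega> in M. (\<lambda>K. (\<integral>u. \<psi> K u * (g u * ?k u \<omega>) \<partial>lborel) ^ (2 * h)) \<longlonglongrightarrow> (\<integral>u. g u * ?k u \<omega> \<partial>lborel) ^ (2 * h)"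
      by (intro AE_I2 tendsto_power lim_in)
    show "AE \<omega> in M. norm ((\<integral>u. \<psi> K u * (g u * ?k u \<omega>) \<partial>lborel) ^ (2 * h)) \<le> R ^ (2 * h)" for K
      unfolding real_norm_def power_abs by (intro AE_I2 power_mono le_R \<psi>m \<psi>1) auto
  qed
  then have "expectation (\<lambda>\<omega>. (\<integral>u. g u * ?k u \<omega> \<partial>lborel) ^ (2 * h)) \<le> ((1 / (1 - \<rho>)) ^ ?d) ^ (2 * h) * D"
    using step by (intro LIMSEQ_le_const2) (auto intro!: exI[of _ 1])
  then show ?thesis
    by (simp add: D_def C0_def A_def V_def \<rho>_def power_mult[symmetric] mult_ac)
qed

end

section \<open>Simple functions and the final bound\<close>

lemma simple_fun_on_measurable:
  assumes "simple_fun_on T g"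
  shows "g \<in> borel_measurable borel"
proof -
  obtain k :: nat and a s t where g: "g = (\<lambda>u. \<Sum>j<k. a j * indicator (rect (s j) (t j)) u)"
    using assms unfolding simple_fun_on_def by blast
  have "rect (s j) (t j) \<in> sets borel" for j
    unfolding rect_def by (rule sets_vec_box)
  then show ?thesis
    unfolding g by (intro borel_measurable_sum borel_measurable_times borel_measurable_indicator) auto
qed

lemma simple_fun_on_bounded:
  assumes "simple_fun_on T g"
  shows "\<exists>B. \<forall>u. \<bar>g u\<bar> \<le> B"
proof -
  obtain k :: nat and a s t where g: "g = (\<lambda>u. \<Sum>j<k. a j * indicator (rect (s j) (t j)) u)"
    using assms unfolding simple_fun_on_def by blast
  have "\<bar>g u\<bar> \<le> (\<Sum>j<k. \<bar>a j\<bar>)" for u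
    unfolding g by (intro order_trans[OF sum_abs] sum_mono) (auto simp: indicator_def)
  then show ?thesis by blast
qed

text \<open>A rectangle open at its lower faces and contained in \<open>[0, T]\<close> cannot meet
  an axis. The positivity of the coordinates matters because the dyadic boxes do not cover the
  axes.\<close>

lemma simple_fun_on_support:
  assumes "simple_fun_on T g" "g u \<noteq> 0"
  shows "0 < u $ i \<and> u $ i \<le> T $ i"
proof -
  obtain k :: nat and a s t where sub: "\<And>j. j < k \<Longrightarrow> rect (s j) (t j) \<subseteq> {0..T}"
    and g: "g = (\<lambda>u. \<Sum>j<k. a j * indicator (rect (s j) (t j)) u)"
    using assms(1) unfolding simple_fun_on_def by blast
  obtain j where j: "j < k" and u: "u \<in> rect (s j) (t j)"
    using assms(2) unfolding g by (auto simp: indicator_def elim!: sum.not_neutral_contains_not_neutral split: if_splits)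
  have "u \<in> {0..T}" using sub[OF j] u by blast
  moreover have "u $ i \<noteq> 0"
  proof
    assume "u $ i = 0"
    \<comment> \<open>If u_i were 0, then s_i would be negative, and moving this coordinate to s_i /
      2 would stay in the rectangle but leave \<open>[0, T]\<close>.\<close>
    define v where "v = (\<chi> k. if k = i then s j $ i / 2 else u $ k)"
    have "s j $ i < u $ i" using u by (simp add: rect_def)
    with \<open>u $ i = 0\<close> have "s j $ i < 0" by simp
    then have "v \<in> rect (s j) (t j)"
      using u \<open>u $ i = 0\<close> by (auto simp: v_def rect_def) (smt (verit))
    then have "0 \<le> v $ i" using sub[OF j] by (auto simp: less_eq_vec_def)
    then show False using \<open>s j $ i < 0\<close> by (simp add: v_def)
  qed
  ultimately show ?thesis by (auto simp: less_eq_vec_def less_le)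
qed

theorem proposition3p2:
  fixes M :: "'w measure"
    and T :: "real ^ 'd"
    and N :: "nat \<Rightarrow> real ^ 'd \<Rightarrow> 'w \<Rightarrow> nat"
    and q :: real
    and m :: nat
  assumes "prob_space M"
    and "\<And>i. 0 < T $ i"
    and "\<And>n. 1 \<le> n \<Longrightarrow>
      poisson_process M T (natural_filtration M (\<lambda>t \<omega>. real (N n t \<omega>))) (real n)
        (\<lambda>t \<omega>. real (N n t \<omega>))"
    and "1 < q"
    and "even m" and "0 < m"
  shows "\<exists>C>0. \<forall>n\<ge>1. \<forall>g. simple_fun_on T g \<longrightarrow>
    prob_space.expectation M
      (\<lambda>\<omega>. (LINT u:{0..T}|lborel. g u * kac_stroock n (N n) u \<omega>) ^ m)
    \<le> C * (LINT u:{0..T}|lborel. \<bar>g u\<bar> powr (2 * q)) powr (real m / (2 * q))"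
proof -
  obtain h where m: "m = 2 * h" using \<open>even m\<close> by blast
  have h: "0 < h" using \<open>0 < m\<close> m by simp
  define C where "C = (1 / (1 - sqrt ((1 / 2) powr (1 - 1 / q)))) ^ (CARD('d) * (2 * h)) *
    (fact (2 * h) ^ CARD('d) * ((2 ^ CARD('d)) ^ (CARD('d) - 1)) ^ h * ((\<Prod>i\<in>UNIV. T $ i) powr (1 - 1 / q)) ^ h)"
  have "(1 / 2 :: real) powr (1 - 1 / q) < (1 / 2) powr 0"
    using \<open>1 < q\<close> by (intro powr_less_mono') auto
  then have "0 < 1 - sqrt ((1 / 2) powr (1 - 1 / q))" by simp
  moreover have "0 < (\<Prod>i\<in>UNIV. T $ i)" using assms(2) by (intro prod_pos) auto
  ultimately have C: "0 < C" unfolding C_def by (intro mult_pos_pos zero_less_power divide_pos_pos) (auto simp: less_imp_neq[OF assms(2), symmetric])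
  have "prob_space.expectation M (\<lambda>\<omega>. (LINT u:{0..T}|lborel. g u * kac_stroock n (N n) u \<omega>) ^ m)
    \<le> C * (LINT u:{0..T}|lborel. \<bar>g u\<bar> powr (2 * q)) powr (real m / (2 * q))"
    if n: "1 \<le> n" and g: "simple_fun_on T g" for n g
  proof -
    interpret poisson_sheet M T "N n" "real n"
      using assms(3)[OF n] by (simp add: poisson_sheet_def)
    obtain B where B: "\<And>u. \<bar>g u\<bar> \<le> B" using simple_fun_on_bounded[OF g] by blast
    have in_T: "u \<in> {0..T}" if "g u \<noteq> 0" for u
      using simple_fun_on_support[OF g that] by (auto simp: less_eq_vec_def less_imp_le)
    have 1: "(LINT u:{0..T}|lborel. g u * kac_stroock n (N n) u \<omega>) = (\<integral>u. g u * sign_kernel u \<omega> \<partial>lborel)" for \<omega>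
      unfolding set_lebesgue_integral_def
    proof (rule Bochner_Integration.integral_cong[OF refl])
      fix u
      show "indicator {0..T} u *\<^sub>R (g u * kac_stroock n (N n) u \<omega>) = g u * sign_kernel u \<omega>"
        using in_T[of u] by (cases "g u = 0") (simp_all add: kac_stroock_def sign_kernel_def clamped_sign_eq)
    qed
    have 2: "(LINT u:{0..T}|lborel. \<bar>g u\<bar> powr (2 * q)) = (\<integral>u. \<bar>g u\<bar> powr (2 * q) \<partial>lborel)"
      unfolding set_lebesgue_integral_def
    proof (rule Bochner_Integration.integral_cong[OF refl])
      fix u
      show "indicator {0..T} u *\<^sub>R (\<bar>g u\<bar> powr (2 * q)) = \<bar>g u\<bar> powr (2 * q)"
        using in_T[of u] by (cases "g u = 0") simp_all
    qed
    \<comment> \<open>The case \<open>x = 0\<close> relies on \<open>0 powr r = 0\<close> and on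
      \<open>0 < h\<close>.\<close>
    have 3: "(x powr (1 / q)) ^ h = x powr (real m / (2 * q))" if "0 \<le> x" for x :: real
      using that h by (cases "x = 0") (simp_all add: m powr_realpow[symmetric] powr_powr)
    show ?thesis
      unfolding 1 2 C_def m
      using moment_sign_kernel_le[OF assms(2) h \<open>1 < q\<close> simple_fun_on_measurable[OF g] B simple_fun_on_support[OF g]]
      by (subst 3[unfolded m, symmetric]) auto
  qed
  with C show ?thesis by blast
qed

end
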